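(* Let $\mathbb{E}=(\mathbb{E}_\alpha)_{\alpha>\alpha_*}$ be a scale of Banach spaces. Suppose that $(V(s,t))_{t\ge s\ge0}\subset L(\mathbb{E})$ satisfies (A2)$^*$ and (A4)$^*$ with constant $K\ge1$, and that $(B(t))_{t\ge0}\subset L(\mathbb{E})$ satisfies (B1) and (B2) with function $M$ (conditions in the context). Define $T(\alpha',\alpha):=\frac{\alpha-\alpha'}{2KeM(\alpha)}$, $\alpha'<\alpha$, with the convention $1/0:=+\infty$. Then there exists a family of operators $$\{W_{\alpha\alpha'}(s,t)\in L(\mathbb{E}_\alpha,\mathbb{E}_{\alpha'})\mid\alpha'<\alpha,\ 0\le s\le t,\ t-s<T(\alpha',\alpha)\}$$ with the following properties. (a) For any $\alpha'<\alpha$, the map $(s,t)\mapsto W_{\alpha\alpha'}(s,t)$, $0\le t-s<T(\alpha',\alpha)$, is strongly continuous on $L(\mathbb{E}_\alpha,\mathbb{E}_{\alpha'})$, $W_{\alpha\alpha'}(t,t)=i_{\alpha\alpha'}$, and $$\|W_{\alpha\alpha'}(s,t)\|_{\alpha\alpha'}\le\frac{T(\alpha',\alpha)}{T(\alpha',\alpha)-(t-s)}K$$ (the fraction being read as $1$ if $T(\alpha',\alpha)=+\infty$). (b) For all $\alpha'<\alpha''<\alpha$ with $0\le t-s<\min\{T(\alpha',\alpha),T(\alpha'',\alpha)\}$ we have $W_{\alpha\alpha'}(s,t)=i_{\alpha''\alpha'}W_{\alpha\alpha''}(s,t)$, and for all $\alpha'<\alpha''<\alpha$ with $0\le t-s<\min\{T(\alpha',\alpha),T(\alpha',\alpha'')\}$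 we have $W_{\alpha\alpha'}(s,t)=W_{\alpha''\alpha'}(s,t)i_{\alpha\alpha''}$. (c) For all $\alpha'<\alpha''<\alpha$ with $0\le t-s<\min\{T(\alpha',\alpha),T(\alpha',\alpha'')\}$ and all $k\in\mathbb{E}_\alpha$, $$W_{\alpha\alpha'}(s,t)k=V_{\alpha\alpha'}(s,t)k+\int_s^tW_{\alpha''\alpha'}(s,r)(B(r)V(r,t))_{\alpha\alpha''}k\,dr.$$ Moreover, $W$ is unique with this property, i.e. any family of operators with the same index set which satisfies (a), (b) and this integral equation coincides with $W$. (d) For all $\alpha'<\alpha''<\alpha$ with $0\le t-s<\min\{T(\alpha',\alpha),T(\alpha'',\alpha)\}$ and all $k\in\mathbb{E}_\alpha$, $$W_{\alpha\alpha'}(s,t)k=V_{\alpha\alpha'}(s,t)k+\int_s^t(V(s,r)B(r))_{\alpha''\alpha'}W_{\alpha\alpha''}(r,t)k\,dr.$$ Moreover, $W$ is also unique with this property, i.e. any family of operators with the same index set which satisfies (a), (b) and this integral equation coincides with $W$.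
   Context: Scale of Banach spaces: $\alpha_*\in\mathbb{R}$ is fixed and $\mathbb{E}=(\mathbb{E}_\alpha)_{\alpha>\alpha_*}$ is a family of Banach spaces with $\mathbb{E}_\alpha\subset\mathbb{E}_{\alpha'}$ and $\|\cdot\|_{\alpha'}\le\|\cdot\|_\alpha$ for $\alpha'<\alpha$. Writing $\alpha'<\alpha$ always includes $\alpha'>\alpha_*$. $i_{\alpha\alpha'}\in L(\mathbb{E}_\alpha,\mathbb{E}_{\alpha'})$ denotes the embedding; $\|\cdot\|_{\alpha\alpha'}$ is the operator norm on $L(\mathbb{E}_\alpha,\mathbb{E}_{\alpha'})$. $L(\mathbb{E})$ is the set of collections $A=(A_{\alpha\alpha'})_{\alpha'<\alpha}$, $A_{\alpha\alpha'}\in L(\mathbb{E}_\alpha,\mathbb{E}_{\alpha'})$, with $A_{\alpha''\alpha'}=i_{\alpha\alpha'}A_{\alpha''\alpha}=A_{\alpha\alpha'}i_{\alpha''\alpha}$ for all $\alpha'<\alpha<\alpha''$. Composition in $L(\mathbb{E})$: $(AB)_{\alpha\alpha'}:=A_{\beta\alpha'}B_{\alpha\beta}$ for any $\beta\in(\alpha',\alpha)$ (independent of $\beta$). (A2)$^*$ $V(s,t)\in L(\mathbb{E})$ for all $t\ge s\ge0$, $V_{\alpha\alpha'}(t,t)=i_{\alpha\alpha'}$ for all $\alpha'<\alpha$, $t\ge0$, and for any $\alpha'<\alpha$, $k\in\mathbb{E}_\alpha$ the map $(s,t)\mapsto V_{\alpha\alpha'}(s,t)k$ is continuous in $\mathbb{E}_{\alpha'}$.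 (A4)$^*$ There is a constant $K\ge1$ with $\|V_{\alpha\alpha'}(s,t)\|_{\alpha\alpha'}\le K$ for all $0\le s\le t$ and $\alpha'<\alpha$. (B1) For all $\alpha'<\alpha$ and $k\in\mathbb{E}_\alpha$, $t\mapsto B_{\alpha\alpha'}(t)k\in\mathbb{E}_{\alpha'}$ is continuous on $[0,\infty)$. (B2) There is an increasing continuous function $M:(\alpha_*,\infty)\to[0,\infty)$ with $\|B_{\alpha\alpha'}(t)\|_{\alpha\alpha'}\le\frac{M(\alpha)}{\alpha-\alpha'}$ for all $t\ge0$, $\alpha'<\alpha$. *)

theory Defs
  imports "HOL-Analysis.Analysis"
begin

section \<open>Normed spaces on carrier sets\<close>

text \<open>
  The spaces of a scale are indexed by a real parameter, so they cannot be types.  They are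
  linear subspaces of one ambient vector space (for instance the union of the scale), each
  with its own norm, of which only the values on the carrier matter.  The scalars
  \<open>'k :: real_normed_field\<close> cover real and complex Banach spaces alike.
\<close>

definition banach_on :: "('k::real_normed_field \<Rightarrow> 'a::ab_group_add \<Rightarrow> 'a) \<Rightarrow> 'a set \<Rightarrow> ('a \<Rightarrow> real) \<Rightarrow> bool"
  where "banach_on smul X p \<longleftrightarrow>
    module.subspace smul X \<and>
    (\<forall>x\<in>X. 0 \<le> p x \<and> (p x = 0 \<longleftrightarrow> x = 0)) \<and>
    (\<forall>x\<in>X. \<forall>y\<in>X. p (x + y) \<le> p x + p y) \<and>
    (\<forall>c. \<forall>x\<in>X. p (smul c x) = norm c * p x) \<and>
    (\<forall>u::nat \<Rightarrow> 'a. range u \<subseteq> X \<and> (\<forall>e>0. \<exists>n0. \<forall>m\<ge>n0. \<forall>n\<ge>n0. p (u m - u n) < e)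
      \<longrightarrow> (\<exists>x\<in>X. (\<lambda>n. p (u n - x)) \<longlonglongrightarrow> 0))"

definition bounded_linear_on ::
    "('k::real_normed_field \<Rightarrow> 'a::ab_group_add \<Rightarrow> 'a) \<Rightarrow>
      'a set \<Rightarrow> ('a \<Rightarrow> real) \<Rightarrow> 'a set \<Rightarrow> ('a \<Rightarrow> real) \<Rightarrow> ('a \<Rightarrow> 'a) \<Rightarrow> bool"
  where "bounded_linear_on smul X p Y q f \<longleftrightarrow>
    f ` X \<subseteq> Y \<and>
    (\<forall>x\<in>X. \<forall>y\<in>X. f (x + y) = f x + f y) \<and>
    (\<forall>c. \<forall>x\<in>X. f (smul c x) = smul c (f x)) \<and>
    (\<exists>C. \<forall>x\<in>X. q (f x) \<le> C * p x)"

text \<open>Relativises \<^const>\<open>onorm\<close>; the supremum is finite for a \<^const>\<open>bounded_linear_on\<close> map.\<close>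

definition onorm_on :: "'a set \<Rightarrow> ('a \<Rightarrow> real) \<Rightarrow> ('a \<Rightarrow> real) \<Rightarrow> ('a \<Rightarrow> 'a) \<Rightarrow> real"
  where "onorm_on X p q f = (SUP x\<in>X. q (f x) / p x)"

definition norm_continuous_on :: "('a::ab_group_add \<Rightarrow> real) \<Rightarrow> 'b::topological_space set \<Rightarrow> ('b \<Rightarrow> 'a) \<Rightarrow> bool"
  where "norm_continuous_on q S f \<longleftrightarrow> (\<forall>z\<in>S. ((\<lambda>w. q (f w - f z)) \<longlongrightarrow> 0) (at z within S))"

text \<open>
  The characterisation \<open>has_integral_cbox\<close> of the library's integral over an interval, with
  convergence in the norm \<open>q\<close> of the carrier \<open>Y\<close>.  For a norm-continuous integrand
  this is the Riemann integral in the Banach space \<open>(Y, q)\<close>.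
\<close>

definition has_integral_on ::
    "('k::real_normed_field \<Rightarrow> 'a::ab_group_add \<Rightarrow> 'a) \<Rightarrow>
      'a set \<Rightarrow> ('a \<Rightarrow> real) \<Rightarrow> (real \<Rightarrow> 'a) \<Rightarrow> 'a \<Rightarrow> real \<Rightarrow> real \<Rightarrow> bool"
  where "has_integral_on smul Y q f I a b \<longleftrightarrow>
    f ` {a..b} \<subseteq> Y \<and> I \<in> Y \<and>
    ((\<lambda>P. q ((\<Sum>(x, J)\<in>P. smul (of_real (measure lborel J)) (f x)) - I)) \<longlongrightarrow> 0)
      (division_filter {a..b})"

lemma onorm_on_UNIV: "onorm_on UNIV norm norm f = onorm f"
  for f :: "'a::real_normed_vector \<Rightarrow> 'a"
  by (simp add: onorm_on_def onorm_def)

lemma norm_continuous_on_norm: "norm_continuous_on norm S f \<longleftrightarrow> continuous_on S f"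
  for f :: "'b::topological_space \<Rightarrow> 'a::real_normed_vector"
proof -
  have "((\<lambda>w. norm (f w - f z)) \<longlongrightarrow> 0) F \<longleftrightarrow> (f \<longlongrightarrow> f z) F" for z F
    by (simp add: tendsto_norm_zero_iff LIM_zero_iff)
  then show ?thesis
    by (simp add: norm_continuous_on_def continuous_on_def)
qed

lemma has_integral_on_UNIV: "has_integral_on scaleR UNIV norm f I a b \<longleftrightarrow> (f has_integral I) {a..b}"
  for f :: "real \<Rightarrow> 'a::real_normed_vector"
proof -
  have "(f has_integral I) {a..b} \<longleftrightarrow>
      ((\<lambda>P. (\<Sum>(x, J)\<in>P. measure lborel J *\<^sub>R f x)) \<longlongrightarrow> I) (division_filter {a..b})"
    using has_integral_cbox[of f I a b] by simp
  then show ?thesis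
    by (simp add: has_integral_on_def tendsto_norm_zero_iff LIM_zero_iff)
qed

lemma has_integral_on_unique:
  assumes "vector_space smul" "banach_on smul Y q"
    and "has_integral_on smul Y q f I a b" "has_integral_on smul Y q f I' a b"
  shows "I = I'"
proof -
  interpret vector_space smul by fact
  have Y: "subspace Y" and tri: "\<And>x y. x \<in> Y \<Longrightarrow> y \<in> Y \<Longrightarrow> q (x + y) \<le> q x + q y"
    and nn: "\<And>x. x \<in> Y \<Longrightarrow> 0 \<le> q x \<and> (q x = 0 \<longleftrightarrow> x = 0)"
    and hom: "\<And>c x. x \<in> Y \<Longrightarrow> q (smul c x) = norm c * q x"
    using assms(2) by (auto simp: banach_on_def)
  let ?S = "\<lambda>P. \<Sum>(x, J)\<in>P. smul (of_real (measure lborel J)) (f x)"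
  let ?F = "division_filter {a..b}"
  have I: "I \<in> Y" "I' \<in> Y" and f: "f ` {a..b} \<subseteq> Y"
    and lims: "((\<lambda>P. q (?S P - I)) \<longlongrightarrow> 0) ?F" "((\<lambda>P. q (?S P - I')) \<longlongrightarrow> 0) ?F"
    using assms(3,4) unfolding has_integral_on_def by simp_all
  have lim: "((\<lambda>P. q (?S P - I) + q (?S P - I')) \<longlongrightarrow> 0 + 0) ?F"
    by (rule tendsto_add[OF lims])
  have "q (I - I') \<le> q (?S P - I) + q (?S P - I')" if "P tagged_division_of {a..b}" for P
  proof -
    have "?S P \<in> Y"
      using that f by (auto intro!: subspace_sum[OF Y] subspace_scale[OF Y] dest: tag_in_interval)
    then have d: "?S P - I \<in> Y" "?S P - I' \<in> Y"
      using I Y by (auto intro: subspace_diff)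
    have "smul (- 1) (?S P - I) = I - ?S P"
      by (simp add: scale_minus_left)
    then have "q (I - ?S P) = q (?S P - I)" "I - ?S P \<in> Y"
      using hom[OF d(1), of "- 1"] subspace_scale[OF Y d(1), of "- 1"] by auto
    then show ?thesis
      using tri[of "I - ?S P" "?S P - I'"] d by simp
  qed
  then have "\<forall>\<^sub>F P in ?F. q (I - I') \<le> q (?S P - I) + q (?S P - I')"
    by (rule eventually_mono[OF eventually_division_filter_tagged_division])
  moreover have "?F \<noteq> bot"
    using division_filter_not_empty[of a b] by simp
  ultimately have "q (I - I') \<le> 0"
    using tendsto_lowerbound[OF lim] by simp
  moreover have "0 \<le> q (I - I')" "q (I - I') = 0 \<longleftrightarrow> I - I' = 0"
    using nn[OF subspace_diff[OF Y I]] by blast+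
  ultimately have "I - I' = 0" by (metis order_antisym)
  then show ?thesis by (rule eq_iff_diff_eq_0[THEN iffD2])
qed


section \<open>Scales of Banach spaces\<close>

definition banach_scale ::
    "('k::real_normed_field \<Rightarrow> 'a::ab_group_add \<Rightarrow> 'a) \<Rightarrow>
      real \<Rightarrow> (real \<Rightarrow> 'a set) \<Rightarrow> (real \<Rightarrow> 'a \<Rightarrow> real) \<Rightarrow> bool"
  where "banach_scale smul \<alpha>s E N \<longleftrightarrow>
    vector_space smul \<and>
    (\<forall>\<alpha>>\<alpha>s. banach_on smul (E \<alpha>) (N \<alpha>)) \<and>
    (\<forall>\<alpha>' \<alpha>. \<alpha>s < \<alpha>' \<and> \<alpha>' < \<alpha> \<longrightarrow> E \<alpha> \<subseteq> E \<alpha>' \<and> (\<forall>x\<in>E \<alpha>. N \<alpha>' x \<le> N \<alpha> x))"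

text \<open>
  A collection \<open>(A\<^bsub>\<alpha>\<alpha>'\<^esub>)\<close> is a function \<open>A\<close> with \<open>A \<alpha> \<alpha>'\<close> the operator from
  \<open>E \<alpha>\<close> to \<open>E \<alpha>'\<close>; its values matter only on \<open>E \<alpha>\<close>.  Since the spaces are nested subsets,
  the embedding of \<open>E \<alpha>\<close> into \<open>E \<alpha>'\<close> is the identity on \<open>E \<alpha>\<close> and is not written.
\<close>

type_synonym 'a opfam = "real \<Rightarrow> real \<Rightarrow> 'a \<Rightarrow> 'a"

definition scale_ops ::
    "('k::real_normed_field \<Rightarrow> 'a::ab_group_add \<Rightarrow> 'a) \<Rightarrow>
      real \<Rightarrow> (real \<Rightarrow> 'a set) \<Rightarrow> (real \<Rightarrow> 'a \<Rightarrow> real) \<Rightarrow> 'a opfam set"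
  where "scale_ops smul \<alpha>s E N = {A.
    (\<forall>\<alpha>' \<alpha>. \<alpha>s < \<alpha>' \<and> \<alpha>' < \<alpha> \<longrightarrow> bounded_linear_on smul (E \<alpha>) (N \<alpha>) (E \<alpha>') (N \<alpha>') (A \<alpha> \<alpha>')) \<and>
    (\<forall>\<alpha>' \<alpha> \<alpha>''. \<alpha>s < \<alpha>' \<and> \<alpha>' < \<alpha> \<and> \<alpha> < \<alpha>'' \<longrightarrow>
      (\<forall>k\<in>E \<alpha>''. A \<alpha>'' \<alpha>' k = A \<alpha>'' \<alpha> k \<and> A \<alpha>'' \<alpha>' k = A \<alpha> \<alpha>' k))}"

text \<open>The intermediate index is irrelevant (\<open>scale_comp_eq\<close>); the midpoint is chosen.\<close>

definition scale_comp :: "'a opfam \<Rightarrow> 'a opfam \<Rightarrow> 'a opfam"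
  where "scale_comp A B \<alpha> \<alpha>' = A ((\<alpha>' + \<alpha>) / 2) \<alpha>' \<circ> B \<alpha> ((\<alpha>' + \<alpha>) / 2)"

lemma scale_comp_eq:
  assumes A: "A \<in> scale_ops smul \<alpha>s E N" and B: "B \<in> scale_ops smul \<alpha>s E N"
    and "\<alpha>s < \<alpha>'" "\<alpha>' < \<beta>" "\<beta> < \<alpha>" "k \<in> E \<alpha>"
  shows "scale_comp A B \<alpha> \<alpha>' k = A \<beta> \<alpha>' (B \<alpha> \<beta> k)"
proof -
  have compat: "C \<alpha>3 \<alpha>1 x = C \<alpha>3 \<alpha>2 x \<and> C \<alpha>3 \<alpha>1 x = C \<alpha>2 \<alpha>1 x"
    if "C \<in> scale_ops smul \<alpha>s E N" "\<alpha>s < \<alpha>1" "\<alpha>1 < \<alpha>2" "\<alpha>2 < \<alpha>3" "x \<in> E \<alpha>3" for C \<alpha>1 \<alpha>2 \<alpha>3 x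
    using that unfolding scale_ops_def by blast
  have aux: "A \<beta> \<alpha>' (B \<alpha> \<beta> k) = A \<gamma> \<alpha>' (B \<alpha> \<gamma> k)"
    if "\<alpha>' < \<beta>" "\<beta> < \<gamma>" "\<gamma> < \<alpha>" for \<beta> \<gamma>
  proof -
    have "\<alpha>s < \<beta>" "\<alpha>s < \<gamma>" using that \<open>\<alpha>s < \<alpha>'\<close> by auto
    have eq: "B \<alpha> \<beta> k = B \<alpha> \<gamma> k"
      by (rule conjunct1[OF compat[OF B \<open>\<alpha>s < \<beta>\<close> that(2,3) \<open>k \<in> E \<alpha>\<close>]])
    have "bounded_linear_on smul (E \<alpha>) (N \<alpha>) (E \<gamma>) (N \<gamma>) (B \<alpha> \<gamma>)"
      using B that \<open>\<alpha>s < \<gamma>\<close> by (simp add: scale_ops_def)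
    then have mem: "B \<alpha> \<gamma> k \<in> E \<gamma>"
      using \<open>k \<in> E \<alpha>\<close> by (auto simp: bounded_linear_on_def)
    have "A \<gamma> \<alpha>' (B \<alpha> \<gamma> k) = A \<beta> \<alpha>' (B \<alpha> \<gamma> k)"
      by (rule conjunct2[OF compat[OF A \<open>\<alpha>s < \<alpha>'\<close> that(1,2) mem]])
    then show ?thesis by (simp only: eq)
  qed
  define \<gamma> where "\<gamma> = (\<alpha>' + \<alpha>) / 2"
  have "\<alpha>' < \<gamma>" "\<gamma> < \<alpha>" using assms(3-5) by (auto simp: \<gamma>_def)
  have "A \<beta> \<alpha>' (B \<alpha> \<beta> k) = A \<gamma> \<alpha>' (B \<alpha> \<gamma> k)"
  proof (cases \<beta> \<gamma> rule: linorder_cases)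
    case less
    then show ?thesis using aux[OF assms(4) _ \<open>\<gamma> < \<alpha>\<close>] by blast
  next
    case equal
    then show ?thesis by (rule arg_cong)
  next
    case greater
    then show ?thesis by (rule aux[OF \<open>\<alpha>' < \<gamma>\<close> _ assms(5), symmetric])
  qed
  then show ?thesis by (simp add: scale_comp_def \<gamma>_def)
qed


section \<open>Assumptions on the evolution family and on the perturbation\<close>

definition A2_star ::
    "('k::real_normed_field \<Rightarrow> 'a::ab_group_add \<Rightarrow> 'a) \<Rightarrow>
      real \<Rightarrow> (real \<Rightarrow> 'a set) \<Rightarrow> (real \<Rightarrow> 'a \<Rightarrow> real) \<Rightarrow> (real \<Rightarrow> real \<Rightarrow> 'a opfam) \<Rightarrow> bool"
  where "A2_star smul \<alpha>s E N V \<longleftrightarrow>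
    (\<forall>s t. 0 \<le> s \<and> s \<le> t \<longrightarrow> V s t \<in> scale_ops smul \<alpha>s E N) \<and>
    (\<forall>\<alpha>' \<alpha> t. \<alpha>s < \<alpha>' \<and> \<alpha>' < \<alpha> \<and> 0 \<le> t \<longrightarrow> (\<forall>k\<in>E \<alpha>. V t t \<alpha> \<alpha>' k = k)) \<and>
    (\<forall>\<alpha>' \<alpha>. \<alpha>s < \<alpha>' \<and> \<alpha>' < \<alpha> \<longrightarrow>
      (\<forall>k\<in>E \<alpha>. norm_continuous_on (N \<alpha>') {(s, t). 0 \<le> s \<and> s \<le> t} (\<lambda>(s, t). V s t \<alpha> \<alpha>' k)))"

definition A4_star ::
    "real \<Rightarrow> (real \<Rightarrow> 'a set) \<Rightarrow> (real \<Rightarrow> 'a \<Rightarrow> real) \<Rightarrow> real \<Rightarrow> (real \<Rightarrow> real \<Rightarrow> 'a opfam) \<Rightarrow> bool"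
  where "A4_star \<alpha>s E N K V \<longleftrightarrow>
    1 \<le> K \<and>
    (\<forall>s t \<alpha>' \<alpha>. 0 \<le> s \<and> s \<le> t \<and> \<alpha>s < \<alpha>' \<and> \<alpha>' < \<alpha> \<longrightarrow>
      onorm_on (E \<alpha>) (N \<alpha>) (N \<alpha>') (V s t \<alpha> \<alpha>') \<le> K)"

definition B1 ::
    "real \<Rightarrow> (real \<Rightarrow> 'a::ab_group_add set) \<Rightarrow> (real \<Rightarrow> 'a \<Rightarrow> real) \<Rightarrow> (real \<Rightarrow> 'a opfam) \<Rightarrow> bool"
  where "B1 \<alpha>s E N B \<longleftrightarrow>
    (\<forall>\<alpha>' \<alpha>. \<alpha>s < \<alpha>' \<and> \<alpha>' < \<alpha> \<longrightarrow>
      (\<forall>k\<in>E \<alpha>. norm_continuous_on (N \<alpha>') {0..} (\<lambda>t. B t \<alpha> \<alpha>' k)))"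

text \<open>``Increasing'' is non-strict: the convention for \<open>M \<alpha> = 0\<close> below would otherwise be void.\<close>

definition B2 ::
    "real \<Rightarrow> (real \<Rightarrow> 'a set) \<Rightarrow> (real \<Rightarrow> 'a \<Rightarrow> real) \<Rightarrow> (real \<Rightarrow> real) \<Rightarrow> (real \<Rightarrow> 'a opfam) \<Rightarrow> bool"
  where "B2 \<alpha>s E N M B \<longleftrightarrow>
    mono_on {\<alpha>s<..} M \<and> continuous_on {\<alpha>s<..} M \<and> (\<forall>\<alpha>>\<alpha>s. 0 \<le> M \<alpha>) \<and>
    (\<forall>t \<alpha>' \<alpha>. 0 \<le> t \<and> \<alpha>s < \<alpha>' \<and> \<alpha>' < \<alpha> \<longrightarrow>
      onorm_on (E \<alpha>) (N \<alpha>) (N \<alpha>') (B t \<alpha> \<alpha>') \<le> M \<alpha> / (\<alpha> - \<alpha>'))"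


section \<open>The perturbed family\<close>

definition horizon :: "real \<Rightarrow> (real \<Rightarrow> real) \<Rightarrow> real \<Rightarrow> real \<Rightarrow> ereal"
  where "horizon K M \<alpha>' \<alpha> = (if M \<alpha> = 0 then \<infinity> else ereal ((\<alpha> - \<alpha>') / (2 * K * exp 1 * M \<alpha>)))"

text \<open>
  Below \<open>T\<close> stands for \<^term>\<open>horizon K M\<close>, and \<open>W s t \<alpha> \<alpha>'\<close> is meaningful only on the index
  set \<open>\<alpha>s < \<alpha>' < \<alpha>\<close>, \<open>0 \<le> s \<le> t\<close>, \<open>t - s < T \<alpha>' \<alpha>\<close>, which depends on \<open>\<alpha>\<close> and \<open>\<alpha>'\<close>.
\<close>

definition local_family ::
    "('k::real_normed_field \<Rightarrow> 'a::ab_group_add \<Rightarrow> 'a) \<Rightarrow> real \<Rightarrow> (real \<Rightarrow> 'a set) \<Rightarrow>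
      (real \<Rightarrow> 'a \<Rightarrow> real) \<Rightarrow> (real \<Rightarrow> real \<Rightarrow> ereal) \<Rightarrow> (real \<Rightarrow> real \<Rightarrow> 'a opfam) \<Rightarrow> bool"
  where "local_family smul \<alpha>s E N T W \<longleftrightarrow>
    (\<forall>\<alpha>' \<alpha> s t. \<alpha>s < \<alpha>' \<and> \<alpha>' < \<alpha> \<and> 0 \<le> s \<and> s \<le> t \<and> ereal (t - s) < T \<alpha>' \<alpha> \<longrightarrow>
      bounded_linear_on smul (E \<alpha>) (N \<alpha>) (E \<alpha>') (N \<alpha>') (W s t \<alpha> \<alpha>'))"

definition families_agree ::
    "real \<Rightarrow> (real \<Rightarrow> 'a set) \<Rightarrow> (real \<Rightarrow> real \<Rightarrow> ereal) \<Rightarrow>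
      (real \<Rightarrow> real \<Rightarrow> 'a opfam) \<Rightarrow> (real \<Rightarrow> real \<Rightarrow> 'a opfam) \<Rightarrow> bool"
  where "families_agree \<alpha>s E T W W' \<longleftrightarrow>
    (\<forall>\<alpha>' \<alpha> s t. \<alpha>s < \<alpha>' \<and> \<alpha>' < \<alpha> \<and> 0 \<le> s \<and> s \<le> t \<and> ereal (t - s) < T \<alpha>' \<alpha> \<longrightarrow>
      (\<forall>k\<in>E \<alpha>. W s t \<alpha> \<alpha>' k = W' s t \<alpha> \<alpha>' k))"

definition continuous_bounded_family ::
    "real \<Rightarrow> (real \<Rightarrow> 'a::ab_group_add set) \<Rightarrow> (real \<Rightarrow> 'a \<Rightarrow> real) \<Rightarrow> real \<Rightarrow>
      (real \<Rightarrow> real \<Rightarrow> ereal) \<Rightarrow> (real \<Rightarrow> real \<Rightarrow> 'a opfam) \<Rightarrow> bool"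
  where "continuous_bounded_family \<alpha>s E N K T W \<longleftrightarrow>
    (\<forall>\<alpha>' \<alpha>. \<alpha>s < \<alpha>' \<and> \<alpha>' < \<alpha> \<longrightarrow>
      (\<forall>k\<in>E \<alpha>. norm_continuous_on (N \<alpha>') {(s, t). 0 \<le> s \<and> s \<le> t \<and> ereal (t - s) < T \<alpha>' \<alpha>}
        (\<lambda>(s, t). W s t \<alpha> \<alpha>' k)) \<and>
      (\<forall>t\<ge>0. \<forall>k\<in>E \<alpha>. W t t \<alpha> \<alpha>' k = k) \<and>
      (\<forall>s t. 0 \<le> s \<and> s \<le> t \<and> ereal (t - s) < T \<alpha>' \<alpha> \<longrightarrow>
        onorm_on (E \<alpha>) (N \<alpha>) (N \<alpha>') (W s t \<alpha> \<alpha>') \<le>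
          (if T \<alpha>' \<alpha> = \<infinity> then 1
           else real_of_ereal (T \<alpha>' \<alpha>) / (real_of_ereal (T \<alpha>' \<alpha>) - (t - s))) * K))"

definition consistent_family ::
    "real \<Rightarrow> (real \<Rightarrow> 'a set) \<Rightarrow> (real \<Rightarrow> real \<Rightarrow> ereal) \<Rightarrow> (real \<Rightarrow> real \<Rightarrow> 'a opfam) \<Rightarrow> bool"
  where "consistent_family \<alpha>s E T W \<longleftrightarrow>
    (\<forall>\<alpha>' \<alpha>'' \<alpha> s t. \<alpha>s < \<alpha>' \<and> \<alpha>' < \<alpha>'' \<and> \<alpha>'' < \<alpha> \<and> 0 \<le> s \<and> s \<le> t \<and>
        ereal (t - s) < min (T \<alpha>' \<alpha>) (T \<alpha>'' \<alpha>) \<longrightarrow>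
      (\<forall>k\<in>E \<alpha>. W s t \<alpha> \<alpha>' k = W s t \<alpha> \<alpha>'' k)) \<and>
    (\<forall>\<alpha>' \<alpha>'' \<alpha> s t. \<alpha>s < \<alpha>' \<and> \<alpha>' < \<alpha>'' \<and> \<alpha>'' < \<alpha> \<and> 0 \<le> s \<and> s \<le> t \<and>
        ereal (t - s) < min (T \<alpha>' \<alpha>) (T \<alpha>' \<alpha>'') \<longrightarrow>
      (\<forall>k\<in>E \<alpha>. W s t \<alpha> \<alpha>' k = W s t \<alpha>'' \<alpha>' k))"

definition duhamel_WBV ::
    "('k::real_normed_field \<Rightarrow> 'a::ab_group_add \<Rightarrow> 'a) \<Rightarrow> real \<Rightarrow> (real \<Rightarrow> 'a set) \<Rightarrow>
      (real \<Rightarrow> 'a \<Rightarrow> real) \<Rightarrow> (real \<Rightarrow> real \<Rightarrow> ereal) \<Rightarrow>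
      (real \<Rightarrow> real \<Rightarrow> 'a opfam) \<Rightarrow> (real \<Rightarrow> 'a opfam) \<Rightarrow> (real \<Rightarrow> real \<Rightarrow> 'a opfam) \<Rightarrow> bool"
  where "duhamel_WBV smul \<alpha>s E N T V B W \<longleftrightarrow>
    (\<forall>\<alpha>' \<alpha>'' \<alpha> s t. \<alpha>s < \<alpha>' \<and> \<alpha>' < \<alpha>'' \<and> \<alpha>'' < \<alpha> \<and> 0 \<le> s \<and> s \<le> t \<and>
        ereal (t - s) < min (T \<alpha>' \<alpha>) (T \<alpha>' \<alpha>'') \<longrightarrow>
      (\<forall>k\<in>E \<alpha>. \<exists>I.
        has_integral_on smul (E \<alpha>') (N \<alpha>')
          (\<lambda>r. W s r \<alpha>'' \<alpha>' (scale_comp (B r) (V r t) \<alpha> \<alpha>'' k)) I s t \<and>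
        W s t \<alpha> \<alpha>' k = V s t \<alpha> \<alpha>' k + I))"

definition duhamel_VBW ::
    "('k::real_normed_field \<Rightarrow> 'a::ab_group_add \<Rightarrow> 'a) \<Rightarrow> real \<Rightarrow> (real \<Rightarrow> 'a set) \<Rightarrow>
      (real \<Rightarrow> 'a \<Rightarrow> real) \<Rightarrow> (real \<Rightarrow> real \<Rightarrow> ereal) \<Rightarrow>
      (real \<Rightarrow> real \<Rightarrow> 'a opfam) \<Rightarrow> (real \<Rightarrow> 'a opfam) \<Rightarrow> (real \<Rightarrow> real \<Rightarrow> 'a opfam) \<Rightarrow> bool"
  where "duhamel_VBW smul \<alpha>s E N T V B W \<longleftrightarrow>
    (\<forall>\<alpha>' \<alpha>'' \<alpha> s t. \<alpha>s < \<alpha>' \<and> \<alpha>' < \<alpha>'' \<and> \<alpha>'' < \<alpha> \<and> 0 \<le> s \<and> s \<le> t \<and>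
        ereal (t - s) < min (T \<alpha>' \<alpha>) (T \<alpha>'' \<alpha>) \<longrightarrow>
      (\<forall>k\<in>E \<alpha>. \<exists>I.
        has_integral_on smul (E \<alpha>') (N \<alpha>')
          (\<lambda>r. scale_comp (V s r) (B r) \<alpha>'' \<alpha>' (W r t \<alpha> \<alpha>'' k)) I s t \<and>
        W s t \<alpha> \<alpha>' k = V s t \<alpha> \<alpha>' k + I))"

end

theory Submission
  imports Defs
begin

text \<open>
  The family \<open>W\<close> is the sum of the Dyson series \<open>\<Sum>n. w n\<close>, where \<open>w 0 = V\<close> and \<open>w (n + 1)\<close> arises
  from \<open>w n\<close> by the convolution \<open>(A \<star> C) (s, t) = \<integral>\<^sub>s\<^sup>t A (s, r) B (r) C (r, t) dr\<close> with \<open>V\<close>.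

  Existence.  Each convolution with \<open>V\<close> costs one factor \<open>B\<close>, that is, a factor
  \<open>M \<alpha> / (\<alpha> - \<beta>)\<close> for the loss \<open>\<alpha> - \<beta>\<close> of regularity.  With the total loss shared out evenly over
  the \<open>n\<close> factors \<open>B\<close> and the last factor \<open>V\<close>, the \<open>n\<close>-th term is at most \<open>K (n + 1)\<^sup>n / n!\<close> times the
  \<open>n\<close>-th power of \<open>K M \<alpha> (t - s) / (\<alpha> - \<beta>)\<close>, and \<open>(n + 1)\<^sup>n / n! \<le> exp n\<close> yields a geometric
  majorant with ratio \<open>(t - s) / T (\<beta>, \<alpha>)\<close> (\<open>w_bound\<close>).  Assertion (a) is read off from it, and (b) holds
  because the sum does not depend on the space in which the limit is taken.

  The two integral equations.  The recursion \<open>w (n + 1) = V \<star> w n\<close> sums to the equation in (d).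
  Convolution is associative, by interchanging integrals over a triangle
  (\<open>has_int_triangle_swap\<close>, \<open>conv_assoc\<close>), so \<open>w (n + 1) = w n \<star> V\<close> holds as well and the same
  series satisfies the equation in (c).

  Uniqueness.  The difference \<open>D\<close> of two solutions of one of the equations satisfies the homogeneous
  equation.  If \<open>h\<close> denotes the distance between the two indices and \<open>\<sigma>\<close> the elapsed time, then (a)
  bounds \<open>D\<close> by a multiple \<open>A\<close> of \<open>1 / (h - \<mu> \<sigma>)\<close> for the \<open>\<mu>\<close> that makes \<open>h / \<mu>\<close> the time horizon.
  Inserting this bound into the homogeneous equation, with an intermediate index that depends on the
  integration variable, reproduces it with \<open>2 A / exp 1\<close> instead of \<open>A\<close> (\<open>shrinking_bounds\<close>), hence
  \<open>D = 0\<close>.  The choice of the index under the integral is legitimate because, by (b), the integrand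
  does not depend on it.  This is the method of Nirenberg and Nishida for the abstract
  Cauchy-Kovalevskaya theorem; it reaches the whole time horizon in one step.

  Since the spaces are subsets with individual norms, their integral is first constructed from
  primitives of norm-continuous functions.
\<close>

section \<open>Integration in a Banach space given as a carrier\<close>

text \<open>Sequences reduce every continuity statement below to the convergence of a sequence of real numbers.\<close>

lemma norm_continuous_on_sequentially:
  fixes f :: "'b::{first_countable_topology, t2_space} \<Rightarrow> 'a::ab_group_add"
  assumes "q 0 = 0"
  shows "norm_continuous_on q S f \<longleftrightarrow>
    (\<forall>z\<in>S. \<forall>X. (\<forall>n. X n \<in> S) \<and> X \<longlonglongrightarrow> z \<longrightarrow> (\<lambda>n. q (f (X n) - f z)) \<longlonglongrightarrow> 0)"
proof -
  have "((\<lambda>w. q (f w - f z)) \<longlongrightarrow> 0) (at z within S) \<longleftrightarrow>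
      (\<forall>X. (\<forall>n. X n \<in> S) \<and> X \<longlonglongrightarrow> z \<longrightarrow> (\<lambda>n. q (f (X n) - f z)) \<longlonglongrightarrow> 0)" for z
    using continuous_within_sequentially[of z S "\<lambda>w. q (f w - f z)"] assms
    by (simp add: continuous_within o_def)
  then show ?thesis by (simp add: norm_continuous_on_def)
qed

text \<open>Additivity of increments for functions into a bare group: the spaces of a scale carry no type-class norm.\<close>

lemma additive_tagged_division_group:
  fixes F :: "real \<Rightarrow> 'a::ab_group_add"
  assumes "a \<le> b" and p: "p tagged_division_of {a..b}"
  shows "(\<Sum>(x, J)\<in>p. F (Sup J) - F (Inf J)) = F b - F a"
proof -
  let ?f = "\<lambda>J::real set. if J = {} then 0 else F (Sup J) - F (Inf J)"
  interpret operative_real plus 0 ?f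
    rewrites "comm_monoid_set.F (+) 0 = sum"
    by standard[1] (auto simp add: sum_def)
  have "(\<Sum>(x, J)\<in>p. ?f J) = ?f {a..b}"
    using tagged_division[of p a b] p by simp
  moreover have "(\<Sum>(x, J)\<in>p. ?f J) = (\<Sum>(x, J)\<in>p. F (Sup J) - F (Inf J))"
    using p by (intro sum.cong) auto
  ultimately show ?thesis using \<open>a \<le> b\<close> by simp
qed

locale banach_carrier = vector_space smul
  for smul :: "'k::real_normed_field \<Rightarrow> 'a::ab_group_add \<Rightarrow> 'a" +
  fixes Y :: "'a set" and q :: "'a \<Rightarrow> real"
  assumes banach: "banach_on smul Y q"
begin

abbreviation rs :: "real \<Rightarrow> 'a \<Rightarrow> 'a" where "rs c x \<equiv> smul (of_real c) x"

abbreviation riemann :: "(real \<Rightarrow> 'a) \<Rightarrow> (real \<times> real set) set \<Rightarrow> 'a"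
  where "riemann f P \<equiv> \<Sum>(x, J)\<in>P. rs (measure lborel J) (f x)"

lemma subspace_carrier: "subspace Y"
  using banach by (simp add: banach_on_def)

lemmas mem_0 [simp] = subspace_0[OF subspace_carrier]
  and mem_add [intro] = subspace_add[OF subspace_carrier]
  and mem_diff [intro] = subspace_diff[OF subspace_carrier]
  and mem_scale [intro] = subspace_scale[OF subspace_carrier]
  and mem_neg [intro] = subspace_neg[OF subspace_carrier]
  and mem_sum [intro] = subspace_sum[OF subspace_carrier]

lemma q_nonneg: "x \<in> Y \<Longrightarrow> 0 \<le> q x"
  and q_eq_0_iff: "x \<in> Y \<Longrightarrow> q x = 0 \<longleftrightarrow> x = 0"
  and q_add_le: "x \<in> Y \<Longrightarrow> y \<in> Y \<Longrightarrow> q (x + y) \<le> q x + q y"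
  and q_scale: "x \<in> Y \<Longrightarrow> q (smul c x) = norm c * q x"
  using banach by (auto simp: banach_on_def)

lemma q_complete:
  assumes "\<And>n. u n \<in> Y" "\<And>e. 0 < e \<Longrightarrow> \<exists>n0. \<forall>m\<ge>n0. \<forall>n\<ge>n0. q (u m - u n) < e"
  obtains x where "x \<in> Y" "(\<lambda>n. q (u n - x)) \<longlonglongrightarrow> 0"
proof -
  have "range u \<subseteq> Y \<and> (\<forall>e>0. \<exists>n0. \<forall>m\<ge>n0. \<forall>n\<ge>n0. q (u m - u n) < e)"
    using assms by blast
  then have "\<exists>x\<in>Y. (\<lambda>n. q (u n - x)) \<longlonglongrightarrow> 0"
    using banach unfolding banach_on_def by blast
  then show thesis using that by blast
qed

lemma q_0 [simp]: "q 0 = 0"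
  using q_eq_0_iff[of 0] by simp

lemma q_neg: "x \<in> Y \<Longrightarrow> q (- x) = q x"
  using q_scale[of x "- 1"] by simp

lemma q_diff_commute: "x \<in> Y \<Longrightarrow> y \<in> Y \<Longrightarrow> q (x - y) = q (y - x)"
  using q_neg[of "x - y"] mem_diff[of x y] by simp

lemma q_diff_le: "x \<in> Y \<Longrightarrow> y \<in> Y \<Longrightarrow> q (x - y) \<le> q x + q y"
  using q_add_le[of x "- y"] mem_neg[of y] by (simp add: q_neg)

lemma q_diff_triangle: "x \<in> Y \<Longrightarrow> y \<in> Y \<Longrightarrow> z \<in> Y \<Longrightarrow> q (x - z) \<le> q (x - y) + q (y - z)"
  using q_add_le[of "x - y" "y - z"] mem_diff[of x y] mem_diff[of y z] by simp

lemma q_abs_diff_le: "x \<in> Y \<Longrightarrow> y \<in> Y \<Longrightarrow> \<bar>q x - q y\<bar> \<le> q (x - y)"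
  using q_add_le[of "x - y" y] q_add_le[of "y - x" x] mem_diff[of x y] mem_diff[of y x]
    q_diff_commute[of x y] by auto

lemma q_sum_le: "(\<And>i. i \<in> A \<Longrightarrow> f i \<in> Y) \<Longrightarrow> q (sum f A) \<le> (\<Sum>i\<in>A. q (f i))"
proof (induction A rule: infinite_finite_induct)
  case (insert i A)
  have "q (f i + sum f A) \<le> q (f i) + q (sum f A)"
    using insert by (intro q_add_le mem_sum) auto
  then show ?case using insert by fastforce
qed auto

lemma q_unique_limit:
  assumes "\<And>n. u n \<in> Y" "x \<in> Y" "y \<in> Y"
    and "(\<lambda>n. q (u n - x)) \<longlonglongrightarrow> 0" "(\<lambda>n. q (u n - y)) \<longlonglongrightarrow> 0"
  shows "x = y"
proof -
  have "q (x - y) \<le> q (u n - x) + q (u n - y)" for n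
    using q_diff_triangle[of x "u n" y] q_diff_commute[of x "u n"] assms by simp
  then have "q (x - y) \<le> 0 + 0"
    by (intro LIMSEQ_le_const[OF tendsto_add[OF assms(4,5)]]) blast
  then have "x - y = 0"
    using q_nonneg[OF mem_diff[OF assms(2,3)]] q_eq_0_iff[OF mem_diff[OF assms(2,3)]] by simp
  then show ?thesis by simp
qed

lemma q_tendsto:
  assumes "\<And>n. u n \<in> Y" "x \<in> Y" "(\<lambda>n. q (u n - x)) \<longlonglongrightarrow> 0"
  shows "(\<lambda>n. q (u n)) \<longlonglongrightarrow> q x"
proof (rule LIM_zero_cancel, rule tendsto_0_le[OF assms(3), where K = 1])
  show "\<forall>\<^sub>F n in sequentially. norm (q (u n) - q x) \<le> norm (q (u n - x)) * 1"
    using q_abs_diff_le assms(1,2) q_nonneg[OF mem_diff[OF assms(1,2)]]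
    by (intro always_eventually) auto
qed

lemmas cont_iff = norm_continuous_on_sequentially[of q, OF q_0]

lemma cont_real:
  fixes f g :: "'b::{first_countable_topology, t2_space} \<Rightarrow> 'a"
  assumes "norm_continuous_on q S f" "f ` S \<subseteq> Y"
  shows "continuous_on S (\<lambda>z. q (f z))"
  unfolding continuous_on_sequentially
proof (intro ballI allI impI)
  fix X z assume z: "z \<in> S" and X: "(\<forall>n. X n \<in> S) \<and> X \<longlonglongrightarrow> z"
  then have "(\<lambda>n. q (f (X n) - f z)) \<longlonglongrightarrow> 0"
    using assms(1) by (auto simp: cont_iff)
  then show "((\<lambda>z. q (f z)) \<circ> X) \<longlonglongrightarrow> q (f z)"
    unfolding o_def using assms(2) X z by (intro q_tendsto) auto
qed

lemma cont_diff:
  fixes f g :: "'b::{first_countable_topology, t2_space} \<Rightarrow> 'a"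
  assumes "norm_continuous_on q S f" "f ` S \<subseteq> Y" "norm_continuous_on q S g" "g ` S \<subseteq> Y"
  shows "norm_continuous_on q S (\<lambda>z. f z - g z)"
  unfolding cont_iff
proof (intro ballI allI impI)
  fix X z assume z: "z \<in> S" and X: "(\<forall>n. X n \<in> S) \<and> X \<longlonglongrightarrow> z"
  then have *: "(\<lambda>n. q (f (X n) - f z) + q (g (X n) - g z)) \<longlonglongrightarrow> 0"
    using assms(1,3) by (intro tendsto_add_zero) (auto simp: cont_iff)
  have "q (f (X n) - g (X n) - (f z - g z)) \<le> q (f (X n) - f z) + q (g (X n) - g z)"
    and "0 \<le> q (f (X n) - g (X n) - (f z - g z))" for n
  proof -
    have Y: "f (X n) \<in> Y" "g (X n) \<in> Y" "f z \<in> Y" "g z \<in> Y" using X z assms by auto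
    then show "0 \<le> q (f (X n) - g (X n) - (f z - g z))" by (intro q_nonneg) auto
    have "f (X n) - g (X n) - (f z - g z) = (f (X n) - f z) - (g (X n) - g z)"
      by (simp add: algebra_simps)
    then show "q (f (X n) - g (X n) - (f z - g z)) \<le> q (f (X n) - f z) + q (g (X n) - g z)"
      using q_diff_le[OF mem_diff[OF Y(1,3)] mem_diff[OF Y(2,4)]] by (simp only:)
  qed
  then show "(\<lambda>n. q (f (X n) - g (X n) - (f z - g z))) \<longlonglongrightarrow> 0"
    by (intro tendsto_sandwich[OF _ _ tendsto_const *] always_eventually) auto
qed

lemma cont_compose:
  fixes f :: "'b::{first_countable_topology, t2_space} \<Rightarrow> 'a"
    and g :: "'c::{first_countable_topology, t2_space} \<Rightarrow> 'b"
  assumes "norm_continuous_on q S f" "continuous_on S' g" "g ` S' \<subseteq> S"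
  shows "norm_continuous_on q S' (\<lambda>z. f (g z))"
  using assms unfolding cont_iff continuous_on_sequentially by (auto simp: o_def image_subset_iff)

lemma cont_subset: "norm_continuous_on q S f \<Longrightarrow> S' \<subseteq> S \<Longrightarrow> norm_continuous_on q S' f"
  unfolding norm_continuous_on_def by (meson subset_iff tendsto_within_subset)

text \<open>Heine's theorem, applied to the real function \<open>(z, w) \<mapsto> q (f z - f w)\<close>, which vanishes on
  the diagonal.\<close>

lemma cont_uniformly:
  fixes f :: "'b::metric_space \<Rightarrow> 'a"
  assumes "norm_continuous_on q S f" "f ` S \<subseteq> Y" "compact S" "0 < e"
  obtains d where "0 < d" "\<And>z w. z \<in> S \<Longrightarrow> w \<in> S \<Longrightarrow> dist z w < d \<Longrightarrow> q (f z - f w) < e"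
proof -
  let ?\<phi> = "\<lambda>p. q (f (fst p) - f (snd p))"
  have "norm_continuous_on q (S \<times> S) (\<lambda>p. f (fst p) - f (snd p))"
    using assms(2) by (intro cont_diff cont_compose[OF assms(1)] continuous_intros) auto
  then have "continuous_on (S \<times> S) ?\<phi>"
    using assms(2) by (intro cont_real) (auto simp: image_subset_iff)
  then have "uniformly_continuous_on (S \<times> S) ?\<phi>"
    using assms(3) by (intro compact_uniformly_continuous compact_Times)
  then obtain d where d: "0 < d"
    "\<And>p p'. p \<in> S \<times> S \<Longrightarrow> p' \<in> S \<times> S \<Longrightarrow> dist p' p < d \<Longrightarrow> dist (?\<phi> p') (?\<phi> p) < e"
    using \<open>0 < e\<close> unfolding uniformly_continuous_on_def by metis
  show thesis
  proof
    fix z w assume "z \<in> S" "w \<in> S" "dist z w < d"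
    then show "q (f z - f w) < e"
      using d(2)[of "(w, w)" "(z, w)"] by (simp add: dist_Pair_Pair)
  qed fact
qed

lemma cont_bounded:
  fixes f :: "'b::metric_space \<Rightarrow> 'a"
  assumes "norm_continuous_on q S f" "f ` S \<subseteq> Y" "compact S"
  obtains C where "0 \<le> C" "\<And>z. z \<in> S \<Longrightarrow> q (f z) \<le> C"
proof -
  have "compact ((\<lambda>z. q (f z)) ` S)"
    using cont_real[OF assms(1,2)] assms(3) by (rule compact_continuous_image)
  then obtain C where C: "\<And>x. x \<in> (\<lambda>z. q (f z)) ` S \<Longrightarrow> norm x \<le> C"
    using compact_imp_bounded bounded_iff by metis
  show thesis
  proof
    show "q (f z) \<le> max C 0" if "z \<in> S" for z using C[of "q (f z)"] that by auto
  qed auto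
qed

subsection \<open>Primitives\<close>

text \<open>Differentiability up to an error \<open>e\<close>, in the straddled form that compares the increment over an
  interval with the value at a point inside it.  In this form approximate primitives on adjacent intervals
  can be glued, and an increment over a tagged cell is compared with the value at the tag.\<close>

definition approx_primitive :: "real \<Rightarrow> (real \<Rightarrow> 'a) \<Rightarrow> (real \<Rightarrow> 'a) \<Rightarrow> real \<Rightarrow> real \<Rightarrow> bool"
  where "approx_primitive e F f a b \<longleftrightarrow>
    (\<forall>x\<in>{a..b}. \<exists>d>0. \<forall>u v. a \<le> u \<and> u \<le> x \<and> x \<le> v \<and> v \<le> b \<and> v - u < d \<longrightarrow>
      q (F v - F u - rs (v - u) (f x)) \<le> e * (v - u))"

lemma approx_primitiveE:
  assumes "approx_primitive e F f a b" "a \<le> x" "x \<le> b"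
  obtains d where "0 < d" "\<And>u v. a \<le> u \<Longrightarrow> u \<le> x \<Longrightarrow> x \<le> v \<Longrightarrow> v \<le> b \<Longrightarrow> v - u < d \<Longrightarrow>
    q (F v - F u - rs (v - u) (f x)) \<le> e * (v - u)"
proof -
  have "\<exists>d>0. \<forall>u v. a \<le> u \<and> u \<le> x \<and> x \<le> v \<and> v \<le> b \<and> v - u < d \<longrightarrow>
      q (F v - F u - rs (v - u) (f x)) \<le> e * (v - u)"
    using assms by (auto simp: approx_primitive_def)
  then show thesis using that by blast
qed

definition primitive_on :: "(real \<Rightarrow> 'a) \<Rightarrow> (real \<Rightarrow> 'a) \<Rightarrow> real \<Rightarrow> real \<Rightarrow> bool"
  where "primitive_on F f a b \<longleftrightarrow> F ` {a..b} \<subseteq> Y \<and> (\<forall>e>0. approx_primitive e F f a b)"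

lemma q_rs: "x \<in> Y \<Longrightarrow> q (rs c x) = \<bar>c\<bar> * q x"
  by (simp add: q_scale)

text \<open>Bisection (\<open>Bolzano\<close>): on a short interval around \<open>x\<close> the linear function with slope \<open>f x\<close> is good enough,
  and approximate primitives on adjacent intervals are glued after adjusting a constant.\<close>

lemma approx_primitive_exists:
  assumes "a \<le> b" and f: "f ` {a..b} \<subseteq> Y" "norm_continuous_on q {a..b} f" and "0 < e"
  shows "\<exists>F. F ` {a..b} \<subseteq> Y \<and> approx_primitive e F f a b"
proof -
  define P where "P = (\<lambda>u v. a \<le> u \<longrightarrow> v \<le> b \<longrightarrow> (\<exists>F. F ` {u..v} \<subseteq> Y \<and> approx_primitive e F f u v))"
  have "P a b"
    using \<open>a \<le> b\<close>
  proof (induction rule: Bolzano)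
    case (trans u c v)
    show ?case unfolding P_def
    proof (intro impI)
      assume "a \<le> u" "v \<le> b"
      then obtain F G where F: "F ` {u..c} \<subseteq> Y" "approx_primitive e F f u c"
        and G: "G ` {c..v} \<subseteq> Y" "approx_primitive e G f c v"
        using trans unfolding P_def by fastforce
      define H where "H x = (if x \<le> c then F x else F c + (G x - G c))" for x
      have HF: "H x = F x" if "x \<le> c" for x using that by (simp add: H_def)
      have HG: "H x = F c + (G x - G c)" if "c \<le> x" for x
        using that by (cases "x = c") (auto simp: H_def)
      have mem: "F x \<in> Y" if "u \<le> x" "x \<le> c" for x using F(1) that by auto
      have mem': "G x \<in> Y" if "c \<le> x" "x \<le> v" for x using G(1) that by auto
      have H: "H x \<in> Y" if "u \<le> x" "x \<le> v" for x
        using that mem[of x] mem[of c] mem'[of x] mem'[of c] trans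
        by (cases "x \<le> c") (auto simp: HF HG)
      have fY: "f x \<in> Y" if "u \<le> x" "x \<le> v" for x
        using f(1) that \<open>a \<le> u\<close> \<open>v \<le> b\<close> by auto
      have "approx_primitive e H f u v"
        unfolding approx_primitive_def
      proof
        fix x assume x: "x \<in> {u..v}"
        consider "x < c" | "x = c" | "c < x" by linarith
        then show "\<exists>d>0. \<forall>y z. u \<le> y \<and> y \<le> x \<and> x \<le> z \<and> z \<le> v \<and> z - y < d \<longrightarrow>
            q (H z - H y - rs (z - y) (f x)) \<le> e * (z - y)"
        proof cases
          case 1
          obtain d where d: "0 < d" "\<And>y z. u \<le> y \<Longrightarrow> y \<le> x \<Longrightarrow> x \<le> z \<Longrightarrow> z \<le> c \<Longrightarrow> z - y < d \<Longrightarrow>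
              q (F z - F y - rs (z - y) (f x)) \<le> e * (z - y)"
            by (rule approx_primitiveE[OF F(2), of x]) (use x 1 in auto)
          show ?thesis
          proof (intro exI[of _ "min d (c - x)"] conjI allI impI)
            fix y z assume "u \<le> y \<and> y \<le> x \<and> x \<le> z \<and> z \<le> v \<and> z - y < min d (c - x)"
            then show "q (H z - H y - rs (z - y) (f x)) \<le> e * (z - y)"
              using d(2)[of y z] by (auto simp: HF)
          qed (use d 1 in auto)
        next
          case 3
          obtain d where d: "0 < d" "\<And>y z. c \<le> y \<Longrightarrow> y \<le> x \<Longrightarrow> x \<le> z \<Longrightarrow> z \<le> v \<Longrightarrow> z - y < d \<Longrightarrow>
              q (G z - G y - rs (z - y) (f x)) \<le> e * (z - y)"
            by (rule approx_primitiveE[OF G(2), of x]) (use x 3 in auto)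
          show ?thesis
          proof (intro exI[of _ "min d (x - c)"] conjI allI impI)
            fix y z assume "u \<le> y \<and> y \<le> x \<and> x \<le> z \<and> z \<le> v \<and> z - y < min d (x - c)"
            then show "q (H z - H y - rs (z - y) (f x)) \<le> e * (z - y)"
              using d(2)[of y z] by (auto simp: HG)
          qed (use d 3 in auto)
        next
          case 2
          obtain d where d: "0 < d" "\<And>y z. u \<le> y \<Longrightarrow> y \<le> x \<Longrightarrow> x \<le> z \<Longrightarrow> z \<le> c \<Longrightarrow> z - y < d \<Longrightarrow>
              q (F z - F y - rs (z - y) (f x)) \<le> e * (z - y)"
            by (rule approx_primitiveE[OF F(2), of x]) (use x 2 in auto)
          obtain d' where d': "0 < d'" "\<And>y z. c \<le> y \<Longrightarrow> y \<le> x \<Longrightarrow> x \<le> z \<Longrightarrow> z \<le> v \<Longrightarrow> z - y < d' \<Longrightarrow>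
              q (G z - G y - rs (z - y) (f x)) \<le> e * (z - y)"
            by (rule approx_primitiveE[OF G(2), of x]) (use x 2 in auto)
          show ?thesis
          proof (intro exI[of _ "min d d'"] conjI allI impI)
            fix y z assume yz: "u \<le> y \<and> y \<le> x \<and> x \<le> z \<and> z \<le> v \<and> z - y < min d d'"
            have "rs (z - y) (f x) = rs (c - y) (f x) + rs (z - c) (f x)"
              by (simp flip: scale_left_distrib of_real_add)
            then have *: "H z - H y - rs (z - y) (f x) =
                (F c - F y - rs (c - y) (f x)) + (G z - G c - rs (z - c) (f x))"
              using yz 2 by (simp add: HF HG)
            have "q \<dots> \<le> q (F c - F y - rs (c - y) (f x)) + q (G z - G c - rs (z - c) (f x))"
              using yz 2 by (intro q_add_le mem_diff mem_scale mem mem' fY) auto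
            also have "\<dots> \<le> e * (c - y) + e * (z - c)"
              using d(2)[of y c] d'(2)[of c z] yz 2 by (intro add_mono) auto
            finally show "q (H z - H y - rs (z - y) (f x)) \<le> e * (z - y)"
              unfolding * by (simp add: algebra_simps)
          qed (use d d' in auto)
        qed
      qed
      moreover have "H ` {u..v} \<subseteq> Y" using H by auto
      ultimately show "\<exists>F. F ` {u..v} \<subseteq> Y \<and> approx_primitive e F f u v" by blast
    qed
  next
    case (local x)
    then have fx: "f x \<in> Y" using f(1) by auto
    have "((\<lambda>y. q (f y - f x)) \<longlongrightarrow> 0) (at x within {a..b})"
      using f(2) local by (auto simp: norm_continuous_on_def)
    then have "\<forall>\<^sub>F y in at x within {a..b}. q (f y - f x) < e"
      using \<open>0 < e\<close> by (rule order_tendstoD(2))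
    then obtain d where d: "0 < d" "\<And>y. y \<in> {a..b} \<Longrightarrow> y \<noteq> x \<Longrightarrow> dist y x < d \<Longrightarrow> q (f y - f x) < e"
      unfolding eventually_at by blast
    have d': "q (f x - f y) \<le> e" if "y \<in> {a..b}" "dist y x < d" for y
      using d(2)[of y] that \<open>0 < e\<close> fx f(1) q_diff_commute[of "f y" "f x"]
      by (cases "y = x") (auto simp: image_subset_iff)
    show ?case
    proof (intro exI[of _ d] conjI allI impI d)
      fix u v assume uv: "u \<le> x \<and> x \<le> v \<and> v - u < d"
      show "P u v" unfolding P_def
      proof (intro impI exI[of _ "\<lambda>y. rs y (f x)"] conjI)
        assume "a \<le> u" "v \<le> b"
        show "(\<lambda>y. rs y (f x)) ` {u..v} \<subseteq> Y" using fx by auto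
        show "approx_primitive e (\<lambda>y. rs y (f x)) f u v"
          unfolding approx_primitive_def
        proof (intro ballI exI[of _ 1] conjI allI impI)
          fix y z z' assume y: "y \<in> {u..v}" and z: "u \<le> z \<and> z \<le> y \<and> y \<le> z' \<and> z' \<le> v \<and> z' - z < 1"
          have fy: "f y \<in> Y" using f(1) y \<open>a \<le> u\<close> \<open>v \<le> b\<close> by auto
          have "rs z' (f x) - rs z (f x) - rs (z' - z) (f y) = rs (z' - z) (f x - f y)"
            by (simp add: scale_left_diff_distrib scale_right_diff_distrib)
          then have "q (rs z' (f x) - rs z (f x) - rs (z' - z) (f y)) = (z' - z) * q (f x - f y)"
            using z q_rs[OF mem_diff[OF fx fy], of "z' - z"] by (simp del: of_real_diff)
          also have "\<dots> \<le> (z' - z) * e"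
            using z y uv \<open>a \<le> u\<close> \<open>v \<le> b\<close> by (intro mult_left_mono d') (auto simp: dist_real_def)
          finally show "q (rs z' (f x) - rs z (f x) - rs (z' - z) (f y)) \<le> e * (z' - z)"
            by (simp add: mult.commute)
        qed auto
      qed
    qed
  qed
  then show ?thesis by (auto simp: P_def)
qed

text \<open>A mean value inequality, again by bisection, since the claimed bound adds up over adjacent
  intervals.\<close>

lemma approx_primitives_close:
  assumes "a \<le> u" "u \<le> v" "v \<le> b" and f: "f ` {a..b} \<subseteq> Y"
    and F: "F ` {a..b} \<subseteq> Y" "approx_primitive e F f a b"
    and G: "G ` {a..b} \<subseteq> Y" "approx_primitive e' G f a b"
  shows "q (F v - F u - (G v - G u)) \<le> (e + e') * (v - u)"
proof -
  have mem: "F x \<in> Y" "G x \<in> Y" "f x \<in> Y" if "a \<le> x" "x \<le> b" for x using F(1) G(1) f that by auto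
  define P where "P = (\<lambda>u v. a \<le> u \<longrightarrow> v \<le> b \<longrightarrow> q (F v - F u - (G v - G u)) \<le> (e + e') * (v - u))"
  have "P u v"
    using \<open>u \<le> v\<close>
  proof (induction rule: Bolzano)
    case (trans y c z)
    show ?case unfolding P_def
    proof (intro impI)
      assume yz: "a \<le> y" "z \<le> b"
      have "F z - F y - (G z - G y) = (F c - F y - (G c - G y)) + (F z - F c - (G z - G c))"
        by simp
      also have "q \<dots> \<le> q (F c - F y - (G c - G y)) + q (F z - F c - (G z - G c))"
        using yz trans by (intro q_add_le mem_diff mem) auto
      also have "\<dots> \<le> (e + e') * (c - y) + (e + e') * (z - c)"
        using trans yz by (intro add_mono) (auto simp: P_def)
      finally show "q (F z - F y - (G z - G y)) \<le> (e + e') * (z - y)"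
        by (simp add: algebra_simps)
    qed
  next
    case (local x)
    then have x: "x \<in> {a..b}" using assms by auto
    obtain d where d: "0 < d" "\<And>y z. a \<le> y \<Longrightarrow> y \<le> x \<Longrightarrow> x \<le> z \<Longrightarrow> z \<le> b \<Longrightarrow> z - y < d \<Longrightarrow>
        q (F z - F y - rs (z - y) (f x)) \<le> e * (z - y)"
      by (rule approx_primitiveE[OF F(2), of x]) (use x in auto)
    obtain d' where d': "0 < d'" "\<And>y z. a \<le> y \<Longrightarrow> y \<le> x \<Longrightarrow> x \<le> z \<Longrightarrow> z \<le> b \<Longrightarrow> z - y < d' \<Longrightarrow>
        q (G z - G y - rs (z - y) (f x)) \<le> e' * (z - y)"
      by (rule approx_primitiveE[OF G(2), of x]) (use x in auto)
    show ?case
    proof (intro exI[of _ "min d d'"] conjI allI impI)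
      fix y z assume yz: "y \<le> x \<and> x \<le> z \<and> z - y < min d d'"
      show "P y z" unfolding P_def
      proof (intro impI)
        assume ab: "a \<le> y" "z \<le> b"
        have "F z - F y - (G z - G y) = (F z - F y - rs (z - y) (f x)) - (G z - G y - rs (z - y) (f x))"
          by simp
        also have "q \<dots> \<le> q (F z - F y - rs (z - y) (f x)) + q (G z - G y - rs (z - y) (f x))"
          using yz ab by (intro q_diff_le mem_diff mem_scale mem) auto
        also have "\<dots> \<le> e * (z - y) + e' * (z - y)"
          using yz ab d(2)[of y z] d'(2)[of y z] by (intro add_mono) auto
        finally show "q (F z - F y - (G z - G y)) \<le> (e + e') * (z - y)"
          by (simp add: algebra_simps)
      qed
    qed (use d d' in auto)
  qed
  then show ?thesis using assms by (auto simp: P_def)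
qed

text \<open>Approximate primitives with errors tending to \<open>0\<close> and normalised at \<open>a\<close> form a Cauchy sequence.
  Their differences are even Lipschitz with small constants, which is why the limit inherits the
  differentiability of its approximations.\<close>

lemma primitive_on_exists:
  assumes "a \<le> b" and f: "f ` {a..b} \<subseteq> Y" "norm_continuous_on q {a..b} f"
  obtains F where "primitive_on F f a b"
proof -
  define e where "e n = inverse (real (Suc n))" for n
  have e: "0 < e n" for n by (simp add: e_def)
  have e0: "e \<longlonglongrightarrow> 0" unfolding e_def by (rule LIMSEQ_inverse_real_of_nat)
  have "\<exists>F. F ` {a..b} \<subseteq> Y \<and> approx_primitive (e n) F f a b" for n
    by (rule approx_primitive_exists[OF assms e])
  then have "\<exists>F. \<forall>n. F n ` {a..b} \<subseteq> Y \<and> approx_primitive (e n) (F n) f a b"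
    by (intro choice) blast
  then obtain F where F: "\<And>n. F n ` {a..b} \<subseteq> Y" "\<And>n. approx_primitive (e n) (F n) f a b"
    by blast
  have mem: "F n x \<in> Y" "f x \<in> Y" if "x \<in> {a..b}" for n x
    using F(1)[of n] f that by (auto simp: image_subset_iff)
  define G where "G n x = F n x - F n a" for n x
  have G: "G n x \<in> Y" if "x \<in> {a..b}" for n x using mem that \<open>a \<le> b\<close> by (auto simp: G_def)
  have close: "q (G m v - G m u - (G n v - G n u)) \<le> (e m + e n) * (v - u)"
    if "a \<le> u" "u \<le> v" "v \<le> b" for m n u v
    using approx_primitives_close[OF that f(1) F F] by (simp add: G_def)
  have "\<exists>y\<in>Y. (\<lambda>n. q (G n x - y)) \<longlonglongrightarrow> 0" if x: "x \<in> {a..b}" for x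
  proof -
    have "\<exists>n0. \<forall>m\<ge>n0. \<forall>n\<ge>n0. q (G m x - G n x) < \<delta>" if "0 < \<delta>" for \<delta>
    proof -
      have "(\<lambda>n. e n * (b - a)) \<longlonglongrightarrow> 0"
        using tendsto_mult_right[OF e0, of "b - a"] by simp
      then have "\<forall>\<^sub>F n in sequentially. e n * (b - a) < \<delta> / 2"
        using \<open>0 < \<delta>\<close> by (intro order_tendstoD(2)) auto
      then obtain n0 where n0: "\<And>n. n \<ge> n0 \<Longrightarrow> e n * (b - a) < \<delta> / 2"
        by (auto simp: eventually_sequentially)
      show ?thesis
      proof (intro exI[of _ n0] allI impI)
        fix m n assume "n0 \<le> m" "n0 \<le> n"
        have "q (G m x - G n x) \<le> (e m + e n) * (x - a)"
          using close[of a x m n] x by (simp add: G_def)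
        also have "\<dots> \<le> (e m + e n) * (b - a)"
          using x e[of m] e[of n] by (intro mult_left_mono) auto
        also have "\<dots> < \<delta>"
          using n0[OF \<open>n0 \<le> m\<close>] n0[OF \<open>n0 \<le> n\<close>] by (simp add: algebra_simps)
        finally show "q (G m x - G n x) < \<delta>" .
      qed
    qed
    then obtain y where "y \<in> Y" "(\<lambda>n. q (G n x - y)) \<longlonglongrightarrow> 0"
      using q_complete[of "\<lambda>n. G n x", OF G[OF x]] by blast
    then show ?thesis by (rule rev_bexI)
  qed
  then have "\<exists>H. \<forall>x\<in>{a..b}. H x \<in> Y \<and> (\<lambda>n. q (G n x - H x)) \<longlonglongrightarrow> 0"
    by (intro bchoice) blast
  then obtain H where H: "\<And>x. x \<in> {a..b} \<Longrightarrow> H x \<in> Y"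
    "\<And>x. x \<in> {a..b} \<Longrightarrow> (\<lambda>n. q (G n x - H x)) \<longlonglongrightarrow> 0"
    by blast
  have HG: "q (H v - H u - (G n v - G n u)) \<le> e n * (v - u)" if uv: "a \<le> u" "u \<le> v" "v \<le> b" for n u v
  proof -
    have mems: "H v \<in> Y" "H u \<in> Y" "G m v \<in> Y" "G m u \<in> Y" for m using uv H G by auto
    have "q (H v - H u - (G n v - G n u)) \<le>
        q (G m v - H v) + q (G m u - H u) + (e m + e n) * (v - u)" for m
    proof -
      have "H v - H u - (G n v - G n u) =
          ((G m u - H u) - (G m v - H v)) + (G m v - G m u - (G n v - G n u))" by simp
      also have "q \<dots> \<le> q ((G m u - H u) - (G m v - H v)) + q (G m v - G m u - (G n v - G n u))"
        using mems by (intro q_add_le mem_diff) auto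
      also have "\<dots> \<le> (q (G m u - H u) + q (G m v - H v)) + (e m + e n) * (v - u)"
        using mems close[OF uv, of m n] by (intro add_mono q_diff_le mem_diff) auto
      finally show ?thesis by simp
    qed
    moreover have "(\<lambda>m. q (G m v - H v) + q (G m u - H u) + (e m + e n) * (v - u)) \<longlonglongrightarrow>
        0 + 0 + (0 + e n) * (v - u)"
      using uv by (intro tendsto_intros H e0) auto
    ultimately show ?thesis
      by (intro LIMSEQ_le_const[where X = "\<lambda>m. q (G m v - H v) + q (G m u - H u) + (e m + e n) * (v - u)"])
        auto
  qed
  have "primitive_on H f a b"
    unfolding primitive_on_def
  proof (intro conjI allI impI)
    show "H ` {a..b} \<subseteq> Y" using H by auto
    fix \<epsilon> :: real assume "0 < \<epsilon>"
    then have "\<forall>\<^sub>F n in sequentially. e n < \<epsilon> / 2"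
      using e0 by (intro order_tendstoD(2)) auto
    then obtain n where n: "e n < \<epsilon> / 2" by (auto simp: eventually_sequentially)
    show "approx_primitive \<epsilon> H f a b"
      unfolding approx_primitive_def
    proof
      fix x assume x: "x \<in> {a..b}"
      obtain d where d: "0 < d" "\<And>y z. a \<le> y \<Longrightarrow> y \<le> x \<Longrightarrow> x \<le> z \<Longrightarrow> z \<le> b \<Longrightarrow> z - y < d \<Longrightarrow>
          q (F n z - F n y - rs (z - y) (f x)) \<le> e n * (z - y)"
        by (rule approx_primitiveE[OF F(2)[of n], of x]) (use x in auto)
      show "\<exists>d>0. \<forall>u v. a \<le> u \<and> u \<le> x \<and> x \<le> v \<and> v \<le> b \<and> v - u < d \<longrightarrow>
          q (H v - H u - rs (v - u) (f x)) \<le> \<epsilon> * (v - u)"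
      proof (intro exI[of _ d] conjI allI impI d)
        fix u v assume uv: "a \<le> u \<and> u \<le> x \<and> x \<le> v \<and> v \<le> b \<and> v - u < d"
        have "H v - H u - rs (v - u) (f x) =
            (H v - H u - (G n v - G n u)) + (F n v - F n u - rs (v - u) (f x))"
          by (simp add: G_def)
        also have "q \<dots> \<le> q (H v - H u - (G n v - G n u)) + q (F n v - F n u - rs (v - u) (f x))"
          using uv x by (intro q_add_le mem_diff mem_scale mem H G) auto
        also have "\<dots> \<le> e n * (v - u) + e n * (v - u)"
          using uv HG[of u v n] d(2)[of u v] by (intro add_mono) auto
        also have "\<dots> \<le> \<epsilon> * (v - u)"
          using n uv mult_right_mono[of "e n * 2" \<epsilon> "v - u"] by (simp add: algebra_simps)
        finally show "q (H v - H u - rs (v - u) (f x)) \<le> \<epsilon> * (v - u)" .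
      qed
    qed
  qed
  then show thesis by (rule that)
qed

lemma primitive_on_subinterval:
  assumes "primitive_on F f a b" "a \<le> c" "d \<le> b"
  shows "primitive_on F f c d"
proof -
  have "approx_primitive e F f c d" if e: "approx_primitive e F f a b" for e
    unfolding approx_primitive_def
  proof
    fix x assume "x \<in> {c..d}"
    then have "x \<in> {a..b}" using assms by auto
    then obtain \<delta> where \<delta>: "0 < \<delta>" "\<And>u v. a \<le> u \<Longrightarrow> u \<le> x \<Longrightarrow> x \<le> v \<Longrightarrow> v \<le> b \<Longrightarrow> v - u < \<delta> \<Longrightarrow>
        q (F v - F u - rs (v - u) (f x)) \<le> e * (v - u)"
      by (auto intro: approx_primitiveE[OF e])
    show "\<exists>\<delta>>0. \<forall>u v. c \<le> u \<and> u \<le> x \<and> x \<le> v \<and> v \<le> d \<and> v - u < \<delta> \<longrightarrow>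
        q (F v - F u - rs (v - u) (f x)) \<le> e * (v - u)"
      using \<delta> assms by (intro exI[of _ \<delta>] conjI allI impI \<delta>) auto
  qed
  moreover have "F ` {c..d} \<subseteq> Y" using assms unfolding primitive_on_def by auto
  ultimately show ?thesis using assms(1) unfolding primitive_on_def by blast
qed

subsection \<open>The integral\<close>

abbreviation has_int :: "(real \<Rightarrow> 'a) \<Rightarrow> 'a \<Rightarrow> real \<Rightarrow> real \<Rightarrow> bool"
  where "has_int \<equiv> has_integral_on smul Y q"

lemma riemann_mem:
  assumes "f ` {a..b} \<subseteq> Y" "P tagged_division_of {a..b}"
  shows "riemann f P \<in> Y"
  using assms by (intro mem_sum) (auto intro!: mem_scale dest: tag_in_interval)

text \<open>The fundamental theorem of calculus: the increments of the primitive telescope over a tagged division.\<close>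

lemma has_int_primitive:
  assumes "a \<le> b" and f: "f ` {a..b} \<subseteq> Y" and F: "primitive_on F f a b"
  shows "has_int f (F b - F a) a b"
  unfolding has_integral_on_def
proof (intro conjI f)
  have FY: "F x \<in> Y" if "x \<in> {a..b}" for x using F that by (auto simp: primitive_on_def)
  then show Fab: "F b - F a \<in> Y" using \<open>a \<le> b\<close> by auto
  show "((\<lambda>P. q (riemann f P - (F b - F a))) \<longlongrightarrow> 0) (division_filter {a..b})"
  proof (rule tendstoI)
    fix e :: real assume "0 < e"
    define \<epsilon> where "\<epsilon> = e / (2 * (b - a + 1))"
    have \<epsilon>: "0 < \<epsilon>" "\<epsilon> * (b - a) < e"
    proof -
      show "0 < \<epsilon>" using \<open>0 < e\<close> \<open>a \<le> b\<close> by (auto simp: \<epsilon>_def)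
      have "\<epsilon> * (b - a) \<le> \<epsilon> * (b - a + 1)" using \<open>0 < \<epsilon>\<close> by (intro mult_left_mono) auto
      also have "\<dots> = e / 2" using \<open>a \<le> b\<close> by (auto simp: \<epsilon>_def field_simps)
      finally show "\<epsilon> * (b - a) < e" using \<open>0 < e\<close> by simp
    qed
    have "approx_primitive \<epsilon> F f a b" using F \<epsilon> by (simp add: primitive_on_def)
    then have "\<exists>d. \<forall>x\<in>{a..b}. 0 < d x \<and> (\<forall>u v. a \<le> u \<and> u \<le> x \<and> x \<le> v \<and> v \<le> b \<and> v - u < d x \<longrightarrow>
        q (F v - F u - rs (v - u) (f x)) \<le> \<epsilon> * (v - u))"
      unfolding approx_primitive_def by (rule bchoice)
    then obtain d where d: "\<And>x. x \<in> {a..b} \<Longrightarrow> 0 < d x"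
      "\<And>x u v. x \<in> {a..b} \<Longrightarrow> a \<le> u \<Longrightarrow> u \<le> x \<Longrightarrow> x \<le> v \<Longrightarrow> v \<le> b \<Longrightarrow> v - u < d x \<Longrightarrow>
        q (F v - F u - rs (v - u) (f x)) \<le> \<epsilon> * (v - u)"
      by blast
    \<comment> \<open>Radius \<open>d x / 2\<close>, so that a cell on both sides of its tag \<open>x\<close> is shorter than \<open>d x\<close>.\<close>
    define g where "g x = ball x (if x \<in> {a..b} then d x / 2 else 1)" for x
    have "gauge g" unfolding g_def using d(1) by (intro gauge_ball_dependent) auto
    have "q (riemann f P - (F b - F a)) < e" if P: "P tagged_division_of {a..b}" "g fine P" for P
    proof -
      have each: "q (rs (measure lborel J) (f x) - (F (Sup J) - F (Inf J))) \<le> \<epsilon> * (Sup J - Inf J)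
          \<and> rs (measure lborel J) (f x) - (F (Sup J) - F (Inf J)) \<in> Y" if xJ: "(x, J) \<in> P" for x J
      proof -
        obtain u v where J: "J = cbox u v" using tagged_division_ofD(4)[OF P(1) xJ] by blast
        have xin: "x \<in> J" "J \<subseteq> {a..b}" using tagged_division_ofD(2,3)[OF P(1) xJ] by auto
        then have uxv: "u \<le> x" "x \<le> v" "a \<le> u" "v \<le> b" and x: "x \<in> {a..b}" using J by auto
        have "J \<subseteq> g x" using P(2) xJ by (auto simp: fine_def)
        then have "dist x u < d x / 2" "dist x v < d x / 2"
          using J uxv x by (auto simp: g_def subset_iff)
        then have "v - u < d x" using uxv by (simp add: dist_real_def)
        then have "q (F v - F u - rs (v - u) (f x)) \<le> \<epsilon> * (v - u)" using d(2)[OF x] uxv by simp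
        moreover have mem: "F v \<in> Y" "F u \<in> Y" "f x \<in> Y" using FY uxv x f by auto
        ultimately show ?thesis
          using J uxv q_diff_commute[of "F v - F u" "rs (v - u) (f x)"] mem_diff[OF mem(1,2)] mem_scale[OF mem(3)]
          by auto
      qed
      have "riemann f P - (F b - F a) =
          (\<Sum>(x, J)\<in>P. rs (measure lborel J) (f x) - (F (Sup J) - F (Inf J)))"
        using additive_tagged_division_group[OF \<open>a \<le> b\<close> P(1), of F]
        by (simp add: sum_subtractf split_beta)
      also have "q \<dots> \<le> (\<Sum>i\<in>P. q ((\<lambda>(x, J). rs (measure lborel J) (f x) - (F (Sup J) - F (Inf J))) i))"
        using each by (intro q_sum_le) auto
      also have "\<dots> \<le> (\<Sum>(x, J)\<in>P. \<epsilon> * (Sup J - Inf J))"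
        using each by (intro sum_mono) auto
      also have "\<dots> = \<epsilon> * (b - a)"
        using additive_tagged_division_group[OF \<open>a \<le> b\<close> P(1), of "\<lambda>x. x"]
        by (simp add: split_beta flip: sum_distrib_left)
      finally show ?thesis using \<epsilon> by simp
    qed
    moreover have "0 \<le> q (riemann f P - (F b - F a))" if "P tagged_division_of {a..b}" for P
      using riemann_mem[OF f that] Fab by (intro q_nonneg) auto
    ultimately show "\<forall>\<^sub>F P in division_filter {a..b}. dist (q (riemann f P - (F b - F a))) 0 < e"
      unfolding eventually_division_filter using \<open>gauge g\<close> by (intro exI[of _ g]) auto
  qed
qed

lemma has_int_continuous:
  assumes "a \<le> b" "f ` {a..b} \<subseteq> Y" "norm_continuous_on q {a..b} f"
  obtains I where "has_int f I a b"
  using primitive_on_exists[OF assms] has_int_primitive[OF assms(1,2)] by blast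

lemma has_int_unique: "has_int f I a b \<Longrightarrow> has_int f I' a b \<Longrightarrow> I = I'"
  by (rule has_integral_on_unique[OF vector_space_axioms banach])

lemma has_int_refl:
  assumes "f a \<in> Y"
  shows "has_int f 0 a a"
proof -
  have "norm_continuous_on q {a..a} f"
    by (auto simp: norm_continuous_on_def at_within_def)
  then obtain F where "primitive_on F f a a" using primitive_on_exists[of a a f] assms by auto
  then show ?thesis using has_int_primitive[of a a f F] assms by auto
qed

lemma has_int_limitI:
  assumes "f ` {a..b} \<subseteq> Y" "I \<in> Y"
    and "\<And>e. 0 < e \<Longrightarrow> \<forall>\<^sub>F P in division_filter {a..b}. P tagged_division_of {a..b} \<longrightarrow>
      q (riemann f P - I) < e"
  shows "has_int f I a b"
  unfolding has_integral_on_def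
proof (intro conjI assms tendstoI)
  fix e :: real assume "0 < e"
  show "\<forall>\<^sub>F P in division_filter {a..b}. dist (q (riemann f P - I)) 0 < e"
    using assms(3)[OF \<open>0 < e\<close>] eventually_division_filter_tagged_division[of "{a..b}"]
  proof eventually_elim
    case (elim P)
    moreover have "0 \<le> q (riemann f P - I)"
      using riemann_mem[OF assms(1) elim(2)] assms(2) by (intro q_nonneg) auto
    ultimately show ?case by simp
  qed
qed

lemma has_intD:
  assumes "has_int f I a b"
  shows "f ` {a..b} \<subseteq> Y" "I \<in> Y"
    "0 < e \<Longrightarrow> \<forall>\<^sub>F P in division_filter {a..b}. q (riemann f P - I) < e"
  using assms order_tendstoD(2)[of "\<lambda>P. q (riemann f P - I)" 0 "division_filter {a..b}" e]
  unfolding has_integral_on_def by auto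

lemma has_int_cong:
  assumes "has_int f I a b" "\<And>x. x \<in> {a..b} \<Longrightarrow> f x = g x"
  shows "has_int g I a b"
proof (rule has_int_limitI)
  have eq: "riemann g P = riemann f P" if "P tagged_division_of {a..b}" for P
    using assms(2) that by (intro sum.cong refl) (auto dest: tag_in_interval)
  show "\<forall>\<^sub>F P in division_filter {a..b}. P tagged_division_of {a..b} \<longrightarrow> q (riemann g P - I) < e" if "0 < e" for e
    using has_intD(3)[OF assms(1) that] by eventually_elim (use eq in auto)
  show "g ` {a..b} \<subseteq> Y" "I \<in> Y" using has_intD(1,2)[OF assms(1)] assms(2) by auto
qed

lemma has_int_norm_le:
  assumes f: "has_int f I a b" and g: "(g has_integral J) {a..b}"
    and le: "\<And>x. x \<in> {a..b} \<Longrightarrow> q (f x) \<le> g x"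
  shows "q I \<le> J"
proof (rule field_le_epsilon)
  fix e :: real assume "0 < e"
  let ?R = "\<lambda>P. \<Sum>(x, J)\<in>P. measure lborel J * g x"
  have "(?R \<longlongrightarrow> J) (division_filter {a..b})"
    using g has_integral_cbox[of g J a b] by simp
  then have "\<forall>\<^sub>F P in division_filter {a..b}. dist (?R P) J < e / 2"
    using \<open>0 < e\<close> by (intro tendstoD) auto
  then have "\<forall>\<^sub>F P in division_filter {a..b}. q I \<le> J + e"
    using has_intD(3)[OF f half_gt_zero[OF \<open>0 < e\<close>]] eventually_division_filter_tagged_division[of "{a..b}"]
  proof eventually_elim
    case (elim P)
    note Y = has_intD(1,2)[OF f]
    have "q I \<le> q (I - riemann f P) + q (riemann f P)"
      using q_add_le[of "I - riemann f P" "riemann f P"] Y riemann_mem[OF Y(1) elim(3)] by auto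
    moreover have "q (I - riemann f P) < e / 2"
      using q_diff_commute[OF Y(2) riemann_mem[OF Y(1) elim(3)]] elim by simp
    moreover have "q (riemann f P) \<le> ?R P"
    proof -
      have tag: "f x \<in> Y" "x \<in> {a..b}" if "(x, J) \<in> P" for x J
        using tag_in_interval[OF elim(3) that] Y by auto
      have "q (riemann f P) \<le> (\<Sum>i\<in>P. q ((\<lambda>(x, J). rs (measure lborel J) (f x)) i))"
        using tag by (intro q_sum_le) auto
      also have "\<dots> \<le> ?R P"
        using tag le by (intro sum_mono) (auto simp: q_rs intro!: mult_left_mono)
      finally show ?thesis .
    qed
    ultimately show ?case using elim(1) unfolding dist_real_def by linarith
  qed
  then show "q I \<le> J + e"
    using eventually_const[of "division_filter {a..b}" "q I \<le> J + e"] division_filter_not_empty[of a b]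
    by (simp add: trivial_limit_def)
qed

lemma has_int_norm_le_const:
  assumes "has_int f I a b" "a \<le> b" "\<And>x. x \<in> {a..b} \<Longrightarrow> q (f x) \<le> C"
  shows "q I \<le> C * (b - a)"
  using has_int_norm_le[OF assms(1) has_integral_const_real[of C a b]] assms(2,3)
  by (simp add: mult.commute)

lemma has_int_add:
  assumes "has_int f I a b" "has_int g J a b"
  shows "has_int (\<lambda>x. f x + g x) (I + J) a b"
proof (rule has_int_limitI)
  note f = has_intD[OF assms(1)] and g = has_intD[OF assms(2)]
  show "(\<lambda>x. f x + g x) ` {a..b} \<subseteq> Y" "I + J \<in> Y" using f(1,2) g(1,2) by (auto simp: image_subset_iff)
  fix e :: real assume "0 < e"
  then have "0 < e / 2" by simp
  show "\<forall>\<^sub>F P in division_filter {a..b}. P tagged_division_of {a..b} \<longrightarrow>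
      q (riemann (\<lambda>x. f x + g x) P - (I + J)) < e"
    using f(3)[OF \<open>0 < e / 2\<close>] g(3)[OF \<open>0 < e / 2\<close>]
  proof eventually_elim
    case (elim P)
    show ?case
    proof
      assume P: "P tagged_division_of {a..b}"
      have "riemann (\<lambda>x. f x + g x) P - (I + J) = (riemann f P - I) + (riemann g P - J)"
        by (simp add: scale_right_distrib sum.distrib split_beta)
      also have "q \<dots> \<le> q (riemann f P - I) + q (riemann g P - J)"
        using f g riemann_mem[OF f(1) P] riemann_mem[OF g(1) P] by (intro q_add_le) auto
      finally show "q (riemann (\<lambda>x. f x + g x) P - (I + J)) < e" using elim by simp
    qed
  qed
qed

text \<open>Over one and the same tagged division the Riemann sums of \<open>f\<close> and \<open>fn n\<close> differ by at most
  \<open>c n * (b - a)\<close>.\<close>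

lemma has_int_uniform_limit:
  assumes "a \<le> b" and fn: "\<And>n. has_int (fn n) (In n) a b"
    and "f ` {a..b} \<subseteq> Y" "I \<in> Y" and In: "(\<lambda>n. q (In n - I)) \<longlonglongrightarrow> 0"
    and c: "c \<longlonglongrightarrow> 0" "\<And>n x. x \<in> {a..b} \<Longrightarrow> q (f x - fn n x) \<le> c n"
  shows "has_int f I a b"
proof (rule has_int_limitI[OF assms(3,4)])
  fix e :: real assume "0 < e"
  have "(\<lambda>n. c n * (b - a) + q (In n - I)) \<longlonglongrightarrow> 0 * (b - a) + 0"
    by (intro tendsto_intros c In)
  then have "\<forall>\<^sub>F n in sequentially. c n * (b - a) + q (In n - I) < e / 2"
    using \<open>0 < e\<close> by (intro order_tendstoD(2)) auto
  then obtain n where n: "c n * (b - a) + q (In n - I) < e / 2" by (auto simp: eventually_sequentially)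
  note D = has_intD[OF fn[of n]]
  show "\<forall>\<^sub>F P in division_filter {a..b}. P tagged_division_of {a..b} \<longrightarrow> q (riemann f P - I) < e"
    using D(3)[OF half_gt_zero[OF \<open>0 < e\<close>]]
  proof eventually_elim
    case (elim P)
    show ?case
    proof
      assume P: "P tagged_division_of {a..b}"
      note mem = riemann_mem[OF assms(3) P] riemann_mem[OF D(1) P]
      have tag: "x \<in> {a..b}" "f x - fn n x \<in> Y" if "(x, J) \<in> P" for x J
        using tag_in_interval[OF P that] D(1) assms(3) by (auto simp: image_subset_iff)
      have "riemann f P - riemann (fn n) P = (\<Sum>(x, J)\<in>P. rs (measure lborel J) (f x - fn n x))"
        by (simp add: scale_right_diff_distrib sum_subtractf split_beta)
      also have "q \<dots> \<le> (\<Sum>i\<in>P. q ((\<lambda>(x, J). rs (measure lborel J) (f x - fn n x)) i))"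
        using tag by (intro q_sum_le) auto
      also have "\<dots> \<le> (\<Sum>(x, J)\<in>P. measure lborel J * c n)"
        using tag c(2) by (intro sum_mono) (auto simp: q_rs intro!: mult_left_mono)
      also have "\<dots> = c n * (b - a)"
        using additive_content_tagged_division[of P a b] P \<open>a \<le> b\<close>
        by (simp add: split_beta mult.commute[of "c n"] flip: sum_distrib_right)
      finally have 1: "q (riemann f P - riemann (fn n) P) \<le> c n * (b - a)" .
      have "q (riemann f P - I) \<le> q (riemann f P - riemann (fn n) P) + q (riemann (fn n) P - I)"
        using mem assms(4) by (intro q_diff_triangle)
      also have "q (riemann (fn n) P - I) \<le> q (riemann (fn n) P - In n) + q (In n - I)"
        using mem assms(4) D(2) by (intro q_diff_triangle)
      finally show "q (riemann f P - I) < e" using 1 n elim by simp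
    qed
  qed
qed

end

text \<open>A bounded operator maps Riemann sums to Riemann sums.  For \<open>T = id\<close> this identifies an integral in
  one space with the integral in a larger space with a weaker norm.\<close>

lemma has_integral_on_image:
  assumes "banach_carrier smul Y q" "banach_carrier smul Z p" and T: "bounded_linear_on smul Y q Z p T"
    and f: "has_integral_on smul Y q f I a b"
  shows "has_integral_on smul Z p (\<lambda>x. T (f x)) (T I) a b"
proof -
  interpret Y: banach_carrier smul Y q by fact
  interpret Z: banach_carrier smul Z p by fact
  obtain C where C: "\<And>x. x \<in> Y \<Longrightarrow> p (T x) \<le> C * q x"
    using T unfolding bounded_linear_on_def by blast
  have TY: "T x \<in> Z" if "x \<in> Y" for x using T that unfolding bounded_linear_on_def by blast
  have add: "T (x + y) = T x + T y" if "x \<in> Y" "y \<in> Y" for x y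
    using T that unfolding bounded_linear_on_def by blast
  have scale: "T (smul c x) = smul c (T x)" if "x \<in> Y" for c x
    using T that unfolding bounded_linear_on_def by blast
  have T0: "T 0 = 0" using scale[of 0 0] by simp
  have diff: "T (x - y) = T x - T y" if "x \<in> Y" "y \<in> Y" for x y
    using add[of "x - y" y] that by (simp add: Y.mem_diff)
  have sum: "T (sum g A) = (\<Sum>i\<in>A. T (g i))" if "\<And>i. i \<in> A \<Longrightarrow> g i \<in> Y" for g and A :: "'c set"
    using that by (induction A rule: infinite_finite_induct) (auto simp: T0 add Y.mem_sum)
  note D = Y.has_intD[OF f]
  show ?thesis
  proof (rule Z.has_int_limitI)
    show "(\<lambda>x. T (f x)) ` {a..b} \<subseteq> Z" "T I \<in> Z" using D(1,2) TY by auto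
    fix e :: real assume "0 < e"
    define e' where "e' = e / (\<bar>C\<bar> + 1)"
    have "0 < e'" using \<open>0 < e\<close> by (simp add: e'_def)
    show "\<forall>\<^sub>F P in division_filter {a..b}. P tagged_division_of {a..b} \<longrightarrow>
        p (Z.riemann (\<lambda>x. T (f x)) P - T I) < e"
      using D(3)[OF \<open>0 < e'\<close>]
    proof eventually_elim
      case (elim P)
      show ?case
      proof
        assume P: "P tagged_division_of {a..b}"
        note mem = Y.riemann_mem[OF D(1) P]
        have tag: "f x \<in> Y" if "(x, J) \<in> P" for x J
          using tag_in_interval[OF P that] D(1) by auto
        have "Z.riemann (\<lambda>x. T (f x)) P = T (Y.riemann f P)"
          using tag by (subst sum) (auto simp: scale intro!: sum.cong)
        then have "p (Z.riemann (\<lambda>x. T (f x)) P - T I) = p (T (Y.riemann f P - I))"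
          using diff mem D(2) by simp
        also have "\<dots> \<le> C * q (Y.riemann f P - I)" using C mem D(2) by auto
        also have "\<dots> \<le> (\<bar>C\<bar> + 1) * q (Y.riemann f P - I)"
          using Y.q_nonneg[OF Y.mem_diff[OF mem D(2)]] by (intro mult_right_mono) auto
        also have "\<dots> < (\<bar>C\<bar> + 1) * e'"
          using elim by (intro mult_strict_left_mono) auto
        also have "\<dots> = e" by (simp add: e'_def)
        finally show "p (Z.riemann (\<lambda>x. T (f x)) P - T I) < e" .
      qed
    qed
  qed
qed

context banach_carrier
begin

lemma has_int_scale:
  assumes "has_int f I a b"
  shows "has_int (\<lambda>x. smul c (f x)) (smul c I) a b"
proof (rule has_integral_on_image[OF _ _ _ assms])
  show "banach_carrier smul Y q" by (rule banach_carrier_axioms)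
  then show "banach_carrier smul Y q" .
  have "smul c (smul d x) = smul d (smul c x)" for d x by (simp add: mult.commute)
  then show "bounded_linear_on smul Y q Y q (smul c)"
    unfolding bounded_linear_on_def
    by (intro conjI exI[of _ "norm c"]) (auto simp: scale_right_distrib q_scale)
qed

lemma has_int_diff:
  assumes "has_int f I a b" "has_int g J a b"
  shows "has_int (\<lambda>x. f x - g x) (I - J) a b"
  using has_int_add[OF assms(1) has_int_scale[OF assms(2), of "- 1"]] by simp

lemma has_int_const:
  assumes "a \<le> b" "y \<in> Y"
  shows "has_int (\<lambda>_. y) (rs (b - a) y) a b"
proof -
  have "primitive_on (\<lambda>x. rs x y) (\<lambda>_. y) a b"
    unfolding primitive_on_def approx_primitive_def
    using assms(2) by (auto intro!: exI[of _ 1] mem_scale simp: scale_left_diff_distrib)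
  from has_int_primitive[OF assms(1) _ this] show ?thesis
    using assms(2) by (simp add: scale_left_diff_distrib image_subset_iff)
qed

definition integ :: "(real \<Rightarrow> 'a) \<Rightarrow> real \<Rightarrow> real \<Rightarrow> 'a"
  where "integ f a b = (THE I. has_int f I a b)"

lemma integ_eq: "has_int f I a b \<Longrightarrow> integ f a b = I"
  unfolding integ_def by (rule the_equality) (auto dest: has_int_unique)

lemma has_int_integ:
  assumes "a \<le> b" "f ` {a..b} \<subseteq> Y" "norm_continuous_on q {a..b} f"
  shows "has_int f (integ f a b) a b"
proof -
  obtain I where "has_int f I a b" using has_int_continuous[OF assms] .
  then show ?thesis by (simp add: integ_eq)
qed

lemma integ_combine:
  assumes "a \<le> c" "c \<le> b" and f: "f ` {a..b} \<subseteq> Y" "norm_continuous_on q {a..b} f"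
  shows "integ f a b = integ f a c + integ f c b"
proof -
  obtain F where F: "primitive_on F f a b"
    using primitive_on_exists[of a b f] assms by auto
  have "integ f u v = F v - F u" if "a \<le> u" "u \<le> v" "v \<le> b" for u v
    by (rule integ_eq[OF has_int_primitive[OF \<open>u \<le> v\<close> _ primitive_on_subinterval[OF F]]]) (use that f in auto)
  then show ?thesis using assms by simp
qed

text \<open>The chain rule for a primitive composed with an affine map.\<close>

lemma has_int_affine:
  assumes "a \<le> b" and f: "f ` {a..b} \<subseteq> Y" "norm_continuous_on q {a..b} f" and I: "has_int f I a b"
  shows "has_int (\<lambda>l. rs (b - a) (f (a + l * (b - a)))) I 0 1"
proof (cases "a = b")
  case True
  then have "I = 0" using I has_int_refl[of f a] has_int_unique f by auto
  then show ?thesis using has_int_const[of 0 1 0] True by simp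
next
  case False
  then have ab: "0 < b - a" using assms by simp
  obtain F where F: "primitive_on F f a b" using primitive_on_exists[OF assms(1-3)] .
  define h where "h l = a + l * (b - a)" for l
  have h: "a \<le> h l" "h l \<le> b" if "0 \<le> l" "l \<le> 1" for l
  proof -
    have "0 \<le> l * (b - a)" "0 \<le> (1 - l) * (b - a)" using ab that by auto
    then show "a \<le> h l" "h l \<le> b" by (simp_all add: h_def algebra_simps)
  qed
  have "primitive_on (\<lambda>l. F (h l)) (\<lambda>l. rs (b - a) (f (h l))) 0 1"
    unfolding primitive_on_def
  proof (intro conjI allI impI)
    show "(\<lambda>l. F (h l)) ` {0..1} \<subseteq> Y"
      using F h by (auto simp: primitive_on_def image_subset_iff)
    fix e :: real assume "0 < e"
    then have "approx_primitive (e / (b - a)) F f a b" using F ab by (simp add: primitive_on_def)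
    note E = approx_primitiveE[OF this]
    show "approx_primitive e (\<lambda>l. F (h l)) (\<lambda>l. rs (b - a) (f (h l))) 0 1"
      unfolding approx_primitive_def
    proof
      fix l :: real assume l: "l \<in> {0..1}"
      obtain d where d: "0 < d" "\<And>u v. a \<le> u \<Longrightarrow> u \<le> h l \<Longrightarrow> h l \<le> v \<Longrightarrow> v \<le> b \<Longrightarrow> v - u < d \<Longrightarrow>
          q (F v - F u - rs (v - u) (f (h l))) \<le> e / (b - a) * (v - u)"
        by (rule E[of "h l"]) (use h l in auto)
      show "\<exists>d>0. \<forall>u v. 0 \<le> u \<and> u \<le> l \<and> l \<le> v \<and> v \<le> 1 \<and> v - u < d \<longrightarrow>
          q (F (h v) - F (h u) - rs (v - u) (rs (b - a) (f (h l)))) \<le> e * (v - u)"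
      proof (intro exI[of _ "d / (b - a)"] conjI allI impI)
        fix u v assume uv: "0 \<le> u \<and> u \<le> l \<and> l \<le> v \<and> v \<le> 1 \<and> v - u < d / (b - a)"
        have hd: "h v - h u = (v - u) * (b - a)" by (simp add: h_def algebra_simps)
        have "h u \<le> h l" "h l \<le> h v" using uv ab by (auto simp: h_def mult_right_mono)
        moreover have "h v - h u < d" unfolding hd using uv ab by (simp add: field_simps)
        ultimately have "q (F (h v) - F (h u) - rs (h v - h u) (f (h l))) \<le> e / (b - a) * (h v - h u)"
          using uv l h by (intro d) auto
        moreover have "rs (v - u) (rs (b - a) (f (h l))) = rs (h v - h u) (f (h l))"
          unfolding hd by (simp del: of_real_diff add: scale_scale of_real_mult)
        ultimately show "q (F (h v) - F (h u) - rs (v - u) (rs (b - a) (f (h l)))) \<le> e * (v - u)"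
          using ab unfolding hd by (simp del: of_real_diff)
      qed (use d ab in auto)
    qed
  qed
  then have "has_int (\<lambda>l. rs (b - a) (f (h l))) (F (h 1) - F (h 0)) 0 1"
    using f h by (intro has_int_primitive) (auto intro!: mem_scale simp: image_subset_iff)
  moreover have "F (h 1) - F (h 0) = I"
    using has_int_unique[OF has_int_primitive[OF assms(1) f(1) F] I] by (simp add: h_def)
  ultimately show ?thesis by (simp add: h_def)
qed

lemma cont_rs:
  fixes f :: "'b::{first_countable_topology, t2_space} \<Rightarrow> 'a"
  assumes "norm_continuous_on q S f" "f ` S \<subseteq> Y"
  shows "norm_continuous_on q S (\<lambda>z. rs c (f z))"
  unfolding cont_iff
proof (intro ballI allI impI)
  fix X z assume z: "z \<in> S" and X: "(\<forall>n. X n \<in> S) \<and> X \<longlonglongrightarrow> z"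
  then have "(\<lambda>n. q (f (X n) - f z)) \<longlonglongrightarrow> 0"
    using assms(1) by (auto simp: cont_iff)
  then have "(\<lambda>n. \<bar>c\<bar> * q (f (X n) - f z)) \<longlonglongrightarrow> 0"
    by (rule tendsto_mult_right_zero)
  moreover have "q (rs c (f (X n)) - rs c (f z)) = \<bar>c\<bar> * q (f (X n) - f z)" for n
    using assms(2) X z q_rs[of "f (X n) - f z" c] mem_diff[of "f (X n)" "f z"]
    by (auto simp: scale_right_diff_distrib image_subset_iff)
  ultimately show "(\<lambda>n. q (rs c (f (X n)) - rs c (f z))) \<longlonglongrightarrow> 0" by simp
qed

text \<open>The norm bound for integrals reduces this to dominated convergence of the real functions \<open>x \<mapsto> q (fn n x - f x)\<close>.\<close>

lemma has_int_dominated: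
  assumes "a \<le> b"
    and fn: "\<And>n. norm_continuous_on q {a..b} (fn n)" "\<And>n. fn n ` {a..b} \<subseteq> Y" "\<And>n. has_int (fn n) (In n) a b"
    and f: "norm_continuous_on q {a..b} f" "f ` {a..b} \<subseteq> Y" "has_int f I a b"
    and C: "\<And>n x. x \<in> {a..b} \<Longrightarrow> q (fn n x - f x) \<le> C"
    and lim: "\<And>x. x \<in> {a..b} \<Longrightarrow> (\<lambda>n. q (fn n x - f x)) \<longlonglongrightarrow> 0"
  shows "(\<lambda>n. q (In n - I)) \<longlonglongrightarrow> 0"
proof -
  have D: "has_int (\<lambda>x. fn n x - f x) (In n - I) a b" for n
    by (rule has_int_diff[OF fn(3) f(3)])
  note DY = has_intD(1,2)[OF D]
  have "continuous_on {a..b} (\<lambda>x. q (fn n x - f x))" for n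
    using DY(1) by (intro cont_real cont_diff fn f) auto
  then have int: "(\<lambda>x. q (fn n x - f x)) integrable_on {a..b}" for n
    by (rule integrable_continuous_real)
  have "(\<lambda>n. integral {a..b} (\<lambda>x. q (fn n x - f x))) \<longlonglongrightarrow> integral {a..b} (\<lambda>x. 0::real)"
  proof (rule dominated_convergence(2)[OF int, of "\<lambda>_. C"])
    show "norm (q (fn n x - f x)) \<le> C" if "x \<in> {a..b}" for n x
      using C[OF that] q_nonneg[of "fn n x - f x"] DY(1)[of n] that by (auto simp: image_subset_iff)
  qed (use lim in auto)
  then have lim0: "(\<lambda>n. integral {a..b} (\<lambda>x. q (fn n x - f x))) \<longlonglongrightarrow> 0" by simp
  have "q (In n - I) \<le> integral {a..b} (\<lambda>x. q (fn n x - f x))" for n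
    by (rule has_int_norm_le[OF D integrable_integral[OF int]]) auto
  then show ?thesis
    using q_nonneg[OF DY(2)] by (intro tendsto_sandwich[OF _ _ tendsto_const lim0] always_eventually) auto
qed

text \<open>Integrals over moving intervals become comparable after an affine reparametrisation over \<open>{0..1}\<close>.
  This is what makes a convolution jointly continuous in both of its time arguments.\<close>

lemma has_int_moving:
  assumes ab: "\<And>n. A n \<le> B n" "A \<longlonglongrightarrow> a" "B \<longlonglongrightarrow> b"
    and fn: "\<And>n. norm_continuous_on q {A n..B n} (fn n)" "\<And>n. fn n ` {A n..B n} \<subseteq> Y" "\<And>n. has_int (fn n) (In n) (A n) (B n)"
    and f: "norm_continuous_on q {a..b} f" "f ` {a..b} \<subseteq> Y" "has_int f I a b"
    and C: "\<And>n x. x \<in> {A n..B n} \<Longrightarrow> q (fn n x) \<le> C"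
    and lim: "\<And>X x. (\<And>n. X n \<in> {A n..B n}) \<Longrightarrow> X \<longlonglongrightarrow> x \<Longrightarrow> (\<lambda>n. q (fn n (X n) - f x)) \<longlonglongrightarrow> 0"
  shows "(\<lambda>n. q (In n - I)) \<longlonglongrightarrow> 0"
proof -
  have "a \<le> b" using ab by (intro LIMSEQ_le[OF ab(2,3)]) auto
  have mem: "u + l * (v - u) \<in> {u..v}" if "l \<in> {0..1}" "u \<le> v" for l u v :: real
    using that mult_right_mono[of l 1 "v - u"] by auto
  define h where "h n l = A n + l * (B n - A n)" for n l
  define k where "k l = a + l * (b - a)" for l
  have h: "h n l \<in> {A n..B n}" if "l \<in> {0..1}" for n l using mem[OF that ab(1)] by (simp add: h_def)
  have k: "k l \<in> {a..b}" if "l \<in> {0..1}" for l using mem[OF that \<open>a \<le> b\<close>] by (simp add: k_def)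
  have hk: "(\<lambda>n. h n l) \<longlonglongrightarrow> k l" for l unfolding h_def k_def by (intro tendsto_intros ab)
  define gn where "gn n l = rs (B n - A n) (fn n (h n l))" for n l
  define g where "g l = rs (b - a) (f (k l))" for l
  have fnY: "fn n (h n l) \<in> Y" and fY: "f (k l) \<in> Y" if "l \<in> {0..1}" for n l
    using fn(2) f(2) h[OF that] k[OF that] by (auto simp: image_subset_iff)
  have "Bseq (\<lambda>n. B n - A n)" by (intro convergent_imp_Bseq convergentI[where L = "b - a"] tendsto_intros ab)
  then obtain c where c: "0 < c" "\<And>n. \<bar>B n - A n\<bar> \<le> c" by (auto simp: Bseq_def)
  have "0 \<le> C" using C[of "A 0" 0] ab(1)[of 0] q_nonneg[of "fn 0 (A 0)"] fn(2)[of 0] by (auto simp: image_subset_iff)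
  obtain C' where C': "\<And>x. x \<in> {a..b} \<Longrightarrow> q (f x) \<le> C'"
    using cont_bounded[OF f(1,2) compact_Icc] by blast
  show ?thesis
  proof (rule has_int_dominated[of 0 1 gn In g I "c * C + \<bar>b - a\<bar> * C'"])
    show "norm_continuous_on q {0..1} (gn n)" for n
      unfolding gn_def
    proof (rule cont_rs)
      show "norm_continuous_on q {0..1} (\<lambda>l. fn n (h n l))"
        using h by (intro cont_compose[OF fn(1)]) (auto simp: h_def intro!: continuous_intros)
    qed (use fnY in auto)
    show "norm_continuous_on q {0..1} g"
      unfolding g_def
    proof (rule cont_rs)
      show "norm_continuous_on q {0..1} (\<lambda>l. f (k l))"
        using k by (intro cont_compose[OF f(1)]) (auto simp: k_def intro!: continuous_intros)
    qed (use fY in auto)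
    show "gn n ` {0..1} \<subseteq> Y" for n using fnY by (auto simp: gn_def)
    show "g ` {0..1} \<subseteq> Y" using fY by (auto simp: g_def)
    show "has_int (gn n) (In n) 0 1" for n
      unfolding gn_def h_def by (rule has_int_affine[OF ab(1) fn(2) fn(1) fn(3)])
    show "has_int g I 0 1"
      unfolding g_def k_def by (rule has_int_affine[OF \<open>a \<le> b\<close> f(2) f(1) f(3)])
    fix l :: real assume l: "l \<in> {0..1}"
    have Y: "fn n (h n l) \<in> Y" "f (k l) \<in> Y" "gn n l \<in> Y" "g l \<in> Y" for n
      using fnY[OF l] fY[OF l] by (auto simp: gn_def g_def)
    have qg: "q (gn n l) = \<bar>B n - A n\<bar> * q (fn n (h n l))" for n
      using q_rs[OF Y(1), of "B n - A n"] by (simp add: gn_def del: of_real_diff)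
    have "q (gn n l) \<le> c * C" for n
      unfolding qg using C[OF h[OF l]] c \<open>0 \<le> C\<close> q_nonneg[OF Y(1)] by (intro mult_mono) auto
    moreover have "q (g l) \<le> \<bar>b - a\<bar> * C'"
      using q_rs[OF Y(2), of "b - a"] C'[OF k[OF l]] by (simp add: g_def mult_left_mono del: of_real_diff)
    ultimately show "q (gn n l - g l) \<le> c * C + \<bar>b - a\<bar> * C'" for n
      using q_diff_le[OF Y(3,4), of n] add_mono order_trans by blast
    have "(\<lambda>n. q (fn n (h n l) - f (k l))) \<longlonglongrightarrow> 0"
      using lim[of "\<lambda>n. h n l" "k l"] h[OF l] hk by blast
    then have "(\<lambda>n. \<bar>B n - A n\<bar> * q (fn n (h n l) - f (k l)) + \<bar>(B n - A n) - (b - a)\<bar> * q (f (k l)))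
        \<longlonglongrightarrow> \<bar>b - a\<bar> * 0 + \<bar>(b - a) - (b - a)\<bar> * q (f (k l))"
      by (intro tendsto_intros ab)
    then have lim0: "(\<lambda>n. \<bar>B n - A n\<bar> * q (fn n (h n l) - f (k l)) + \<bar>(B n - A n) - (b - a)\<bar> * q (f (k l))) \<longlonglongrightarrow> 0"
      by simp
    have "q (gn n l - g l) \<le> \<bar>B n - A n\<bar> * q (fn n (h n l) - f (k l)) + \<bar>(B n - A n) - (b - a)\<bar> * q (f (k l))" for n
    proof -
      have "gn n l - g l = rs (B n - A n) (fn n (h n l) - f (k l)) + rs ((B n - A n) - (b - a)) (f (k l))"
        by (simp add: gn_def g_def scale_right_diff_distrib scale_left_diff_distrib)
      also have "q \<dots> \<le> q (rs (B n - A n) (fn n (h n l) - f (k l))) + q (rs ((B n - A n) - (b - a)) (f (k l)))"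
        using Y by (intro q_add_le) auto
      finally show ?thesis
        using q_rs[OF mem_diff[OF Y(1,2)], of "B n - A n"] q_rs[OF Y(2), of "(B n - A n) - (b - a)"]
        by (simp del: of_real_diff)
    qed
    then show "(\<lambda>n. q (gn n l - g l)) \<longlonglongrightarrow> 0"
      using q_nonneg[OF mem_diff[OF Y(3,4)]]
      by (intro tendsto_sandwich[OF _ _ tendsto_const lim0] always_eventually) auto
  qed auto
qed

subsection \<open>Integration over a triangle\<close>

text \<open>The upper limit moves in both variables at once: \<open>G x = \<integral>\<^sub>s\<^sup>x \<integral>\<^sub>r\<^sup>x g (r, u) du dr\<close> is a primitive of
  \<open>p u = \<integral>\<^sub>s\<^sup>u g (r, u) dr\<close>, because the increment of \<open>G\<close> over \<open>{a..b}\<close> consists of a strip of width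
  \<open>b - a\<close>, on which \<open>g\<close> is almost constant in \<open>u\<close>, and of a triangle of area at most
  \<open>(b - a)\<^sup>2\<close>.\<close>

lemma has_int_triangle_swap:
  fixes g :: "real \<times> real \<Rightarrow> 'a"
  assumes "s \<le> t"
    and g: "norm_continuous_on q {(r, u). s \<le> r \<and> r \<le> u \<and> u \<le> t} g"
      "g ` {(r, u). s \<le> r \<and> r \<le> u \<and> u \<le> t} \<subseteq> Y"
    and p: "\<And>u. u \<in> {s..t} \<Longrightarrow> has_int (\<lambda>r. g (r, u)) (p u) s u"
    and m: "\<And>r. r \<in> {s..t} \<Longrightarrow> has_int (\<lambda>u. g (r, u)) (m r) r t"
    and I: "has_int m I s t"
  shows "has_int p I s t"
proof -
  let ?\<Delta> = "{(r, u). s \<le> r \<and> r \<le> u \<and> u \<le> t}"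
  have "closed {z::real \<times> real. s \<le> fst z \<and> fst z \<le> snd z \<and> snd z \<le> t}"
    by (intro closed_Collect_conj closed_Collect_le continuous_intros)
  moreover have "{z. s \<le> fst z \<and> fst z \<le> snd z \<and> snd z \<le> t} = ?\<Delta>" by auto
  ultimately have "closed ?\<Delta>" by simp
  then have "compact (({s..t} \<times> {s..t}) \<inter> ?\<Delta>)"
    by (intro compact_Int_closed compact_Times compact_Icc)
  moreover have "({s..t} \<times> {s..t}) \<inter> ?\<Delta> = ?\<Delta>" by auto
  ultimately have comp: "compact ?\<Delta>" by simp
  have gY: "g (r, u) \<in> Y" if "s \<le> r" "r \<le> u" "u \<le> t" for r u using g(2) that by (auto simp: image_subset_iff)
  obtain C where C: "0 \<le> C" "\<And>z. z \<in> ?\<Delta> \<Longrightarrow> q (g z) \<le> C" by (rule cont_bounded[OF g comp]) (rule that; assumption)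
  have cont_u: "norm_continuous_on q {a..b} (\<lambda>u. g (r, u))" if "s \<le> r" "r \<le> a" "b \<le> t" for r a b
    using that by (intro cont_compose[OF g(1)] continuous_intros) auto
  have cont_r: "norm_continuous_on q {a..b} (\<lambda>r. g (r, u))" if "s \<le> a" "b \<le> u" "u \<le> t" for u a b
    using that by (intro cont_compose[OF g(1)] continuous_intros) auto
  have int_u: "has_int (\<lambda>u. g (r, u)) (integ (\<lambda>u. g (r, u)) a b) a b"
    if "s \<le> r" "r \<le> a" "a \<le> b" "b \<le> t" for r a b
    using that gY by (intro has_int_integ cont_u) auto
  have int_r: "has_int (\<lambda>r. g (r, u)) (integ (\<lambda>r. g (r, u)) a b) a b"
    if "s \<le> a" "a \<le> b" "b \<le> u" "u \<le> t" for u a b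
    using that gY by (intro has_int_integ cont_r) auto
  define mm where "mm x r = integ (\<lambda>u. g (r, u)) r x" for x r
  have mm: "has_int (\<lambda>u. g (r, u)) (mm x r) r x" if "s \<le> r" "r \<le> x" "x \<le> t" for x r
    unfolding mm_def using that by (intro int_u) auto
  have mmY: "mm x r \<in> Y" if "s \<le> r" "r \<le> x" "x \<le> t" for x r using has_intD(2)[OF mm[OF that]] .
  have mm_cont: "norm_continuous_on q {s..x} (mm x)" if "x \<le> t" for x
    unfolding cont_iff
  proof (intro ballI allI impI)
    fix r X assume r: "r \<in> {s..x}" and X: "(\<forall>n. X n \<in> {s..x}) \<and> X \<longlonglongrightarrow> r"
    show "(\<lambda>n. q (mm x (X n) - mm x r)) \<longlonglongrightarrow> 0"
    proof (rule has_int_moving[where A = X and B = "\<lambda>_. x" and fn = "\<lambda>n u. g (X n, u)" and f = "\<lambda>u. g (r, u)" and C = C])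
      show "norm_continuous_on q {X n..x} (\<lambda>u. g (X n, u))" for n
        using X that by (intro cont_u) auto
      show "norm_continuous_on q {r..x} (\<lambda>u. g (r, u))" using r that by (intro cont_u) auto
      show "(\<lambda>u. g (X n, u)) ` {X n..x} \<subseteq> Y" for n using X that gY by auto
      show "(\<lambda>u. g (r, u)) ` {r..x} \<subseteq> Y" using r that gY by auto
      show "has_int (\<lambda>u. g (X n, u)) (mm x (X n)) (X n) x" for n using X that by (intro mm) auto
      show "has_int (\<lambda>u. g (r, u)) (mm x r) r x" using r that by (intro mm) auto
      show "q (g (X n, u)) \<le> C" if "u \<in> {X n..x}" for n u
        using that X \<open>x \<le> t\<close> by (intro C) auto
      fix U u assume U: "\<And>n. U n \<in> {X n..x}" "U \<longlonglongrightarrow> u"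
      have "r \<le> u" using U X by (intro LIMSEQ_le[of X r U u]) auto
      moreover have "u \<le> x" using U by (intro LIMSEQ_le_const2[OF U(2)]) auto
      ultimately have "(r, u) \<in> ?\<Delta>" using r that by auto
      moreover have "(\<lambda>n. (X n, U n)) \<longlonglongrightarrow> (r, u)" using X U by (intro tendsto_Pair) auto
      moreover have "(X n, U n) \<in> ?\<Delta>" for n using X[THEN conjunct1, rule_format, of n] U(1)[of n] that by auto
      ultimately show "(\<lambda>n. q (g (X n, U n) - g (r, u))) \<longlonglongrightarrow> 0"
        by (intro g(1)[unfolded cont_iff, rule_format, of "(r, u)" "\<lambda>n. (X n, U n)"] conjI allI)
    qed (use X in auto)
  qed
  define G where "G x = integ (mm x) s x" for x
  have int_mm: "has_int (mm x) (integ (mm x) a b) a b" if "s \<le> a" "a \<le> b" "b \<le> x" "x \<le> t" for a b x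
    using that mmY cont_subset[OF mm_cont[OF \<open>x \<le> t\<close>], of "{a..b}"] by (intro has_int_integ) auto
  have G: "has_int (mm x) (G x) s x" if "s \<le> x" "x \<le> t" for x
    unfolding G_def using that by (intro int_mm) auto
  have p_eq: "p u = integ (\<lambda>r. g (r, u)) s u" if "u \<in> {s..t}" for u
    using integ_eq[OF p[OF that]] by simp
  have "primitive_on G p s t"
    unfolding primitive_on_def
  proof (intro conjI allI impI)
    show "G ` {s..t} \<subseteq> Y" using has_intD(2)[OF G] by auto
    fix e :: real assume "0 < e"
    define e' where "e' = e / (2 * (t - s + 1))"
    have e': "0 < e'" "e' * (t - s) \<le> e / 2"
    proof -
      show "0 < e'" using \<open>0 < e\<close> \<open>s \<le> t\<close> by (auto simp: e'_def)
      have "e' * (t - s) \<le> e' * (t - s + 1)" using \<open>0 < e'\<close> by (intro mult_left_mono) auto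
      also have "\<dots> = e / 2" using \<open>s \<le> t\<close> by (auto simp: e'_def field_simps)
      finally show "e' * (t - s) \<le> e / 2" .
    qed
    obtain d where d: "0 < d" "\<And>z w. z \<in> ?\<Delta> \<Longrightarrow> w \<in> ?\<Delta> \<Longrightarrow> dist z w < d \<Longrightarrow> q (g z - g w) < e'"
      by (rule cont_uniformly[OF g comp e'(1)]) (rule that; assumption)
    \<comment> \<open>The first entry controls the strip, the second one the small triangle.\<close>
    define d' where "d' = min d (e / (4 * (C + 1)))"
    have "0 < d'" using d(1) C(1) \<open>0 < e\<close> by (simp add: d'_def)
    have d'_C: "2 * C * d' \<le> e / 2"
    proof -
      have "2 * C * d' \<le> 2 * (C + 1) * (e / (4 * (C + 1)))"
        using C(1) \<open>0 < d'\<close> by (intro mult_mono) (auto simp: d'_def)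
      also have "\<dots> = e / 2" using C(1) by (simp add: field_simps)
      finally show ?thesis .
    qed
    show "approx_primitive e G p s t"
      unfolding approx_primitive_def
    proof (intro ballI exI[of _ d'] conjI allI impI)
      fix x a b assume x: "x \<in> {s..t}" and ab: "s \<le> a \<and> a \<le> x \<and> x \<le> b \<and> b \<le> t \<and> b - a < d'"
      have Gb: "G b = integ (mm b) s a + integ (mm b) a b"
        unfolding G_def using ab mmY mm_cont[of b] by (intro integ_combine) auto
      have strip: "mm b r - mm a r = integ (\<lambda>u. g (r, u)) a b" if "r \<in> {s..a}" for r
        using integ_combine[of r a b "\<lambda>u. g (r, u)"] that ab gY cont_u[of r r b] by (simp add: mm_def image_subset_iff)
      have px: "p x = integ (\<lambda>r. g (r, x)) s a + integ (\<lambda>r. g (r, x)) a x"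
        using p_eq[OF x] integ_combine[of s a x "\<lambda>r. g (r, x)"] ab x gY cont_r[of s x x]
        by (simp add: image_subset_iff)
      let ?I1 = "integ (mm b) s a - G a - rs (b - a) (integ (\<lambda>r. g (r, x)) s a)"
      let ?I2 = "integ (mm b) a b" and ?I3 = "integ (\<lambda>r. g (r, x)) a x"
      have I1: "has_int (\<lambda>r. mm b r - mm a r - rs (b - a) (g (r, x))) ?I1 s a"
        using ab by (intro has_int_diff has_int_scale int_mm G int_r) auto
      have I2: "has_int (mm b) ?I2 a b" using ab by (intro int_mm) auto
      have I3: "has_int (\<lambda>r. g (r, x)) ?I3 a x" using ab by (intro int_r) auto
      have "q (mm b r - mm a r - rs (b - a) (g (r, x))) \<le> e' * (b - a)" if r: "r \<in> {s..a}" for r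
      proof (rule has_int_norm_le_const)
        show "has_int (\<lambda>u. g (r, u) - g (r, x)) (mm b r - mm a r - rs (b - a) (g (r, x))) a b"
          unfolding strip[OF r] using ab r gY by (intro has_int_diff has_int_const int_u) auto
        show "q (g (r, u) - g (r, x)) \<le> e'" if "u \<in> {a..b}" for u
          using that ab r by (intro less_imp_le[OF d(2)]) (auto simp: dist_Pair_Pair dist_real_def d'_def)
      qed (use ab in auto)
      then have 1: "q ?I1 \<le> e' * (b - a) * (a - s)"
        using ab by (intro has_int_norm_le_const[OF I1]) auto
      have "q (mm b r) \<le> C * (b - a)" if "r \<in> {a..b}" for r
      proof -
        have "q (mm b r) \<le> C * (b - r)"
          using that ab by (intro has_int_norm_le_const[OF mm] C) auto
        also have "\<dots> \<le> C * (b - a)" using that C(1) by (intro mult_left_mono) auto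
        finally show ?thesis .
      qed
      then have 2: "q ?I2 \<le> C * (b - a) * (b - a)"
        using ab by (intro has_int_norm_le_const[OF I2]) auto
      have "q ?I3 \<le> C * (x - a)"
        using ab by (intro has_int_norm_le_const[OF I3] C) auto
      also have "\<dots> \<le> C * (b - a)" using ab C(1) by (intro mult_left_mono) auto
      finally have 3: "q (rs (b - a) ?I3) \<le> C * (b - a) * (b - a)"
        using q_rs[OF has_intD(2)[OF I3], of "b - a"] ab mult_left_mono[of "q ?I3" "C * (b - a)" "b - a"]
        by (simp del: of_real_diff add: mult.commute)
      have area: "(e' * (a - s) + 2 * C * (b - a)) * (b - a) =
          e' * (b - a) * (a - s) + C * (b - a) * (b - a) + C * (b - a) * (b - a)"
        by (simp add: algebra_simps)
      have regroup: "x + y - z - (u + v) = x - z - u + y - v" for x y z u v :: 'a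
        by (simp add: algebra_simps)
      have "G b - G a - rs (b - a) (p x) = ?I1 + ?I2 - rs (b - a) ?I3"
        unfolding px Gb scale_right_distrib by (rule regroup)
      moreover have "q (?I1 + ?I2 - rs (b - a) ?I3) \<le> q (?I1 + ?I2) + q (rs (b - a) ?I3)"
        by (intro q_diff_le mem_add mem_scale has_intD(2)[OF I1] has_intD(2)[OF I2] has_intD(2)[OF I3])
      moreover have "q (?I1 + ?I2) \<le> q ?I1 + q ?I2"
        by (rule q_add_le[OF has_intD(2)[OF I1] has_intD(2)[OF I2]])
      ultimately have "q (G b - G a - rs (b - a) (p x)) \<le> (e' * (a - s) + 2 * C * (b - a)) * (b - a)"
        unfolding area using 1 2 3 by (simp only:)
      also have "\<dots> \<le> e * (b - a)"
      proof (rule mult_right_mono)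
        have "e' * (a - s) \<le> e' * (t - s)" using e' ab by (intro mult_left_mono) auto
        moreover have "2 * C * (b - a) \<le> 2 * C * d'" using C(1) ab by (intro mult_left_mono) auto
        ultimately show "e' * (a - s) + 2 * C * (b - a) \<le> e" using e' d'_C by linarith
      qed (use ab in auto)
      finally show "q (G b - G a - rs (b - a) (p x)) \<le> e * (b - a)" .
    qed (rule \<open>0 < d'\<close>)
  qed
  then have P: "has_int p (G t - G s) s t"
    using has_intD(2)[OF p] by (intro has_int_primitive[OF \<open>s \<le> t\<close>]) auto
  have "G s = 0"
    by (rule has_int_unique[OF G has_int_refl]) (use mmY[of s s] \<open>s \<le> t\<close> in auto)
  have "has_int (mm t) I s t"
    by (rule has_int_cong[OF I], rule has_int_unique[OF m mm]) auto
  then have "G t = I" by (intro has_int_unique[OF G]) (use \<open>s \<le> t\<close> in auto)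
  then show ?thesis using P \<open>G s = 0\<close> by simp
qed

end

section \<open>Operator families on a scale\<close>

locale scale = vector_space smul
  for smul :: "'k::real_normed_field \<Rightarrow> 'a::ab_group_add \<Rightarrow> 'a" +
  fixes \<alpha>s :: real and E :: "real \<Rightarrow> 'a set" and N :: "real \<Rightarrow> 'a \<Rightarrow> real"
  assumes scale_axiom: "banach_scale smul \<alpha>s E N"
begin

lemma carrier: "\<alpha>s < \<alpha> \<Longrightarrow> banach_carrier smul (E \<alpha>) (N \<alpha>)"
  using scale_axiom vector_space_axioms
  by (simp add: banach_scale_def banach_carrier_def banach_carrier_axioms_def)

lemma E_mono: "\<alpha>s < \<beta> \<Longrightarrow> \<beta> \<le> \<alpha> \<Longrightarrow> x \<in> E \<alpha> \<Longrightarrow> x \<in> E \<beta>"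
  and N_mono: "\<alpha>s < \<beta> \<Longrightarrow> \<beta> \<le> \<alpha> \<Longrightarrow> x \<in> E \<alpha> \<Longrightarrow> N \<beta> x \<le> N \<alpha> x"
proof -
  have "E \<alpha> \<subseteq> E \<beta> \<and> (\<forall>x\<in>E \<alpha>. N \<beta> x \<le> N \<alpha> x)" if "\<alpha>s < \<beta>" "\<beta> < \<alpha>"
    using scale_axiom that unfolding banach_scale_def by blast
  then show "\<alpha>s < \<beta> \<Longrightarrow> \<beta> \<le> \<alpha> \<Longrightarrow> x \<in> E \<alpha> \<Longrightarrow> x \<in> E \<beta>"
    "\<alpha>s < \<beta> \<Longrightarrow> \<beta> \<le> \<alpha> \<Longrightarrow> x \<in> E \<alpha> \<Longrightarrow> N \<beta> x \<le> N \<alpha> x"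
    by (cases "\<beta> = \<alpha>"; force)+
qed

abbreviation has_int_in :: "real \<Rightarrow> (real \<Rightarrow> 'a) \<Rightarrow> 'a \<Rightarrow> real \<Rightarrow> real \<Rightarrow> bool"
  where "has_int_in \<alpha> \<equiv> has_integral_on smul (E \<alpha>) (N \<alpha>)"

abbreviation cont_in :: "real \<Rightarrow> 'b::{first_countable_topology, t2_space} set \<Rightarrow> ('b \<Rightarrow> 'a) \<Rightarrow> bool"
  where "cont_in \<alpha> S f \<equiv> norm_continuous_on (N \<alpha>) S f \<and> f ` S \<subseteq> E \<alpha>"

lemma has_int_in_mono:
  assumes "\<alpha>s < \<beta>" "\<beta> \<le> \<alpha>" "has_int_in \<alpha> f I a b"
  shows "has_int_in \<beta> f I a b"
proof (rule has_integral_on_image[OF carrier carrier _ assms(3)])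
  show "bounded_linear_on smul (E \<alpha>) (N \<alpha>) (E \<beta>) (N \<beta>) (\<lambda>x. x)"
    unfolding bounded_linear_on_def
    using E_mono[OF assms(1,2)] N_mono[OF assms(1,2)] by (auto intro!: exI[of _ 1])
qed (use assms in auto)

text \<open>The integral in whichever space of the scale it exists; by nestedness its value does not depend on the
  space.\<close>

definition sint :: "(real \<Rightarrow> 'a) \<Rightarrow> real \<Rightarrow> real \<Rightarrow> 'a"
  where "sint f a b = (THE I. \<exists>\<beta>>\<alpha>s. has_int_in \<beta> f I a b)"

lemma has_int_in_unique:
  assumes "\<alpha>s < \<beta>" "has_int_in \<beta> f I a b" "\<alpha>s < \<gamma>" "has_int_in \<gamma> f J a b"
  shows "I = J"
  using banach_carrier.has_int_unique[OF carrier[of "min \<beta> \<gamma>"]]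
    has_int_in_mono[of "min \<beta> \<gamma>" \<beta> f I a b] has_int_in_mono[of "min \<beta> \<gamma>" \<gamma> f J a b] assms
  by auto

lemma sint_eq: "\<alpha>s < \<beta> \<Longrightarrow> has_int_in \<beta> f I a b \<Longrightarrow> sint f a b = I"
  unfolding sint_def by (rule the_equality) (auto dest: has_int_in_unique)

lemma has_int_in_sint:
  assumes "\<alpha>s < \<beta>" "a \<le> b" "cont_in \<beta> {a..b} f"
  shows "has_int_in \<beta> f (sint f a b) a b"
proof -
  interpret banach_carrier smul "E \<beta>" "N \<beta>" using assms(1) by (rule carrier)
  have "has_int_in \<beta> f (integ f a b) a b"
    using assms by (intro has_int_integ) auto
  then show ?thesis using sint_eq[OF assms(1)] by simp
qed

lemma cont_in_compose:
  assumes "\<alpha>s < \<beta>" "cont_in \<beta> S f" "continuous_on S' g" "g ` S' \<subseteq> S"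
  shows "cont_in \<beta> S' (\<lambda>z. f (g z))"
  using banach_carrier.cont_compose[OF carrier[OF assms(1)] conjunct1[OF assms(2)] assms(3,4)] assms
  by (auto simp: image_subset_iff)

lemma cont_in_tendsto:
  assumes "\<alpha>s < \<beta>" "cont_in \<beta> S f" "z \<in> S" "\<And>n. X n \<in> S" "X \<longlonglongrightarrow> z"
  shows "(\<lambda>n. N \<beta> (f (X n) - f z)) \<longlonglongrightarrow> 0"
proof -
  interpret banach_carrier smul "E \<beta>" "N \<beta>" using assms(1) by (rule carrier)
  show ?thesis using assms(2-5) unfolding cont_iff by blast
qed

subsection \<open>Strongly continuous families\<close>

text \<open>The operators carry no indices: since the spaces are nested, the collections in
  \<^const>\<open>scale_ops\<close> are restrictions of a single map defined on the union of the scale.\<close>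

definition scale_linear :: "('a \<Rightarrow> 'a) \<Rightarrow> bool"
  where "scale_linear f \<longleftrightarrow> (\<forall>\<alpha>>\<alpha>s. \<forall>x\<in>E \<alpha>. (\<forall>y\<in>E \<alpha>. f (x + y) = f x + f y) \<and> (\<forall>c. f (smul c x) = smul c (f x)))"

definition bounded_by :: "('a \<Rightarrow> 'a) \<Rightarrow> real \<Rightarrow> real \<Rightarrow> real \<Rightarrow> bool"
  where "bounded_by f \<alpha> \<beta> C \<longleftrightarrow> (\<forall>x\<in>E \<alpha>. f x \<in> E \<beta> \<and> N \<beta> (f x) \<le> C * N \<alpha> x)"

text \<open>Bounds on compact parameter sets let strong continuity pass to products: a convergent sequence of parameters together with its limit is compact.\<close>

definition strong_family :: "'z::metric_space set \<Rightarrow> ('z \<Rightarrow> 'a \<Rightarrow> 'a) \<Rightarrow> bool"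
  where "strong_family S A \<longleftrightarrow>
    (\<forall>z\<in>S. scale_linear (A z)) \<and>
    (\<forall>\<beta> \<alpha> Q. \<alpha>s < \<beta> \<and> \<beta> < \<alpha> \<and> compact Q \<and> Q \<subseteq> S \<longrightarrow> (\<exists>C\<ge>0. \<forall>z\<in>Q. bounded_by (A z) \<alpha> \<beta> C)) \<and>
    (\<forall>\<beta> \<alpha> k. \<alpha>s < \<beta> \<and> \<beta> < \<alpha> \<and> k \<in> E \<alpha> \<longrightarrow> norm_continuous_on (N \<beta>) S (\<lambda>z. A z k))"

lemma scale_linearD:
  assumes "scale_linear f" "\<alpha>s < \<alpha>" "x \<in> E \<alpha>"
  shows "y \<in> E \<alpha> \<Longrightarrow> f (x + y) = f x + f y" "f (smul c x) = smul c (f x)"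
    "y \<in> E \<alpha> \<Longrightarrow> f (x - y) = f x - f y"
proof -
  show add: "f (x + y) = f x + f y" if "y \<in> E \<alpha>" for y
    using assms that by (auto simp: scale_linear_def)
  show scale: "f (smul c x) = smul c (f x)" for c
    using assms by (auto simp: scale_linear_def)
  interpret banach_carrier smul "E \<alpha>" "N \<alpha>" using assms(2) by (rule carrier)
  show "f (x - y) = f x - f y" if "y \<in> E \<alpha>"
  proof -
    have "f (x + smul (- 1) y) = f x + f (smul (- 1) y)"
      by (intro add mem_scale that)
    moreover have "f (smul (- 1) y) = smul (- 1) (f y)"
      using assms(1,2) that unfolding scale_linear_def by blast
    ultimately show ?thesis by simp
  qed
qed

lemma bounded_byD:
  "bounded_by f \<alpha> \<beta> C \<Longrightarrow> x \<in> E \<alpha> \<Longrightarrow> f x \<in> E \<beta>"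
  "bounded_by f \<alpha> \<beta> C \<Longrightarrow> x \<in> E \<alpha> \<Longrightarrow> N \<beta> (f x) \<le> C * N \<alpha> x"
  by (auto simp: bounded_by_def)

lemma bounded_linear_on_scale:
  assumes "\<alpha>s < \<alpha>" "scale_linear f" "bounded_by f \<alpha> \<beta> C"
  shows "bounded_linear_on smul (E \<alpha>) (N \<alpha>) (E \<beta>) (N \<beta>) f"
  unfolding bounded_linear_on_def
  using scale_linearD[OF assms(2,1)] bounded_byD[OF assms(3)] by (intro conjI exI[of _ C]) auto

lemma strong_linear: "strong_family S A \<Longrightarrow> z \<in> S \<Longrightarrow> scale_linear (A z)"
  by (simp add: strong_family_def)

lemma strong_bounded:
  assumes "strong_family S A" "\<alpha>s < \<beta>" "\<beta> < \<alpha>" "compact Q" "Q \<subseteq> S"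
  obtains C where "0 \<le> C" "\<And>z. z \<in> Q \<Longrightarrow> bounded_by (A z) \<alpha> \<beta> C"
proof -
  have "\<exists>C\<ge>0. \<forall>z\<in>Q. bounded_by (A z) \<alpha> \<beta> C"
    using assms unfolding strong_family_def by blast
  then show thesis using that by blast
qed

lemma strong_mem:
  assumes "strong_family S A" "\<alpha>s < \<beta>" "\<beta> < \<alpha>" "z \<in> S" "x \<in> E \<alpha>"
  shows "A z x \<in> E \<beta>"
  by (rule strong_bounded[OF assms(1-3), of "{z}"]) (use assms bounded_byD(1) in auto)

lemma strong_bounded_linear:
  assumes "strong_family S A" "\<alpha>s < \<beta>" "\<beta> < \<alpha>" "z \<in> S"
  shows "bounded_linear_on smul (E \<alpha>) (N \<alpha>) (E \<beta>) (N \<beta>) (A z)"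
  by (rule strong_bounded[OF assms(1-3), of "{z}"])
    (use assms bounded_linear_on_scale[OF _ strong_linear[OF assms(1,4)]] in auto)

lemma strong_apply:
  fixes A :: "'z::heine_borel \<Rightarrow> 'a \<Rightarrow> 'a"
    and X :: "'w::metric_space \<Rightarrow> 'a"
  assumes A: "strong_family S A" and \<alpha>: "\<alpha>s < \<beta>" "\<beta> < \<alpha>"
    and X: "cont_in \<alpha> S' X" and \<phi>: "continuous_on S' \<phi>" "\<phi> ` S' \<subseteq> S"
  shows "cont_in \<beta> S' (\<lambda>w. A (\<phi> w) (X w))"
proof -
  interpret Y: banach_carrier smul "E \<alpha>" "N \<alpha>" using \<alpha> by (intro carrier) auto
  interpret Z: banach_carrier smul "E \<beta>" "N \<beta>" using \<alpha> by (intro carrier) auto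
  have mem: "A (\<phi> w) (X w') \<in> E \<beta>" if "w \<in> S'" "w' \<in> S'" for w w'
    using that X \<phi> by (intro strong_mem[OF A \<alpha>]) auto
  have "norm_continuous_on (N \<beta>) S' (\<lambda>w. A (\<phi> w) (X w))"
    unfolding Z.cont_iff
  proof (intro ballI allI impI)
    fix w u assume w: "w \<in> S'" and u: "(\<forall>n. u n \<in> S') \<and> u \<longlonglongrightarrow> w"
    then have u': "\<And>n. u n \<in> S'" by blast
    have \<phi>u: "(\<lambda>n. \<phi> (u n)) \<longlonglongrightarrow> \<phi> w"
      using \<phi>(1) u w by (auto simp: continuous_on_sequentially o_def)
    have "compact (insert (\<phi> w) (range (\<lambda>n. \<phi> (u n))))"
      by (rule compact_sequence_with_limit[OF \<phi>u])
    then obtain C where C: "0 \<le> C" "\<And>z. z \<in> insert (\<phi> w) (range (\<lambda>n. \<phi> (u n))) \<Longrightarrow> bounded_by (A z) \<alpha> \<beta> C"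
      by (rule strong_bounded[OF A \<alpha>]) (use \<phi> w u' in auto)
    have Xw: "X w \<in> E \<alpha>" "X (u n) \<in> E \<alpha>" for n using X w u' by auto
    have "norm_continuous_on (N \<beta>) S (\<lambda>z. A z (X w))"
      using A \<alpha> Xw unfolding strong_family_def by blast
    then have 1: "(\<lambda>n. N \<beta> (A (\<phi> (u n)) (X w) - A (\<phi> w) (X w))) \<longlonglongrightarrow> 0"
      using \<phi>u \<phi>(2) w u' unfolding Z.cont_iff by (auto simp: image_subset_iff)
    have 2: "(\<lambda>n. N \<alpha> (X (u n) - X w)) \<longlonglongrightarrow> 0"
      using X w u unfolding Y.cont_iff by blast
    have lim: "(\<lambda>n. C * N \<alpha> (X (u n) - X w) + N \<beta> (A (\<phi> (u n)) (X w) - A (\<phi> w) (X w))) \<longlonglongrightarrow> 0"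
      using tendsto_add[OF tendsto_mult_left[OF 2, of C] 1] by simp
    have "N \<beta> (A (\<phi> (u n)) (X (u n)) - A (\<phi> w) (X w)) \<le>
        C * N \<alpha> (X (u n) - X w) + N \<beta> (A (\<phi> (u n)) (X w) - A (\<phi> w) (X w))" for n
    proof -
      have lin: "scale_linear (A (\<phi> (u n)))" using A \<phi> u' by (intro strong_linear) auto
      have "A (\<phi> (u n)) (X (u n)) - A (\<phi> (u n)) (X w) = A (\<phi> (u n)) (X (u n) - X w)"
        using scale_linearD(3)[OF lin _ Xw(2) Xw(1)] \<alpha> by simp
      moreover have "N \<beta> (A (\<phi> (u n)) (X (u n) - X w)) \<le> C * N \<alpha> (X (u n) - X w)"
        using Xw by (intro bounded_byD(2)[OF C(2)] Y.mem_diff) auto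
      ultimately show ?thesis
        using Z.q_diff_triangle[of "A (\<phi> (u n)) (X (u n))" "A (\<phi> (u n)) (X w)" "A (\<phi> w) (X w)"]
          mem w u' by (auto intro: order_trans)
    qed
    then show "(\<lambda>n. N \<beta> (A (\<phi> (u n)) (X (u n)) - A (\<phi> w) (X w))) \<longlonglongrightarrow> 0"
      using Z.q_nonneg[OF Z.mem_diff[OF mem mem]] w u'
      by (intro tendsto_sandwich[OF _ _ tendsto_const lim] always_eventually) auto
  qed
  then show ?thesis using mem by auto
qed

lemma strong_cont:
  fixes A :: "'z::heine_borel \<Rightarrow> 'a \<Rightarrow> 'a" and \<phi> :: "'w::metric_space \<Rightarrow> 'z"
  assumes "strong_family S A" "\<alpha>s < \<beta>" "\<beta> < \<alpha>" "k \<in> E \<alpha>" "continuous_on S' \<phi>" "\<phi> ` S' \<subseteq> S"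
  shows "cont_in \<beta> S' (\<lambda>w. A (\<phi> w) k)"
proof (rule strong_apply[OF assms(1-3) _ assms(5,6)])
  interpret banach_carrier smul "E \<alpha>" "N \<alpha>" using assms by (intro carrier) auto
  show "cont_in \<alpha> S' (\<lambda>w. k)" using assms(4) by (auto simp: norm_continuous_on_def)
qed

end

abbreviation time_pairs :: "(real \<times> real) set"
  where "time_pairs \<equiv> {(s, t). 0 \<le> s \<and> s \<le> t}"

lemma compact_time_pairs: "compact {(s, t). 0 \<le> s \<and> s \<le> t \<and> t \<le> (\<tau>::real)}"
proof -
  have "closed {z::real \<times> real. 0 \<le> fst z \<and> fst z \<le> snd z \<and> snd z \<le> \<tau>}"
    by (intro closed_Collect_conj closed_Collect_le continuous_intros)
  then have "compact (({0..\<tau>} \<times> {0..\<tau>}) \<inter> {z. 0 \<le> fst z \<and> fst z \<le> snd z \<and> snd z \<le> \<tau>})"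
    by (intro compact_Int_closed compact_Times compact_Icc)
  moreover have "({0..\<tau>} \<times> {0..\<tau>}) \<inter> {z. 0 \<le> fst z \<and> fst z \<le> snd z \<and> snd z \<le> \<tau>} =
      {(s, t). 0 \<le> s \<and> s \<le> t \<and> t \<le> \<tau>}" by auto
  ultimately show ?thesis by simp
qed

subsection \<open>Convolution\<close>

locale perturbed_scale = scale +
  fixes b :: "real \<Rightarrow> 'b \<Rightarrow> 'b"
  assumes b: "strong_family {0..} b"
begin

text \<open>The term \<open>\<integral>\<^sub>s\<^sup>t A (s, r) b (r) C (r, t) k dr\<close> of Duhamel's formula.\<close>

definition conv :: "(real \<times> real \<Rightarrow> 'b \<Rightarrow> 'b) \<Rightarrow> (real \<times> real \<Rightarrow> 'b \<Rightarrow> 'b) \<Rightarrow> real \<times> real \<Rightarrow> 'b \<Rightarrow> 'b"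
  where "conv A C = (\<lambda>(s, t) k. sint (\<lambda>r. A (s, r) (b r (C (r, t) k))) s t)"

text \<open>Each of the three factors loses a little regularity, whence the two intermediate indices.\<close>

lemma integrand_cont:
  fixes S :: "'z::metric_space set"
  assumes A: "strong_family time_pairs A" and C: "strong_family time_pairs C"
    and \<alpha>: "\<alpha>s < \<beta>" "\<beta> < \<alpha>" "k \<in> E \<alpha>"
    and "continuous_on S x" "continuous_on S y" "continuous_on S z"
    and le: "\<And>w. w \<in> S \<Longrightarrow> 0 \<le> x w \<and> x w \<le> y w \<and> y w \<le> z w"
  shows "cont_in \<beta> S (\<lambda>w. A (x w, y w) (b (y w) (C (y w, z w) k)))"
proof -
  obtain \<gamma> \<delta> where *: "\<beta> < \<gamma>" "\<gamma> < \<delta>" "\<delta> < \<alpha>" using \<alpha>(2) dense by meson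
  then have "\<alpha>s < \<gamma>" "\<alpha>s < \<delta>" using \<alpha> by auto
  have le': "0 \<le> x w" "x w \<le> y w" "y w \<le> z w" "0 \<le> y w" if "w \<in> S" for w using le[OF that] by auto
  have "cont_in \<delta> S (\<lambda>w. C (y w, z w) k)"
    using le' by (intro strong_cont[OF C \<open>\<alpha>s < \<delta>\<close> *(3) \<alpha>(3)] continuous_intros assms) auto
  then have "cont_in \<gamma> S (\<lambda>w. b (y w) (C (y w, z w) k))"
    using le' by (intro strong_apply[OF b \<open>\<alpha>s < \<gamma>\<close> *(2)] assms) auto
  then show ?thesis
    using le' by (intro strong_apply[OF A \<alpha>(1) *(1)] continuous_intros assms) auto
qed

lemma conv_has_int:
  assumes A: "strong_family time_pairs A" and C: "strong_family time_pairs C"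
    and \<alpha>: "\<alpha>s < \<beta>" "\<beta> < \<alpha>" "k \<in> E \<alpha>" and "0 \<le> s" "s \<le> t"
  shows "has_int_in \<beta> (\<lambda>r. A (s, r) (b r (C (r, t) k))) (conv A C (s, t) k) s t"
  unfolding conv_def prod.case
  by (intro has_int_in_sint[OF \<alpha>(1) \<open>s \<le> t\<close>] integrand_cont[OF A C \<alpha>] continuous_intros)
    (use assms in auto)

lemma conv_eqI:
  assumes "\<alpha>s < \<beta>" "has_int_in \<beta> (\<lambda>r. A (s, r) (b r (C (r, t) k))) I s t"
  shows "conv A C (s, t) k = I"
  unfolding conv_def prod.case by (rule sint_eq[OF assms])

lemma integrand_bounded:
  assumes A: "strong_family time_pairs A" and C: "strong_family time_pairs C"
    and \<alpha>: "\<alpha>s < \<beta>" "\<beta> < \<alpha>"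
  obtains c where "0 \<le> c"
    "\<And>s r t k. 0 \<le> s \<Longrightarrow> s \<le> r \<Longrightarrow> r \<le> t \<Longrightarrow> t \<le> \<tau> \<Longrightarrow> k \<in> E \<alpha> \<Longrightarrow>
      N \<beta> (A (s, r) (b r (C (r, t) k))) \<le> c * N \<alpha> k"
proof -
  let ?Q = "{(s, t). 0 \<le> s \<and> s \<le> t \<and> t \<le> \<tau>}"
  obtain \<gamma> \<delta> where *: "\<beta> < \<gamma>" "\<gamma> < \<delta>" "\<delta> < \<alpha>" using \<alpha>(2) dense by meson
  then have \<gamma>\<delta>: "\<alpha>s < \<gamma>" "\<alpha>s < \<delta>" using \<alpha> by auto
  obtain a where a: "0 \<le> a" "\<And>z. z \<in> ?Q \<Longrightarrow> bounded_by (A z) \<gamma> \<beta> a"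
    by (rule strong_bounded[OF A \<alpha>(1) *(1) compact_time_pairs[of \<tau>]]) (auto intro: that)
  obtain c where c: "0 \<le> c" "\<And>z. z \<in> ?Q \<Longrightarrow> bounded_by (C z) \<alpha> \<delta> c"
    by (rule strong_bounded[OF C \<gamma>\<delta>(2) *(3) compact_time_pairs[of \<tau>]]) (auto intro: that)
  obtain e where e: "0 \<le> e" "\<And>z. z \<in> {0..\<tau>} \<Longrightarrow> bounded_by (b z) \<delta> \<gamma> e"
    by (rule strong_bounded[OF b \<gamma>\<delta>(1) *(2) compact_Icc[of 0 \<tau>]]) (auto intro: that)
  show thesis
  proof (rule that[of "a * (e * c)"])
    fix s r t k assume *: "0 \<le> s" "s \<le> r" "r \<le> t" "t \<le> \<tau>" and k: "k \<in> E \<alpha>"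
    have Ck: "C (r, t) k \<in> E \<delta>" "N \<delta> (C (r, t) k) \<le> c * N \<alpha> k"
      using bounded_byD[OF c(2)[of "(r, t)"] k] * by auto
    have bk: "b r (C (r, t) k) \<in> E \<gamma>" "N \<gamma> (b r (C (r, t) k)) \<le> e * N \<delta> (C (r, t) k)"
      using bounded_byD[OF e(2)[of r] Ck(1)] * by auto
    have "N \<beta> (A (s, r) (b r (C (r, t) k))) \<le> a * N \<gamma> (b r (C (r, t) k))"
      using bounded_byD[OF a(2)[of "(s, r)"] bk(1)] * by auto
    also have "\<dots> \<le> a * (e * (c * N \<alpha> k))"
      using a(1) e(1) Ck(2) bk(2) by (meson mult_left_mono order_trans)
    finally show "N \<beta> (A (s, r) (b r (C (r, t) k))) \<le> a * (e * c) * N \<alpha> k"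
      by (simp add: mult.assoc)
  qed (use a c e in auto)
qed

lemma strong_conv:
  assumes A: "strong_family time_pairs A" and C: "strong_family time_pairs C"
  shows "strong_family time_pairs (conv A C)"
  unfolding strong_family_def
proof (intro conjI ballI allI impI)
  note has_int = conv_has_int[OF A C]
  fix z assume "z \<in> time_pairs"
  then obtain s t where z: "z = (s, t)" "0 \<le> s" "s \<le> t" by auto
  show "scale_linear (conv A C z)"
    unfolding scale_linear_def z(1)
  proof (intro allI impI ballI conjI)
    fix \<alpha> x assume \<alpha>: "\<alpha>s < \<alpha>" and x: "x \<in> E \<alpha>"
    define \<beta> \<gamma> \<delta> where "\<beta> = (\<alpha> + 3 * \<alpha>s) / 4" and "\<gamma> = (\<alpha> + \<alpha>s) / 2" and "\<delta> = (3 * \<alpha> + \<alpha>s) / 4"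
    have *: "\<alpha>s < \<beta>" "\<beta> < \<gamma>" "\<gamma> < \<delta>" "\<delta> < \<alpha>" "\<beta> < \<alpha>" using \<alpha> by (auto simp: \<beta>_def \<gamma>_def \<delta>_def)
    then have \<gamma>\<delta>: "\<alpha>s < \<gamma>" "\<alpha>s < \<delta>" by auto
    interpret banach_carrier smul "E \<beta>" "N \<beta>" using * by (intro carrier)
    have mem: "C (r, t) x \<in> E \<delta>" "b r (C (r, t) x) \<in> E \<gamma>" if "r \<in> {s..t}" "x \<in> E \<alpha>" for r x
    proof -
      show 1: "C (r, t) x \<in> E \<delta>" using that z * \<gamma>\<delta> by (intro strong_mem[OF C]) auto
      show "b r (C (r, t) x) \<in> E \<gamma>" using that z * \<gamma>\<delta> by (intro strong_mem[OF b _ _ _ 1]) auto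
    qed
    have lin: "scale_linear (A (s, r))" "scale_linear (b r)" "scale_linear (C (r, t))" if "r \<in> {s..t}" for r
      using that z by (auto intro!: strong_linear[OF A] strong_linear[OF b] strong_linear[OF C])
    show "conv A C (s, t) (x + y) = conv A C (s, t) x + conv A C (s, t) y" if y: "y \<in> E \<alpha>" for y
    proof (rule conv_eqI[OF *(1)], rule has_int_cong[OF has_int_add[OF has_int[OF *(1,5) x z(2,3)] has_int[OF *(1,5) y z(2,3)]]])
      fix r assume r: "r \<in> {s..t}"
      show "A (s, r) (b r (C (r, t) x)) + A (s, r) (b r (C (r, t) y)) = A (s, r) (b r (C (r, t) (x + y)))"
        using scale_linearD(1)[OF lin(3)[OF r] \<alpha> x y]
          scale_linearD(1)[OF lin(2)[OF r] \<gamma>\<delta>(2) mem(1)[OF r x] mem(1)[OF r y]]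
          scale_linearD(1)[OF lin(1)[OF r] \<gamma>\<delta>(1) mem(2)[OF r x] mem(2)[OF r y]] by simp
    qed
    show "conv A C (s, t) (smul c x) = smul c (conv A C (s, t) x)" for c
    proof (rule conv_eqI[OF *(1)], rule has_int_cong[OF has_int_scale[OF has_int[OF *(1,5) x z(2,3)]]])
      fix r assume r: "r \<in> {s..t}"
      show "smul c (A (s, r) (b r (C (r, t) x))) = A (s, r) (b r (C (r, t) (smul c x)))"
        using scale_linearD(2)[OF lin(3)[OF r] \<alpha> x]
          scale_linearD(2)[OF lin(2)[OF r] \<gamma>\<delta>(2) mem(1)[OF r x]]
          scale_linearD(2)[OF lin(1)[OF r] \<gamma>\<delta>(1) mem(2)[OF r x]] by simp
    qed
  qed
next
  fix \<beta> \<alpha> Q assume *: "\<alpha>s < \<beta> \<and> \<beta> < \<alpha> \<and> compact Q \<and> Q \<subseteq> time_pairs"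
  then have \<alpha>: "\<alpha>s < \<beta>" "\<beta> < \<alpha>" by auto
  interpret banach_carrier smul "E \<beta>" "N \<beta>" using \<alpha>(1) by (rule carrier)
  interpret Y: banach_carrier smul "E \<alpha>" "N \<alpha>" using \<alpha> by (intro carrier) auto
  have "bounded (snd ` Q)" using * by (intro bounded_snd compact_imp_bounded) auto
  then obtain \<tau> where \<tau>: "\<And>z. z \<in> Q \<Longrightarrow> norm (snd z) \<le> \<tau>" unfolding bounded_iff by auto
  obtain c where c: "0 \<le> c" "\<And>s r t k. 0 \<le> s \<Longrightarrow> s \<le> r \<Longrightarrow> r \<le> t \<Longrightarrow> t \<le> \<tau> \<Longrightarrow> k \<in> E \<alpha> \<Longrightarrow>
      N \<beta> (A (s, r) (b r (C (r, t) k))) \<le> c * N \<alpha> k"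
    by (rule integrand_bounded[OF A C \<alpha>]) (rule that; assumption)
  show "\<exists>c\<ge>0. \<forall>z\<in>Q. bounded_by (conv A C z) \<alpha> \<beta> c"
  proof (intro exI[of _ "c * \<bar>\<tau>\<bar>"] conjI ballI)
    fix z assume z: "z \<in> Q"
    then obtain s t where st: "z = (s, t)" "0 \<le> s" "s \<le> t" using * by auto
    have "t \<le> \<tau>" using \<tau>[OF z] st by simp
    show "bounded_by (conv A C z) \<alpha> \<beta> (c * \<bar>\<tau>\<bar>)"
      unfolding bounded_by_def st(1)
    proof (intro ballI conjI)
      fix x assume x: "x \<in> E \<alpha>"
      note I = conv_has_int[OF A C \<alpha> x st(2,3)]
      show "conv A C (s, t) x \<in> E \<beta>" by (rule has_intD(2)[OF I])
      have "N \<beta> (conv A C (s, t) x) \<le> (c * N \<alpha> x) * (t - s)"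
        using st \<open>t \<le> \<tau>\<close> x by (intro has_int_norm_le_const[OF I] c) auto
      also have "\<dots> \<le> (c * N \<alpha> x) * \<bar>\<tau>\<bar>"
        using c(1) Y.q_nonneg[OF x] st \<open>t \<le> \<tau>\<close> by (intro mult_left_mono) auto
      finally show "N \<beta> (conv A C (s, t) x) \<le> c * \<bar>\<tau>\<bar> * N \<alpha> x" by (simp add: mult_ac)
    qed
  qed (use c in auto)
next
  fix \<beta> \<alpha> k assume *: "\<alpha>s < \<beta> \<and> \<beta> < \<alpha> \<and> k \<in> E \<alpha>"
  then have \<alpha>: "\<alpha>s < \<beta>" "\<beta> < \<alpha>" and k: "k \<in> E \<alpha>" by auto
  interpret banach_carrier smul "E \<beta>" "N \<beta>" using \<alpha>(1) by (rule carrier)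
  show "norm_continuous_on (N \<beta>) time_pairs (\<lambda>z. conv A C z k)"
    unfolding cont_iff
  proof (intro ballI allI impI)
    fix z Z assume z: "z \<in> time_pairs" and Z: "(\<forall>n. Z n \<in> time_pairs) \<and> Z \<longlonglongrightarrow> z"
    define s t where "s = fst z" and "t = snd z"
    define S T where "S n = fst (Z n)" and "T n = snd (Z n)" for n
    have st: "z = (s, t)" "0 \<le> s" "s \<le> t" using z by (auto simp: s_def t_def)
    have ST: "Z n = (S n, T n)" "0 \<le> S n" "S n \<le> T n" for n
      using Z[THEN conjunct1, rule_format, of n] by (auto simp: S_def T_def)
    have lim: "S \<longlonglongrightarrow> s" "T \<longlonglongrightarrow> t"
      unfolding S_def T_def s_def t_def using Z by (auto intro: tendsto_fst tendsto_snd)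
    have "Bseq T" using lim(2) by (intro convergent_imp_Bseq convergentI)
    then obtain \<tau> where \<tau>: "\<And>n. \<bar>T n\<bar> \<le> \<tau>" by (auto simp: Bseq_def)
    obtain c where c: "0 \<le> c" "\<And>s r t k. 0 \<le> s \<Longrightarrow> s \<le> r \<Longrightarrow> r \<le> t \<Longrightarrow> t \<le> \<tau> \<Longrightarrow> k \<in> E \<alpha> \<Longrightarrow>
        N \<beta> (A (s, r) (b r (C (r, t) k))) \<le> c * N \<alpha> k"
      by (rule integrand_bounded[OF A C \<alpha>]) (rule that; assumption)
    have cont: "cont_in \<beta> {s..t} (\<lambda>r. A (s, r) (b r (C (r, t) k)))" if "0 \<le> s" for s t
      by (intro integrand_cont[OF A C \<alpha> k] continuous_intros) (use that in auto)
    show "(\<lambda>n. N \<beta> (conv A C (Z n) k - conv A C z k)) \<longlonglongrightarrow> 0"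
      unfolding ST(1) st(1)
    proof (rule has_int_moving[OF ST(3) lim])
      show "norm_continuous_on (N \<beta>) {S n..T n} (\<lambda>r. A (S n, r) (b r (C (r, T n) k)))"
        "(\<lambda>r. A (S n, r) (b r (C (r, T n) k))) ` {S n..T n} \<subseteq> E \<beta>" for n
        using cont[OF ST(2)] by auto
      show "norm_continuous_on (N \<beta>) {s..t} (\<lambda>r. A (s, r) (b r (C (r, t) k)))"
        "(\<lambda>r. A (s, r) (b r (C (r, t) k))) ` {s..t} \<subseteq> E \<beta>"
        using cont[OF st(2)] by auto
      show "has_int_in \<beta> (\<lambda>r. A (S n, r) (b r (C (r, T n) k))) (conv A C (S n, T n) k) (S n) (T n)" for n
        using ST by (intro conv_has_int[OF A C \<alpha> k])
      show "has_int_in \<beta> (\<lambda>r. A (s, r) (b r (C (r, t) k))) (conv A C (s, t) k) s t"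
        using st by (intro conv_has_int[OF A C \<alpha> k])
      show "N \<beta> (A (S n, r) (b r (C (r, T n) k))) \<le> c * N \<alpha> k" if "r \<in> {S n..T n}" for n r
        using that ST(2)[of n] \<tau>[of n] k by (intro c) auto
      fix R r assume R: "\<And>n. R n \<in> {S n..T n}" "R \<longlonglongrightarrow> r"
      let ?D = "{(s, r, t). 0 \<le> s \<and> s \<le> r \<and> r \<le> (t::real)}"
      have "cont_in \<beta> ?D (\<lambda>w. A (fst w, fst (snd w)) (b (fst (snd w)) (C (fst (snd w), snd (snd w)) k)))"
        by (intro integrand_cont[OF A C \<alpha> k] continuous_intros) auto
      then have "(\<lambda>n. N \<beta> (A (fst (W n), fst (snd (W n))) (b (fst (snd (W n))) (C (fst (snd (W n)), snd (snd (W n))) k)) -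
          A (fst w, fst (snd w)) (b (fst (snd w)) (C (fst (snd w), snd (snd w)) k)))) \<longlonglongrightarrow> 0"
        if "w \<in> ?D" "\<And>n. W n \<in> ?D" "W \<longlonglongrightarrow> w" for w W
        by (rule cont_in_tendsto[OF \<alpha>(1) _ that])
      note this[of "(s, r, t)" "\<lambda>n. (S n, R n, T n)", unfolded fst_conv snd_conv]
      moreover have "s \<le> r" using R by (intro LIMSEQ_le[OF lim(1) R(2)]) auto
      moreover have "r \<le> t" using R by (intro LIMSEQ_le[OF R(2) lim(2)]) auto
      moreover have "(\<lambda>n. (S n, R n, T n)) \<longlonglongrightarrow> (s, r, t)"
        using lim R by (intro tendsto_Pair)
      moreover have "(S n, R n, T n) \<in> ?D" for n using R(1)[of n] ST(2)[of n] by auto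
      ultimately show "(\<lambda>n. N \<beta> (A (S n, R n) (b (R n) (C (R n, T n) k)) - A (s, r) (b r (C (r, t) k)))) \<longlonglongrightarrow> 0"
        using st by simp
    qed
  qed
qed

text \<open>Both sides integrate \<open>A (s, r) b (r) C (r, u) b (u) D (u, t) k\<close> over the triangle \<open>s \<le> r \<le> u \<le> t\<close>, in
  different orders.\<close>

lemma conv_assoc:
  assumes A: "strong_family time_pairs A" and C: "strong_family time_pairs C" and D: "strong_family time_pairs D"
    and \<alpha>: "\<alpha>s < \<alpha>" "k \<in> E \<alpha>" and st: "0 \<le> s" "s \<le> t"
  shows "conv (conv A C) D (s, t) k = conv A (conv C D) (s, t) k"
proof -
  \<comment> \<open>Equally spaced indices, one for each of the five factors applied to \<open>k \<in> E (\<beta> 6)\<close>.\<close>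
  define h where "h = (\<alpha> - \<alpha>s) / 6"
  define \<beta> where "\<beta> i = \<alpha>s + i * h" for i
  have "0 < h" using \<alpha> by (simp add: h_def)
  then have mono: "\<beta> i < \<beta> j \<longleftrightarrow> i < j" for i j by (simp add: \<beta>_def)
  have \<beta>0: "\<alpha>s < \<beta> i" if "0 < i" for i using that \<open>0 < h\<close> by (simp add: \<beta>_def)
  have \<beta>6: "\<beta> 6 = \<alpha>" by (simp add: \<beta>_def h_def diff_divide_distrib)
  interpret banach_carrier smul "E (\<beta> 1)" "N (\<beta> 1)" by (intro carrier \<beta>0) auto
  define X where "X u = b u (D (u, t) k)" for u
  have X: "cont_in (\<beta> 4) {s..t} X"
    unfolding X_def
  proof (rule strong_apply[OF b])
    show "cont_in (\<beta> 5) {s..t} (\<lambda>u. D (u, t) k)"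
      using st \<alpha> by (intro strong_cont[OF D, where \<alpha> = \<alpha>] continuous_intros) (auto simp: \<beta>0 mono simp flip: \<beta>6)
  qed (use st in \<open>auto simp: \<beta>0 mono\<close>)
  define g where "g z = A (s, fst z) (b (fst z) (C z (X (snd z))))" for z
  let ?\<Delta> = "{(r, u). s \<le> r \<and> r \<le> u \<and> u \<le> t}"
  have g: "cont_in (\<beta> 1) ?\<Delta> g"
    unfolding g_def
  proof (rule strong_apply[OF A])
    show "cont_in (\<beta> 2) ?\<Delta> (\<lambda>z. b (fst z) (C z (X (snd z))))"
    proof (rule strong_apply[OF b])
      show "cont_in (\<beta> 3) ?\<Delta> (\<lambda>z. C z (X (snd z)))"
      proof (rule strong_apply[OF C])
        show "cont_in (\<beta> 4) ?\<Delta> (\<lambda>z. X (snd z))"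
          by (intro cont_in_compose[OF _ X] continuous_intros) (auto simp: \<beta>0)
      qed (use st in \<open>auto simp: \<beta>0 mono intro!: continuous_intros\<close>)
    qed (use st in \<open>auto simp: \<beta>0 mono intro!: continuous_intros\<close>)
  qed (use st in \<open>auto simp: \<beta>0 mono intro!: continuous_intros\<close>)
  have "has_int_in (\<beta> 1) (\<lambda>u. conv A C (s, u) (X u)) (conv A (conv C D) (s, t) k) s t"
  proof (rule has_int_triangle_swap[OF st(2) conjunct1[OF g] conjunct2[OF g]])
    show "has_int_in (\<beta> 1) (\<lambda>r. g (r, u)) (conv A C (s, u) (X u)) s u" if "u \<in> {s..t}" for u
    proof -
      have "X u \<in> E (\<beta> 4)" using X that by auto
      then show ?thesis
        unfolding g_def fst_conv snd_conv
        by (rule conv_has_int[OF A C, rotated 2]) (use that st in \<open>auto simp: \<beta>0 mono\<close>)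
    qed
    show "has_int_in (\<beta> 1) (\<lambda>u. g (r, u)) (A (s, r) (b r (conv C D (r, t) k))) r t" if "r \<in> {s..t}" for r
    proof -
      have "has_int_in (\<beta> 5) (\<lambda>u. C (r, u) (X u)) (conv C D (r, t) k) r t"
        unfolding X_def using that st \<alpha>
        by (intro conv_has_int[OF C D, where \<alpha> = \<alpha>]) (auto simp: \<beta>0 mono simp flip: \<beta>6)
      then have "has_int_in (\<beta> 3) (\<lambda>u. b r (C (r, u) (X u))) (b r (conv C D (r, t) k)) r t"
        by (rule has_integral_on_image[rotated 3]) (use that st in \<open>auto simp: \<beta>0 mono intro!: carrier strong_bounded_linear[OF b]\<close>)
      then show ?thesis
        unfolding g_def fst_conv snd_conv
        by (rule has_integral_on_image[rotated 3]) (use that st in \<open>auto simp: \<beta>0 mono intro!: carrier strong_bounded_linear[OF A]\<close>)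
    qed
    show "has_int_in (\<beta> 1) (\<lambda>r. A (s, r) (b r (conv C D (r, t) k))) (conv A (conv C D) (s, t) k) s t"
      using st \<alpha> by (intro conv_has_int[OF A strong_conv[OF C D], where \<alpha> = \<alpha>]) (auto simp: \<beta>0 mono simp flip: \<beta>6)
  qed
  then show ?thesis
    unfolding X_def by (intro conv_eqI[of "\<beta> 1"]) (auto simp: \<beta>0)
qed

lemma conv_cong:
  assumes A: "strong_family time_pairs A" and C: "strong_family time_pairs C"
    and \<alpha>: "\<alpha>s < \<alpha>" "k \<in> E \<alpha>" and st: "0 \<le> s" "s \<le> t"
    and eq: "\<And>r. s \<le> r \<Longrightarrow> r \<le> t \<Longrightarrow> C (r, t) k = C' (r, t) k"
  shows "conv A C' (s, t) k = conv A C (s, t) k"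
proof -
  obtain \<beta> where \<beta>: "\<alpha>s < \<beta>" "\<beta> < \<alpha>" using \<alpha>(1) dense by blast
  interpret banach_carrier smul "E \<beta>" "N \<beta>" using \<beta>(1) by (rule carrier)
  show ?thesis
    by (rule conv_eqI[OF \<beta>(1)], rule has_int_cong[OF conv_has_int[OF A C \<beta> \<alpha>(2) st]]) (simp add: eq)
qed

end

section \<open>The perturbation series\<close>

locale perturbed_evolution = perturbed_scale +
  fixes v :: "real \<times> real \<Rightarrow> 'b \<Rightarrow> 'b" and K :: real and M :: "real \<Rightarrow> real"
  assumes v: "strong_family time_pairs v"
    and v_id: "\<And>\<alpha> k t. \<alpha>s < \<alpha> \<Longrightarrow> k \<in> E \<alpha> \<Longrightarrow> 0 \<le> t \<Longrightarrow> v (t, t) k = k"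
    and v_bound: "\<And>\<beta> \<alpha> s t k. \<alpha>s < \<beta> \<Longrightarrow> \<beta> < \<alpha> \<Longrightarrow> 0 \<le> s \<Longrightarrow> s \<le> t \<Longrightarrow> k \<in> E \<alpha> \<Longrightarrow>
      N \<beta> (v (s, t) k) \<le> K * N \<alpha> k"
    and b_bound: "\<And>\<beta> \<alpha> t k. \<alpha>s < \<beta> \<Longrightarrow> \<beta> < \<alpha> \<Longrightarrow> 0 \<le> t \<Longrightarrow> k \<in> E \<alpha> \<Longrightarrow>
      N \<beta> (b t k) \<le> M \<alpha> / (\<alpha> - \<beta>) * N \<alpha> k"
    and K_ge_1: "1 \<le> K"
    and M_nonneg: "\<And>\<alpha>. \<alpha>s < \<alpha> \<Longrightarrow> 0 \<le> M \<alpha>"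
    and M_mono: "\<And>\<beta> \<alpha>. \<alpha>s < \<beta> \<Longrightarrow> \<beta> \<le> \<alpha> \<Longrightarrow> M \<beta> \<le> M \<alpha>"
begin

text \<open>The reciprocal of the time horizon, so that \<open>t - s < T (\<beta>, \<alpha>)\<close> becomes \<open>rate \<beta> \<alpha> * (t - s) < 1\<close>.
  The infinite horizon becomes the case \<open>rate \<beta> \<alpha> = 0\<close>.\<close>

definition rate :: "real \<Rightarrow> real \<Rightarrow> real"
  where "rate \<beta> \<alpha> = 2 * K * exp 1 * M \<alpha> / (\<alpha> - \<beta>)"

primrec w :: "nat \<Rightarrow> real \<times> real \<Rightarrow> 'b \<Rightarrow> 'b"
  where "w 0 = v" | "w (Suc n) = conv v (w n)"

lemma strong_w: "strong_family time_pairs (w n)"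
  by (induction n) (auto intro: v strong_conv)

text \<open>By associativity the factor \<open>v\<close> may be split off on either side; this is why one series solves both
  integral equations.\<close>

lemma w_Suc_right:
  assumes "\<alpha>s < \<alpha>" "k \<in> E \<alpha>" "0 \<le> s" "s \<le> t"
  shows "w (Suc n) (s, t) k = conv (w n) v (s, t) k"
  using assms(3,4)
proof (induction n arbitrary: s)
  case (Suc n)
  have "w (Suc (Suc n)) (s, t) k = conv v (conv (w n) v) (s, t) k"
    unfolding w.simps(2)[of "Suc n"] using Suc assms(1,2)
    by (intro conv_cong[OF v strong_conv[OF strong_w v]]) (auto simp del: w.simps)
  also have "\<dots> = conv (w (Suc n)) v (s, t) k"
    using conv_assoc[OF v strong_w v assms(1,2) Suc.prems] by simp
  finally show ?case .
qed simp

lemma norm_nonneg: "\<alpha>s < \<alpha> \<Longrightarrow> k \<in> E \<alpha> \<Longrightarrow> 0 \<le> N \<alpha> k"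
  using banach_carrier.q_nonneg[OF carrier] by blast

text \<open>The bounds of \<open>v\<close> do not depend on the indices, so the index between the two factors can be moved
  to the end of the interval where \<open>b\<close> receives the whole distance \<open>\<alpha> - \<beta>\<close>.\<close>

lemma vb_bound:
  assumes "\<alpha>s < \<beta>" "\<beta> < \<alpha>" "0 \<le> s" "s \<le> r" "x \<in> E \<alpha>"
  shows "v (s, r) (b r x) \<in> E \<beta>" "N \<beta> (v (s, r) (b r x)) \<le> K * (M \<alpha> / (\<alpha> - \<beta>)) * N \<alpha> x"
proof -
  have mem: "b r x \<in> E \<gamma>" if "\<beta> < \<gamma>" "\<gamma> < \<alpha>" for \<gamma>
    using assms that by (intro strong_mem[OF b]) auto
  show "v (s, r) (b r x) \<in> E \<beta>"
  proof -
    obtain \<gamma> where "\<beta> < \<gamma>" "\<gamma> < \<alpha>" using assms(2) dense by blast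
    then show ?thesis using assms by (intro strong_mem[OF v _ _ _ mem]) auto
  qed
  have "N \<beta> (v (s, r) (b r x)) \<le> K * (M \<alpha> / (\<alpha> - \<gamma>)) * N \<alpha> x" if \<gamma>: "\<beta> < \<gamma>" "\<gamma> < \<alpha>" for \<gamma>
  proof -
    have "N \<beta> (v (s, r) (b r x)) \<le> K * N \<gamma> (b r x)"
      using assms \<gamma> mem[OF \<gamma>] by (intro v_bound) auto
    also have "\<dots> \<le> K * (M \<alpha> / (\<alpha> - \<gamma>) * N \<alpha> x)"
      using assms \<gamma> K_ge_1 by (intro mult_left_mono b_bound) auto
    finally show ?thesis by (simp add: mult.assoc)
  qed
  then have ev: "\<forall>\<^sub>F \<gamma> in at_right \<beta>. N \<beta> (v (s, r) (b r x)) \<le> K * (M \<alpha> / (\<alpha> - \<gamma>)) * N \<alpha> x"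
    using eventually_at_right_real[OF assms(2)] by (auto elim: eventually_mono)
  have "((\<lambda>\<gamma>. K * (M \<alpha> / (\<alpha> - \<gamma>)) * N \<alpha> x) \<longlongrightarrow> K * (M \<alpha> / (\<alpha> - \<beta>)) * N \<alpha> x) (at_right \<beta>)"
    using assms(2) by (intro tendsto_intros) auto
  then show "N \<beta> (v (s, r) (b r x)) \<le> K * (M \<alpha> / (\<alpha> - \<beta>)) * N \<alpha> x"
    by (rule tendsto_lowerbound[OF _ ev]) simp
qed

lemma bv_bound:
  assumes "\<alpha>s < \<beta>" "\<beta> < \<alpha>" "0 \<le> r" "r \<le> t" "x \<in> E \<alpha>"
  shows "b r (v (r, t) x) \<in> E \<beta>" "N \<beta> (b r (v (r, t) x)) \<le> K * (M \<alpha> / (\<alpha> - \<beta>)) * N \<alpha> x"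
proof -
  have mem: "v (r, t) x \<in> E \<gamma>" if "\<beta> < \<gamma>" "\<gamma> < \<alpha>" for \<gamma>
    using assms that by (intro strong_mem[OF v]) auto
  show "b r (v (r, t) x) \<in> E \<beta>"
  proof -
    obtain \<gamma> where "\<beta> < \<gamma>" "\<gamma> < \<alpha>" using assms(2) dense by blast
    then show ?thesis using assms by (intro strong_mem[OF b _ _ _ mem]) auto
  qed
  have "N \<beta> (b r (v (r, t) x)) \<le> K * (M \<alpha> / (\<gamma> - \<beta>)) * N \<alpha> x" if \<gamma>: "\<beta> < \<gamma>" "\<gamma> < \<alpha>" for \<gamma>
  proof -
    have "N \<beta> (b r (v (r, t) x)) \<le> M \<gamma> / (\<gamma> - \<beta>) * N \<gamma> (v (r, t) x)"
      using assms \<gamma> mem[OF \<gamma>] by (intro b_bound) auto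
    also have "\<dots> \<le> M \<alpha> / (\<gamma> - \<beta>) * (K * N \<alpha> x)"
      using assms \<gamma> mem[OF \<gamma>] M_nonneg[of \<alpha>]
      by (intro mult_mono divide_right_mono v_bound M_mono norm_nonneg) auto
    finally show ?thesis by (simp add: mult_ac)
  qed
  then have ev: "\<forall>\<^sub>F \<gamma> in at_left \<alpha>. N \<beta> (b r (v (r, t) x)) \<le> K * (M \<alpha> / (\<gamma> - \<beta>)) * N \<alpha> x"
    using eventually_at_left_real[OF assms(2)] by (auto elim: eventually_mono)
  have "((\<lambda>\<gamma>. K * (M \<alpha> / (\<gamma> - \<beta>)) * N \<alpha> x) \<longlongrightarrow> K * (M \<alpha> / (\<alpha> - \<beta>)) * N \<alpha> x) (at_left \<alpha>)"
    using assms(2) by (intro tendsto_intros) auto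
  then show "N \<beta> (b r (v (r, t) x)) \<le> K * (M \<alpha> / (\<alpha> - \<beta>)) * N \<alpha> x"
    by (rule tendsto_lowerbound[OF _ ev]) simp
qed

lemma rate_nonneg: "\<alpha>s < \<alpha> \<Longrightarrow> \<beta> < \<alpha> \<Longrightarrow> 0 \<le> rate \<beta> \<alpha>"
  using K_ge_1 M_nonneg by (auto simp: rate_def)

lemma w_mem:
  assumes "\<alpha>s < \<beta>" "\<beta> < \<alpha>" "k \<in> E \<alpha>" "0 \<le> s" "s \<le> t"
  shows "w n (s, t) k \<in> E \<beta>"
  using assms by (intro strong_mem[OF strong_w]) auto

lemma has_integral_power:
  fixes s t :: real
  assumes "s \<le> t"
  shows "((\<lambda>r. c * (t - r) ^ n) has_integral c * ((t - s) ^ Suc n / real (Suc n))) {s..t}"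
proof -
  let ?F = "\<lambda>r. - (c * (t - r) ^ Suc n / real (Suc n))"
  have "((\<lambda>r. c * (t - r) ^ n) has_integral ?F t - ?F s) {s..t}"
  proof (rule fundamental_theorem_of_calculus[OF assms])
    fix r :: real
    have "((\<lambda>r. (t - r) ^ Suc n) has_real_derivative real (Suc n) * (t - r) ^ n * (0 - 1)) (at r within {s..t})"
      by (rule derivative_eq_intros refl | simp)+
    from DERIV_cmult[OF this, of "- c / real (Suc n)"]
    have "(?F has_real_derivative c * (t - r) ^ n) (at r within {s..t})"
      by (simp del: power_Suc of_nat_Suc)
    then show "(?F has_vector_derivative c * (t - r) ^ n) (at r within {s..t})"
      by (simp add: has_real_derivative_iff_has_vector_derivative)
  qed
  then show ?thesis by simp
qed

text \<open>In the induction step the loss of regularity \<open>h = \<alpha> - \<beta>\<close> is divided in the proportion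
  \<open>1 : n + 1\<close> between the new factor \<open>b\<close> and the \<open>n\<close>-th term; the price \<open>(1 + 1 / (n + 1)) ^ (n + 1)\<close> of moving the intermediate
  index is at most \<open>exp 1\<close>, while the time integral yields \<open>1 / (n + 1)\<close>.\<close>

lemma w_bound:
  assumes "\<alpha>s < \<beta>" "\<beta> < \<alpha>" "k \<in> E \<alpha>" "0 \<le> s" "s \<le> t"
  shows "N \<beta> (w n (s, t) k) \<le> K * (rate \<beta> \<alpha> * (t - s)) ^ n * N \<alpha> k"
  using assms
proof (induction n arbitrary: \<beta> s)
  case 0
  then show ?case using v_bound by simp
next
  case (Suc n)
  define h where "h = \<alpha> - \<beta>"
  define \<gamma> where "\<gamma> = \<alpha> - h * ((real n + 1) / (real n + 2))"
  define L where "L = (real n + 2) / (real n + 1)"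
  have "0 < h" using Suc by (simp add: h_def)
  have L: "0 < L" "L ^ Suc n \<le> exp 1"
  proof -
    have "L = 1 + 1 / real (Suc n)" by (simp add: L_def field_simps)
    then show "L ^ Suc n \<le> exp 1"
      using exp_ge_one_plus_x_over_n_power_n[of "Suc n" 1] by simp
  qed (simp add: L_def)
  have \<alpha>\<gamma>: "\<alpha> - \<gamma> = h / L" by (simp add: \<gamma>_def L_def)
  have \<gamma>\<beta>: "\<gamma> - \<beta> = h / (real n + 2)" by (simp add: \<gamma>_def h_def field_simps)
  have \<gamma>: "\<beta> < \<gamma>" "\<gamma> < \<alpha>" "\<alpha>s < \<gamma>" "\<alpha>s < \<alpha>"
  proof -
    have "0 < \<gamma> - \<beta>" "0 < \<alpha> - \<gamma>" unfolding \<alpha>\<gamma> \<gamma>\<beta> using \<open>0 < h\<close> L by auto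
    then show "\<beta> < \<gamma>" "\<gamma> < \<alpha>" "\<alpha>s < \<gamma>" "\<alpha>s < \<alpha>" using Suc by auto
  qed
  note nonneg = M_nonneg[OF \<open>\<alpha>s < \<alpha>\<close>] M_nonneg[OF \<open>\<alpha>s < \<gamma>\<close>] norm_nonneg[OF \<open>\<alpha>s < \<alpha>\<close> Suc.prems(3)]
    rate_nonneg[OF \<open>\<alpha>s < \<alpha>\<close> Suc.prems(2)] rate_nonneg[OF \<open>\<alpha>s < \<alpha>\<close> \<gamma>(2)]
  have rate: "rate \<gamma> \<alpha> = rate \<beta> \<alpha> * L"
    using \<open>0 < h\<close> L by (simp add: rate_def \<alpha>\<gamma> flip: h_def)
  define Q where "Q = K * (M \<alpha> * (real n + 2) / h) * (K * (rate \<beta> \<alpha> * L) ^ n * N \<alpha> k)"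
  interpret banach_carrier smul "E \<beta>" "N \<beta>" using Suc.prems by (intro carrier)
  have "N \<beta> (w (Suc n) (s, t) k) \<le> Q * ((t - s) ^ Suc n / real (Suc n))"
  proof (rule has_int_norm_le[OF _ has_integral_power[OF Suc.prems(5)]])
    show "has_int_in \<beta> (\<lambda>r. v (s, r) (b r (w n (r, t) k))) (w (Suc n) (s, t) k) s t"
      unfolding w.simps by (rule conv_has_int[OF v strong_w Suc.prems])
    fix r assume r: "r \<in> {s..t}"
    have mem: "w n (r, t) k \<in> E \<gamma>" using r Suc.prems \<gamma> by (intro w_mem) auto
    have "N \<beta> (v (s, r) (b r (w n (r, t) k))) \<le> K * (M \<gamma> / (\<gamma> - \<beta>)) * N \<gamma> (w n (r, t) k)"
      using Suc.prems r \<gamma> mem by (intro vb_bound) auto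
    also have "\<dots> \<le> K * (M \<alpha> / (\<gamma> - \<beta>)) * (K * (rate \<gamma> \<alpha> * (t - r)) ^ n * N \<alpha> k)"
      using Suc.prems r \<gamma> K_ge_1 nonneg norm_nonneg[OF \<gamma>(3) mem]
      by (intro mult_mono divide_right_mono M_mono Suc.IH) auto
    also have "\<dots> = Q * (t - r) ^ n"
      by (simp add: Q_def \<gamma>\<beta> rate power_mult_distrib)
    finally show "N \<beta> (v (s, r) (b r (w n (r, t) k))) \<le> Q * (t - r) ^ n" .
  qed
  also have "\<dots> = (K * rate \<beta> \<alpha> ^ n * (t - s) ^ Suc n * N \<alpha> k) * (K * M \<alpha> / h * L ^ Suc n)"
  proof -
    have "real n + 2 = L * real (Suc n)" by (simp add: L_def add.commute)
    then have "Q * ((t - s) ^ Suc n / real (Suc n)) =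
        K * (M \<alpha> / h) * (K * (rate \<beta> \<alpha> * L) ^ n * N \<alpha> k) * (t - s) ^ Suc n * L"
      unfolding Q_def by (simp del: of_nat_Suc power_Suc)
    then show ?thesis by (simp add: power_mult_distrib)
  qed
  also have "\<dots> \<le> (K * rate \<beta> \<alpha> ^ n * (t - s) ^ Suc n * N \<alpha> k) * rate \<beta> \<alpha>"
  proof (rule mult_left_mono)
    have "0 \<le> exp (1::real)" by simp
    with L(2) have "L ^ Suc n \<le> 2 * exp 1" by linarith
    then have "K * M \<alpha> / h * L ^ Suc n \<le> K * M \<alpha> / h * (2 * exp 1)"
      using K_ge_1 nonneg \<open>0 < h\<close> by (intro mult_left_mono) auto
    also have "\<dots> = rate \<beta> \<alpha>" by (simp add: rate_def h_def)
    finally show "K * M \<alpha> / h * L ^ Suc n \<le> rate \<beta> \<alpha>" .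
  qed (use K_ge_1 nonneg Suc.prems in auto)
  finally show ?case by (simp add: power_mult_distrib mult_ac)
qed

subsection \<open>The sum of the series\<close>

definition partial :: "nat \<Rightarrow> real \<times> real \<Rightarrow> 'b \<Rightarrow> 'b"
  where "partial m z k = (\<Sum>n<m. w n z k)"

text \<open>As for \<open>sint\<close>, the limit may be taken in any space in which the series converges.\<close>

definition W :: "real \<times> real \<Rightarrow> 'b \<Rightarrow> 'b"
  where "W z k = (THE y. \<exists>\<beta>>\<alpha>s. y \<in> E \<beta> \<and> (\<forall>m. partial m z k \<in> E \<beta>) \<and>
    (\<lambda>m. N \<beta> (partial m z k - y)) \<longlonglongrightarrow> 0)"

lemma partial_mem:
  assumes "\<alpha>s < \<beta>" "\<beta> < \<alpha>" "k \<in> E \<alpha>" "0 \<le> s" "s \<le> t"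
  shows "partial m (s, t) k \<in> E \<beta>"
proof -
  interpret banach_carrier smul "E \<beta>" "N \<beta>" using assms by (intro carrier)
  show ?thesis unfolding partial_def by (intro mem_sum w_mem[OF assms])
qed

text \<open>Convergence in two spaces of the scale implies convergence in the larger one, where limits are unique.\<close>

lemma W_eqI:
  assumes "\<alpha>s < \<beta>" "y \<in> E \<beta>" "\<And>m. partial m z k \<in> E \<beta>" "(\<lambda>m. N \<beta> (partial m z k - y)) \<longlonglongrightarrow> 0"
  shows "W z k = y"
  unfolding W_def
proof (rule the_equality)
  show "\<exists>\<beta>>\<alpha>s. y \<in> E \<beta> \<and> (\<forall>m. partial m z k \<in> E \<beta>) \<and> (\<lambda>m. N \<beta> (partial m z k - y)) \<longlonglongrightarrow> 0"
    using assms by blast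
next
  fix x assume "\<exists>\<beta>>\<alpha>s. x \<in> E \<beta> \<and> (\<forall>m. partial m z k \<in> E \<beta>) \<and> (\<lambda>m. N \<beta> (partial m z k - x)) \<longlonglongrightarrow> 0"
  then obtain \<gamma> where \<gamma>: "\<alpha>s < \<gamma>" "x \<in> E \<gamma>" "\<And>m. partial m z k \<in> E \<gamma>" "(\<lambda>m. N \<gamma> (partial m z k - x)) \<longlonglongrightarrow> 0"
    by blast
  have weaker: "x \<in> E (min \<beta> \<gamma>) \<and> (\<lambda>m. N (min \<beta> \<gamma>) (partial m z k - x)) \<longlonglongrightarrow> 0"
    if \<delta>: "\<alpha>s < \<delta>" "min \<beta> \<gamma> \<le> \<delta>" "x \<in> E \<delta>" "\<And>m. partial m z k \<in> E \<delta>" "(\<lambda>m. N \<delta> (partial m z k - x)) \<longlonglongrightarrow> 0" for \<delta> x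
  proof -
    interpret banach_carrier smul "E \<delta>" "N \<delta>" using \<delta> by (intro carrier)
    have min: "\<alpha>s < min \<beta> \<gamma>" using assms(1) \<gamma>(1) by simp
    have diff: "partial m z k - x \<in> E \<delta>" for m using \<delta> by (intro mem_diff)
    have "0 \<le> N (min \<beta> \<gamma>) (partial m z k - x)" for m
      using norm_nonneg[OF min E_mono[OF min \<delta>(2) diff]] .
    then have "(\<lambda>m. N (min \<beta> \<gamma>) (partial m z k - x)) \<longlonglongrightarrow> 0"
      using N_mono[OF min \<delta>(2) diff]
      by (intro tendsto_sandwich[OF _ _ tendsto_const \<delta>(5)] always_eventually) auto
    then show ?thesis using E_mono[OF min \<delta>(2,3)] by blast
  qed
  interpret banach_carrier smul "E (min \<beta> \<gamma>)" "N (min \<beta> \<gamma>)" using assms \<gamma> by (intro carrier) auto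
  have "partial m z k \<in> E (min \<beta> \<gamma>)" for m
    using E_mono[of "min \<beta> \<gamma>" \<beta>] assms \<gamma> by auto
  then show "x = y"
    using weaker[OF \<gamma>(1) _ \<gamma>(2,3,4)] weaker[OF assms(1) _ assms(2,3,4)]
    by (intro q_unique_limit[of "\<lambda>m. partial m z k" x y]) auto
qed

lemma geometric_tail:
  fixes \<rho> :: real
  assumes "0 \<le> \<rho>" "\<rho> < 1"
  shows "(\<Sum>n=m..<m + j. \<rho> ^ n) \<le> \<rho> ^ m / (1 - \<rho>)"
proof -
  have "(\<Sum>n=m..<m + j. \<rho> ^ n) * (1 - \<rho>) = \<rho> ^ m - \<rho> ^ (m + j)"
    by (induction j) (auto simp: distrib_right right_diff_distrib)
  also have "\<dots> \<le> \<rho> ^ m" using assms by simp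
  finally show ?thesis using assms by (simp add: pos_le_divide_eq)
qed

lemma partial_tail:
  assumes "\<alpha>s < \<beta>" "\<beta> < \<alpha>" "k \<in> E \<alpha>" "0 \<le> s" "s \<le> t" and \<rho>: "rate \<beta> \<alpha> * (t - s) \<le> \<rho>" "\<rho> < 1" and "m \<le> m'"
  shows "N \<beta> (partial m' (s, t) k - partial m (s, t) k) \<le> K * \<rho> ^ m / (1 - \<rho>) * N \<alpha> k"
proof -
  interpret banach_carrier smul "E \<beta>" "N \<beta>" using assms by (intro carrier)
  have \<rho>0: "0 \<le> rate \<beta> \<alpha> * (t - s)" using assms by (intro mult_nonneg_nonneg rate_nonneg) auto
  have nn: "0 \<le> N \<alpha> k" using assms by (intro norm_nonneg) auto
  obtain j where j: "m' = m + j" using \<open>m \<le> m'\<close> le_Suc_ex by blast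
  have "partial m' (s, t) k = partial m (s, t) k + (\<Sum>n=m..<m + j. w n (s, t) k)"
    unfolding partial_def j lessThan_atLeast0 by (rule sum.atLeastLessThan_concat[symmetric]) auto
  then have "N \<beta> (partial m' (s, t) k - partial m (s, t) k) = N \<beta> (\<Sum>n=m..<m + j. w n (s, t) k)" by simp
  also have "\<dots> \<le> (\<Sum>n=m..<m + j. N \<beta> (w n (s, t) k))"
    using w_mem[OF assms(1-5)] by (intro q_sum_le)
  also have "\<dots> \<le> (\<Sum>n=m..<m + j. K * \<rho> ^ n * N \<alpha> k)"
  proof (rule sum_mono)
    fix n
    have "N \<beta> (w n (s, t) k) \<le> K * (rate \<beta> \<alpha> * (t - s)) ^ n * N \<alpha> k"
      by (rule w_bound[OF assms(1-5)])
    also have "\<dots> \<le> K * \<rho> ^ n * N \<alpha> k"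
      using \<rho> \<rho>0 nn K_ge_1 by (intro mult_right_mono mult_left_mono power_mono) auto
    finally show "N \<beta> (w n (s, t) k) \<le> K * \<rho> ^ n * N \<alpha> k" .
  qed
  also have "\<dots> = K * N \<alpha> k * (\<Sum>n=m..<m + j. \<rho> ^ n)"
    by (simp add: sum_distrib_left mult_ac)
  also have "\<dots> \<le> K * N \<alpha> k * (\<rho> ^ m / (1 - \<rho>))"
    using geometric_tail[of \<rho> m j] \<rho> \<rho>0 nn K_ge_1 by (intro mult_left_mono) auto
  finally show ?thesis by (simp add: mult_ac)
qed

lemma W_limit:
  assumes "\<alpha>s < \<beta>" "\<beta> < \<alpha>" "k \<in> E \<alpha>" "0 \<le> s" "s \<le> t" and \<rho>: "rate \<beta> \<alpha> * (t - s) < 1"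
  shows "W (s, t) k \<in> E \<beta>" "(\<lambda>m. N \<beta> (partial m (s, t) k - W (s, t) k)) \<longlonglongrightarrow> 0"
proof -
  interpret banach_carrier smul "E \<beta>" "N \<beta>" using assms by (intro carrier)
  define \<rho> where "\<rho> = rate \<beta> \<alpha> * (t - s)"
  have \<rho>1: "0 \<le> \<rho>" "\<rho> < 1" unfolding \<rho>_def using assms by (auto intro!: mult_nonneg_nonneg rate_nonneg)
  note mem = partial_mem[OF assms(1-5)]
  note tail = partial_tail[OF assms(1-5) _ \<rho>1(2), unfolded \<rho>_def, OF order_refl, folded \<rho>_def]
  have "(\<lambda>m. K * \<rho> ^ m / (1 - \<rho>) * N \<alpha> k) \<longlonglongrightarrow> K * 0 / (1 - \<rho>) * N \<alpha> k"
    using \<rho>1 by (intro tendsto_intros LIMSEQ_power_zero) auto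
  then have lim0: "(\<lambda>m. K * \<rho> ^ m / (1 - \<rho>) * N \<alpha> k) \<longlonglongrightarrow> 0" by simp
  have "\<exists>n0. \<forall>m\<ge>n0. \<forall>n\<ge>n0. N \<beta> (partial m (s, t) k - partial n (s, t) k) < e" if "0 < e" for e
  proof -
    have "\<forall>\<^sub>F m in sequentially. K * \<rho> ^ m / (1 - \<rho>) * N \<alpha> k < e"
      using lim0 \<open>0 < e\<close> by (rule order_tendstoD(2))
    then obtain n0 where n0: "\<And>m. n0 \<le> m \<Longrightarrow> K * \<rho> ^ m / (1 - \<rho>) * N \<alpha> k < e"
      by (auto simp: eventually_sequentially)
    have one: "N \<beta> (partial m (s, t) k - partial n (s, t) k) < e" if "n0 \<le> n" "n \<le> m" for m n
      using tail[OF that(2)] n0[OF that(1)] by linarith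
    have "N \<beta> (partial m (s, t) k - partial n (s, t) k) < e" if "n0 \<le> n" "n0 \<le> m" for m n
    proof (cases "n \<le> m")
      case False
      then show ?thesis using one[of m n] that q_diff_commute[OF mem mem, of m n] by simp
    qed (use one that in auto)
    then show ?thesis by blast
  qed
  then obtain y where y: "y \<in> E \<beta>" "(\<lambda>m. N \<beta> (partial m (s, t) k - y)) \<longlonglongrightarrow> 0"
    using q_complete[of "\<lambda>m. partial m (s, t) k", OF mem] by blast
  then have "W (s, t) k = y" by (intro W_eqI[OF assms(1)] mem)
  then show "W (s, t) k \<in> E \<beta>" "(\<lambda>m. N \<beta> (partial m (s, t) k - W (s, t) k)) \<longlonglongrightarrow> 0"
    using y by auto
qed

lemma W_tail:
  assumes "\<alpha>s < \<beta>" "\<beta> < \<alpha>" "k \<in> E \<alpha>" "0 \<le> s" "s \<le> t" and \<rho>: "rate \<beta> \<alpha> * (t - s) \<le> \<rho>" "\<rho> < 1"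
  shows "N \<beta> (W (s, t) k - partial m (s, t) k) \<le> K * \<rho> ^ m / (1 - \<rho>) * N \<alpha> k"
proof -
  interpret banach_carrier smul "E \<beta>" "N \<beta>" using assms by (intro carrier)
  note mem = partial_mem[OF assms(1-5)] and W = W_limit[OF assms(1-5)]
  have r1: "rate \<beta> \<alpha> * (t - s) < 1" using \<rho> by simp
  have "(\<lambda>m'. N \<beta> (partial m' (s, t) k - partial m (s, t) k)) \<longlonglongrightarrow> N \<beta> (W (s, t) k - partial m (s, t) k)"
    using W[OF r1] mem by (intro q_tendsto) auto
  then show ?thesis
    by (rule LIMSEQ_le_const2) (use partial_tail[OF assms] in blast)
qed

lemma W_bound:
  assumes "\<alpha>s < \<beta>" "\<beta> < \<alpha>" "k \<in> E \<alpha>" "0 \<le> s" "s \<le> t" and \<rho>: "rate \<beta> \<alpha> * (t - s) < 1"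
  shows "N \<beta> (W (s, t) k) \<le> K / (1 - rate \<beta> \<alpha> * (t - s)) * N \<alpha> k"
  using W_tail[OF assms(1-5) order_refl \<rho>, of 0] by (simp add: partial_def)

lemma W_refl:
  assumes "\<alpha>s < \<alpha>" "k \<in> E \<alpha>" "0 \<le> t"
  shows "W (t, t) k = k"
proof -
  obtain \<beta> where \<beta>: "\<alpha>s < \<beta>" "\<beta> < \<alpha>" using assms(1) dense by blast
  interpret banach_carrier smul "E \<beta>" "N \<beta>" using \<beta> by (intro carrier)
  have "N \<beta> (W (t, t) k - partial 1 (t, t) k) \<le> K * 0 ^ 1 / (1 - 0) * N \<alpha> k"
    using assms \<beta> by (intro W_tail) auto
  moreover have mem: "W (t, t) k - partial 1 (t, t) k \<in> E \<beta>"
    using assms \<beta> by (intro mem_diff W_limit partial_mem) auto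
  ultimately have "W (t, t) k - partial 1 (t, t) k = 0"
    using q_nonneg[OF mem] q_eq_0_iff[OF mem] by simp
  then show ?thesis using v_id[OF assms] by (simp add: partial_def)
qed

lemma W_linear:
  assumes "\<alpha>s < \<beta>" "\<beta> < \<alpha>" "x \<in> E \<alpha>" "0 \<le> s" "s \<le> t" and \<rho>: "rate \<beta> \<alpha> * (t - s) < 1"
  shows "y \<in> E \<alpha> \<Longrightarrow> W (s, t) (x + y) = W (s, t) x + W (s, t) y"
    and "W (s, t) (smul c x) = smul c (W (s, t) x)"
proof -
  interpret banach_carrier smul "E \<beta>" "N \<beta>" using assms by (intro carrier)
  interpret Y: banach_carrier smul "E \<alpha>" "N \<alpha>" using assms by (intro carrier) auto
  have lin: "scale_linear (w n (s, t))" for n using assms by (intro strong_linear[OF strong_w]) auto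
  have "\<alpha>s < \<alpha>" using assms by simp
  note mem = partial_mem[OF assms(1,2) _ assms(4,5)] and W = W_limit[OF assms(1,2) _ assms(4,5) \<rho>]
  show "W (s, t) (x + y) = W (s, t) x + W (s, t) y" if y: "y \<in> E \<alpha>"
  proof (rule W_eqI[OF assms(1)])
    have eq: "partial m (s, t) (x + y) = partial m (s, t) x + partial m (s, t) y" for m
      using scale_linearD(1)[OF lin \<open>\<alpha>s < \<alpha>\<close> assms(3) y] by (simp add: partial_def sum.distrib)
    have lim: "(\<lambda>m. N \<beta> (partial m (s, t) x - W (s, t) x) + N \<beta> (partial m (s, t) y - W (s, t) y)) \<longlonglongrightarrow> 0"
      using W assms(3) y by (intro tendsto_add_zero) auto
    have memd: "partial m (s, t) k - W (s, t) k \<in> E \<beta>" if "k \<in> E \<alpha>" for k m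
      using mem W that by (intro mem_diff) auto
    have decomp: "partial m (s, t) (x + y) - (W (s, t) x + W (s, t) y) =
        (partial m (s, t) x - W (s, t) x) + (partial m (s, t) y - W (s, t) y)" for m
      by (simp add: eq)
    have "N \<beta> (partial m (s, t) (x + y) - (W (s, t) x + W (s, t) y)) \<le>
        N \<beta> (partial m (s, t) x - W (s, t) x) + N \<beta> (partial m (s, t) y - W (s, t) y)"
      and "0 \<le> N \<beta> (partial m (s, t) (x + y) - (W (s, t) x + W (s, t) y))" for m
      unfolding decomp
      by (rule q_add_le[OF memd[OF assms(3)] memd[OF y]], rule q_nonneg[OF mem_add[OF memd[OF assms(3)] memd[OF y]]])
    then show "(\<lambda>m. N \<beta> (partial m (s, t) (x + y) - (W (s, t) x + W (s, t) y))) \<longlonglongrightarrow> 0"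
      by (intro tendsto_sandwich[OF _ _ tendsto_const lim] always_eventually) auto
  qed (use mem W assms(3) y in auto)
  show "W (s, t) (smul c x) = smul c (W (s, t) x)"
  proof (rule W_eqI[OF assms(1)])
    have eq: "partial m (s, t) (smul c x) = smul c (partial m (s, t) x)" for m
      using scale_linearD(2)[OF lin \<open>\<alpha>s < \<alpha>\<close> assms(3)] by (simp add: partial_def scale_sum_right)
    have "N \<beta> (partial m (s, t) (smul c x) - smul c (W (s, t) x)) = norm c * N \<beta> (partial m (s, t) x - W (s, t) x)" for m
      using q_scale[of "partial m (s, t) x - W (s, t) x" c] mem[OF assms(3)] W(1)[OF assms(3)]
      by (auto simp: eq scale_right_diff_distrib)
    then show "(\<lambda>m. N \<beta> (partial m (s, t) (smul c x) - smul c (W (s, t) x))) \<longlonglongrightarrow> 0"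
      using tendsto_mult_right_zero[OF W(2)[OF assms(3)]] by simp
  qed (use mem W assms(3) in auto)
qed

lemma partial_cont:
  assumes "\<alpha>s < \<beta>" "\<beta> < \<alpha>" "k \<in> E \<alpha>" "z \<in> time_pairs" "\<And>n. Z n \<in> time_pairs" "Z \<longlonglongrightarrow> z"
  shows "(\<lambda>n. N \<beta> (partial m (Z n) k - partial m z k)) \<longlonglongrightarrow> 0"
proof -
  interpret banach_carrier smul "E \<beta>" "N \<beta>" using assms by (intro carrier)
  have mem: "w i z' k \<in> E \<beta>" if "z' \<in> time_pairs" for i z'
    using that assms by (intro strong_mem[OF strong_w]) auto
  have lim: "(\<lambda>n. \<Sum>i<m. N \<beta> (w i (Z n) k - w i z k)) \<longlonglongrightarrow> 0"
  proof (rule tendsto_null_sum)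
    fix i
    have "cont_in \<beta> time_pairs (\<lambda>z. w i z k)"
      using assms by (intro strong_cont[OF strong_w]) auto
    then show "(\<lambda>n. N \<beta> (w i (Z n) k - w i z k)) \<longlonglongrightarrow> 0"
      by (rule cont_in_tendsto[OF assms(1) _ assms(4-6)])
  qed
  have md: "w i (Z n) k - w i z k \<in> E \<beta>" for i n using mem assms(4,5) by (intro mem_diff) auto
  have "partial m (Z n) k - partial m z k = (\<Sum>i<m. w i (Z n) k - w i z k)" for n
    by (simp add: partial_def sum_subtractf)
  then have "N \<beta> (partial m (Z n) k - partial m z k) \<le> (\<Sum>i<m. N \<beta> (w i (Z n) k - w i z k))"
    "0 \<le> N \<beta> (partial m (Z n) k - partial m z k)" for n
    using q_sum_le[of "{..<m}", OF md] q_nonneg[OF mem_sum[of "{..<m}", OF md]] by simp_all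
  then show ?thesis
    by (intro tendsto_sandwich[OF _ _ tendsto_const lim] always_eventually) auto
qed

text \<open>On a neighbourhood of each point of the domain the series converges uniformly, because there the
  ratio of the majorant stays below some \<open>\<rho> < 1\<close>.\<close>

lemma W_continuous:
  assumes "\<alpha>s < \<beta>" "\<beta> < \<alpha>" "k \<in> E \<alpha>"
  shows "norm_continuous_on (N \<beta>) {(s, t). 0 \<le> s \<and> s \<le> t \<and> rate \<beta> \<alpha> * (t - s) < 1} (\<lambda>z. W z k)"
proof -
  interpret banach_carrier smul "E \<beta>" "N \<beta>" using assms by (intro carrier)
  let ?S = "{(s, t). 0 \<le> s \<and> s \<le> t \<and> rate \<beta> \<alpha> * (t - s) < 1}"
  show ?thesis
    unfolding cont_iff
  proof (intro ballI allI impI)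
    fix z Z assume z: "z \<in> ?S" and Z: "(\<forall>n. Z n \<in> ?S) \<and> Z \<longlonglongrightarrow> z"
    define r where "r z = rate \<beta> \<alpha> * (snd z - fst z)" for z :: "real \<times> real"
    have ZS: "Z n \<in> ?S" for n by (rule Z[THEN conjunct1, rule_format])
    have Zn: "Z n \<in> time_pairs" for n using ZS[of n] by (cases "Z n") auto
    have mem: "partial m z k \<in> E \<beta>" if "z \<in> ?S" for m z using that assms by (auto intro!: partial_mem)
    have memW: "W z k \<in> E \<beta>" if "z \<in> ?S" for z using that assms by (auto intro!: W_limit)
    obtain \<rho> where \<rho>: "r z < \<rho>" "\<rho> < 1" using z dense[of "r z" 1] by (auto simp: r_def)
    have "0 \<le> r z" using z assms by (auto simp: r_def intro!: mult_nonneg_nonneg rate_nonneg)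
    have "(\<lambda>n. r (Z n)) \<longlonglongrightarrow> r z" unfolding r_def using Z by (intro tendsto_intros) auto
    then have near: "\<forall>\<^sub>F n in sequentially. r (Z n) < \<rho>" using \<rho>(1) by (rule order_tendstoD(1)[rotated] order_tendstoD(2))
    have tail: "N \<beta> (W z k - partial m z k) \<le> K * \<rho> ^ m / (1 - \<rho>) * N \<alpha> k" if "z \<in> ?S" "r z < \<rho>" for z m
      using that assms \<rho>(2) by (auto simp: r_def simp del: times_divide_eq_left intro!: W_tail)
    show "(\<lambda>n. N \<beta> (W (Z n) k - W z k)) \<longlonglongrightarrow> 0"
    proof (rule LIMSEQ_I)
      fix e :: real assume "0 < e"
      have "(\<lambda>m. K * \<rho> ^ m / (1 - \<rho>) * N \<alpha> k) \<longlonglongrightarrow> K * 0 / (1 - \<rho>) * N \<alpha> k"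
        using \<rho> \<open>0 \<le> r z\<close> by (intro tendsto_intros LIMSEQ_power_zero) auto
      then have "\<forall>\<^sub>F m in sequentially. K * \<rho> ^ m / (1 - \<rho>) * N \<alpha> k < e / 3"
        using \<open>0 < e\<close> by (intro order_tendstoD(2)) auto
      then obtain m where m: "K * \<rho> ^ m / (1 - \<rho>) * N \<alpha> k < e / 3" by (auto simp: eventually_sequentially)
      have "(\<lambda>n. N \<beta> (partial m (Z n) k - partial m z k)) \<longlonglongrightarrow> 0"
        using z Z by (intro partial_cont[OF assms] Zn) auto
      then have "\<forall>\<^sub>F n in sequentially. N \<beta> (partial m (Z n) k - partial m z k) < e / 3"
        using \<open>0 < e\<close> by (intro order_tendstoD(2)) auto
      then have "\<forall>\<^sub>F n in sequentially. norm (N \<beta> (W (Z n) k - W z k) - 0) < e"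
        using near
      proof eventually_elim
        case (elim n)
        note mems = memW[OF ZS[of n]] memW[OF z] mem[OF ZS[of n], of m] mem[OF z, of m]
        have "N \<beta> (W (Z n) k - W z k) \<le> N \<beta> (W (Z n) k - partial m (Z n) k) + N \<beta> (partial m (Z n) k - W z k)"
          using mems by (intro q_diff_triangle)
        also have "N \<beta> (partial m (Z n) k - W z k) \<le> N \<beta> (partial m (Z n) k - partial m z k) + N \<beta> (W z k - partial m z k)"
          using q_diff_triangle[of "partial m (Z n) k" "partial m z k" "W z k"] q_diff_commute[of "W z k" "partial m z k"] mems by simp
        finally have "N \<beta> (W (Z n) k - W z k) < e"
          using tail[OF ZS elim(2), of m] tail[OF z \<rho>(1), of m] elim(1) m by linarith
        then show ?case using q_nonneg[OF mem_diff[OF mems(1,2)]] by simp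
      qed
      then show "\<exists>n0. \<forall>n\<ge>n0. norm (N \<beta> (W (Z n) k - W z k) - 0) < e"
        by (auto simp: eventually_sequentially)
    qed
  qed
qed

end

section \<open>The two integral equations\<close>

context perturbed_evolution
begin

lemma scale_linear_sum:
  assumes "scale_linear f" "\<alpha>s < \<alpha>" "\<And>i. i \<in> I \<Longrightarrow> g i \<in> E \<alpha>"
  shows "f (sum g I) = (\<Sum>i\<in>I. f (g i))"
proof -
  interpret banach_carrier smul "E \<alpha>" "N \<alpha>" using assms by (intro carrier)
  have "f 0 = 0" using scale_linearD(3)[OF assms(1,2) mem_0 mem_0] by simp
  then show ?thesis
    using assms(3)
    by (induction I rule: infinite_finite_induct)
      (auto simp: scale_linearD(1)[OF assms(1,2)] mem_sum)
qed

lemma partial_conv: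
  "partial (Suc m) (s, t) k = v (s, t) k + (\<Sum>n<m. w (Suc n) (s, t) k)"
  unfolding partial_def sum.lessThan_Suc_shift by simp

lemma has_int_in_sum:
  fixes m :: nat
  assumes "\<alpha>s < \<beta>" "l \<le> u" "\<And>n. has_int_in \<beta> (f n) (I n) l u"
  shows "has_int_in \<beta> (\<lambda>x. \<Sum>n<m. f n x) (\<Sum>n<m. I n) l u"
proof -
  interpret banach_carrier smul "E \<beta>" "N \<beta>" using assms by (intro carrier)
  show ?thesis
  proof (induction m)
    case 0
    then show ?case using has_int_const[OF assms(2) mem_0] by simp
  next
    case (Suc m)
    then show ?case using has_int_add[OF Suc assms(3)[of m]] by simp
  qed
qed

lemma rate_le:
  assumes "\<alpha>s < \<alpha>" "\<beta> \<le> \<gamma>" "\<gamma> < \<alpha>"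
  shows "rate \<beta> \<alpha> \<le> rate \<gamma> \<alpha>"
  unfolding rate_def using assms K_ge_1 M_nonneg[of \<alpha>] by (intro divide_left_mono mult_nonneg_nonneg) auto

lemma series_remainder_tendsto_0:
  assumes "0 \<le> \<rho>" "\<rho> < (1::real)"
  shows "(\<lambda>m. c * (K * \<rho> ^ m / (1 - \<rho>) * d)) \<longlonglongrightarrow> 0"
proof -
  have "(\<lambda>m. c * (K * \<rho> ^ m / (1 - \<rho>) * d)) \<longlonglongrightarrow> c * (K * 0 / (1 - \<rho>) * d)"
    using assms by (intro tendsto_intros LIMSEQ_power_zero) auto
  then show ?thesis by simp
qed

lemma vb_sum:
  assumes "\<alpha>s < \<beta>" "\<beta> < \<gamma>" "0 \<le> s" "s \<le> r" "\<And>n. n \<in> I \<Longrightarrow> x n \<in> E \<gamma>"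
  shows "v (s, r) (b r (sum x I)) = (\<Sum>n\<in>I. v (s, r) (b r (x n)))"
proof -
  obtain \<delta> where \<delta>: "\<beta> < \<delta>" "\<delta> < \<gamma>" using assms(2) dense by blast
  have "b r (sum x I) = (\<Sum>n\<in>I. b r (x n))"
    using assms \<delta> by (intro scale_linear_sum[of _ \<gamma>] strong_linear[OF b]) auto
  also have "v (s, r) \<dots> = (\<Sum>n\<in>I. v (s, r) (b r (x n)))"
    using assms \<delta> by (intro scale_linear_sum[of _ \<delta>] strong_linear[OF v] strong_mem[OF b, of \<delta> \<gamma>]) auto
  finally show ?thesis .
qed

lemma vb_diff:
  assumes "\<alpha>s < \<beta>" "\<beta> < \<gamma>" "0 \<le> s" "s \<le> r" "x \<in> E \<gamma>" "y \<in> E \<gamma>"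
  shows "v (s, r) (b r (x - y)) = v (s, r) (b r x) - v (s, r) (b r y)"
proof -
  obtain \<delta> where \<delta>: "\<beta> < \<delta>" "\<delta> < \<gamma>" using assms(2) dense by blast
  have "b r (x - y) = b r x - b r y"
    using assms \<delta> by (intro scale_linearD(3)[of _ \<gamma>] strong_linear[OF b]) auto
  also have "v (s, r) \<dots> = v (s, r) (b r x) - v (s, r) (b r y)"
    using assms \<delta> by (intro scale_linearD(3)[of _ \<delta>] strong_linear[OF v] strong_mem[OF b, of \<delta> \<gamma>]) auto
  finally show ?thesis .
qed

text \<open>Termwise integration: the \<open>m\<close>-th partial sum under the integral yields the next partial sum without
  its first term \<open>v\<close>, and the remainder of the series is uniformly small in \<open>r\<close>.\<close>

lemma W_duhamel_VBW:
  assumes "\<alpha>s < \<beta>" "\<beta> < \<gamma>" "\<gamma> < \<alpha>" "0 \<le> s" "s \<le> t" "rate \<gamma> \<alpha> * (t - s) < 1" "k \<in> E \<alpha>"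
  shows "has_int_in \<beta> (\<lambda>r. v (s, r) (b r (W (r, t) k))) (W (s, t) k - v (s, t) k) s t"
proof -
  interpret banach_carrier smul "E \<beta>" "N \<beta>" using assms by (intro carrier)
  interpret Y: banach_carrier smul "E \<gamma>" "N \<gamma>" using assms by (intro carrier) auto
  define \<rho> where "\<rho> = rate \<gamma> \<alpha> * (t - s)"
  have \<rho>: "0 \<le> \<rho>" "\<rho> < 1" unfolding \<rho>_def using assms by (auto intro!: mult_nonneg_nonneg rate_nonneg)
  have ratek: "rate \<gamma> \<alpha> * (t - r) \<le> \<rho>" if "s \<le> r" for r
    unfolding \<rho>_def using assms that by (intro mult_left_mono rate_nonneg) auto
  have rate\<beta>: "rate \<beta> \<alpha> * (t - s) < 1"
    using mult_right_mono[OF rate_le[of \<alpha> \<beta> \<gamma>], of "t - s"] assms by auto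
  have W\<beta>: "W (s, t) k \<in> E \<beta>" "(\<lambda>m. N \<beta> (partial m (s, t) k - W (s, t) k)) \<longlonglongrightarrow> 0"
    using assms rate\<beta> by (auto intro!: W_limit[of \<beta> \<alpha>])
  have mem: "W (r, t) k \<in> E \<gamma>" "partial m (r, t) k \<in> E \<gamma>" "w m (r, t) k \<in> E \<gamma>" if "s \<le> r" "r \<le> t" for r m
    using assms that ratek[OF that(1)] \<rho> by (auto intro!: W_limit(1)[of \<gamma> \<alpha>] partial_mem[of \<gamma> \<alpha>] w_mem[of \<gamma> \<alpha>])
  have vY: "v (s, t) k \<in> E \<beta>" using assms by (intro strong_mem[OF v]) auto
  define c where "c = K * (M \<gamma> / (\<gamma> - \<beta>))"
  have "0 \<le> c" unfolding c_def using K_ge_1 M_nonneg[of \<gamma>] assms by simp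
  show ?thesis
  proof (rule has_int_uniform_limit[OF assms(5)])
    show "has_int_in \<beta> (\<lambda>r. v (s, r) (b r (partial m (r, t) k))) (\<Sum>n<m. w (Suc n) (s, t) k) s t" for m
    proof (rule has_int_cong)
      show "has_int_in \<beta> (\<lambda>r. \<Sum>n<m. v (s, r) (b r (w n (r, t) k))) (\<Sum>n<m. w (Suc n) (s, t) k) s t"
        unfolding w.simps using assms by (intro has_int_in_sum conv_has_int[OF v strong_w, of \<beta> \<alpha>]) auto
      show "(\<Sum>n<m. v (s, r) (b r (w n (r, t) k))) = v (s, r) (b r (partial m (r, t) k))"
        if "r \<in> {s..t}" for r
        unfolding partial_def using assms mem that by (intro vb_sum[of \<beta> \<gamma>, symmetric]) auto
    qed
    show "(\<lambda>r. v (s, r) (b r (W (r, t) k))) ` {s..t} \<subseteq> E \<beta>"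
      using assms mem by (auto intro!: vb_bound(1)[of \<beta> \<gamma>])
    show "W (s, t) k - v (s, t) k \<in> E \<beta>" using W\<beta> vY by auto
    show "(\<lambda>m. N \<beta> ((\<Sum>n<m. w (Suc n) (s, t) k) - (W (s, t) k - v (s, t) k))) \<longlonglongrightarrow> 0"
      using LIMSEQ_Suc[OF W\<beta>(2)] unfolding partial_conv by (simp add: diff_diff_eq2 add.commute)
    show "(\<lambda>m. c * (K * \<rho> ^ m / (1 - \<rho>) * N \<alpha> k)) \<longlonglongrightarrow> 0"
      using \<rho> by (rule series_remainder_tendsto_0)
    fix m r assume r: "r \<in> {s..t}"
    have tail: "N \<gamma> (W (r, t) k - partial m (r, t) k) \<le> K * \<rho> ^ m / (1 - \<rho>) * N \<alpha> k"
      by (rule W_tail) (use assms r \<rho>(2) ratek[of r] in simp_all)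
    have "v (s, r) (b r (W (r, t) k)) - v (s, r) (b r (partial m (r, t) k)) =
        v (s, r) (b r (W (r, t) k - partial m (r, t) k))"
      using assms mem r by (intro vb_diff[of \<beta> \<gamma>, symmetric]) auto
    moreover have "N \<beta> (v (s, r) (b r (W (r, t) k - partial m (r, t) k))) \<le>
        c * N \<gamma> (W (r, t) k - partial m (r, t) k)"
      unfolding c_def using assms mem r by (intro vb_bound(2)[of \<beta> \<gamma>] Y.mem_diff) auto
    moreover have "c * N \<gamma> (W (r, t) k - partial m (r, t) k) \<le> c * (K * \<rho> ^ m / (1 - \<rho>) * N \<alpha> k)"
      using tail \<open>0 \<le> c\<close> by (rule mult_left_mono)
    ultimately show "N \<beta> (v (s, r) (b r (W (r, t) k)) - v (s, r) (b r (partial m (r, t) k))) \<le>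
        c * (K * \<rho> ^ m / (1 - \<rho>) * N \<alpha> k)"
      by (simp only:)
  qed
qed

text \<open>The same argument with the splitting \<open>w_Suc_right\<close> of the terms.\<close>

lemma W_duhamel_WBV:
  assumes "\<alpha>s < \<beta>" "\<beta> < \<gamma>" "\<gamma> < \<alpha>" "0 \<le> s" "s \<le> t" "rate \<beta> \<alpha> * (t - s) < 1" "rate \<beta> \<gamma> * (t - s) < 1" "k \<in> E \<alpha>"
  shows "has_int_in \<beta> (\<lambda>r. W (s, r) (b r (v (r, t) k))) (W (s, t) k - v (s, t) k) s t"
proof -
  interpret banach_carrier smul "E \<beta>" "N \<beta>" using assms by (intro carrier)
  define \<rho> where "\<rho> = rate \<beta> \<gamma> * (t - s)"
  have \<rho>: "0 \<le> \<rho>" "\<rho> < 1" unfolding \<rho>_def using assms by (auto intro!: mult_nonneg_nonneg rate_nonneg)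
  have ratek: "rate \<beta> \<gamma> * (r - s) \<le> \<rho>" if "r \<le> t" for r
    unfolding \<rho>_def using assms that by (intro mult_left_mono rate_nonneg) auto
  have W\<beta>: "W (s, t) k \<in> E \<beta>" "(\<lambda>m. N \<beta> (partial m (s, t) k - W (s, t) k)) \<longlonglongrightarrow> 0"
    using assms by (auto intro!: W_limit[of \<beta> \<alpha>])
  define c where "c = K * (M \<alpha> / (\<alpha> - \<gamma>)) * N \<alpha> k"
  have x: "b r (v (r, t) k) \<in> E \<gamma>" "N \<gamma> (b r (v (r, t) k)) \<le> c" if "s \<le> r" "r \<le> t" for r
    using bv_bound[of \<gamma> \<alpha> r t k] assms that by (auto simp: c_def)
  have mem: "W (s, r) (b r (v (r, t) k)) \<in> E \<beta>" "partial m (s, r) (b r (v (r, t) k)) \<in> E \<beta>" if "s \<le> r" "r \<le> t" for r m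
    using assms that ratek[OF that(2)] \<rho> x[OF that] by (auto intro!: W_limit(1)[of _ \<gamma>] partial_mem[of _ \<gamma>])
  have vY: "v (s, t) k \<in> E \<beta>" using assms by (intro strong_mem[OF v]) auto
  show ?thesis
  proof (rule has_int_uniform_limit[OF assms(5)])
    show "has_int_in \<beta> (\<lambda>r. partial m (s, r) (b r (v (r, t) k))) (\<Sum>n<m. w (Suc n) (s, t) k) s t" for m
      unfolding partial_def
    proof (intro has_int_in_sum)
      fix n
      have "w (Suc n) (s, t) k = conv (w n) v (s, t) k"
        using assms by (intro w_Suc_right[of \<alpha>]) auto
      then show "has_int_in \<beta> (\<lambda>r. w n (s, r) (b r (v (r, t) k))) (w (Suc n) (s, t) k) s t"
        using assms conv_has_int[OF strong_w v, of \<beta> \<alpha> k s t n] by simp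
    qed (use assms in auto)
    show "(\<lambda>r. W (s, r) (b r (v (r, t) k))) ` {s..t} \<subseteq> E \<beta>" using mem by auto
    show "W (s, t) k - v (s, t) k \<in> E \<beta>" using W\<beta> vY by auto
    show "(\<lambda>m. N \<beta> ((\<Sum>n<m. w (Suc n) (s, t) k) - (W (s, t) k - v (s, t) k))) \<longlonglongrightarrow> 0"
      using LIMSEQ_Suc[OF W\<beta>(2)] unfolding partial_conv by (simp add: diff_diff_eq2 add.commute)
    show "(\<lambda>m. 1 * (K * \<rho> ^ m / (1 - \<rho>) * c)) \<longlonglongrightarrow> 0"
      using \<rho> by (rule series_remainder_tendsto_0)
    fix m r assume r: "r \<in> {s..t}"
    have "N \<beta> (W (s, r) (b r (v (r, t) k)) - partial m (s, r) (b r (v (r, t) k))) \<le>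
        K * \<rho> ^ m / (1 - \<rho>) * N \<gamma> (b r (v (r, t) k))"
      by (rule W_tail) (use assms r \<rho>(2) ratek[of r] x[of r] in simp_all)
    also have "\<dots> \<le> K * \<rho> ^ m / (1 - \<rho>) * c"
      using r \<rho> K_ge_1 x by (intro mult_left_mono) auto
    finally show "N \<beta> (W (s, r) (b r (v (r, t) k)) - partial m (s, r) (b r (v (r, t) k))) \<le>
        1 * (K * \<rho> ^ m / (1 - \<rho>) * c)" by simp
  qed
qed

end

section \<open>Uniqueness\<close>

text \<open>The predicate \<open>bd h \<sigma> C\<close> stands for a bound \<open>C\<close> on an operator that loses \<open>h\<close> of the index and acts over
  the time \<open>\<sigma>\<close>; \<open>step\<close> is an integral inequality in which the loss \<open>h\<close> may be divided, differently at
  each time \<open>\<sigma>\<close>, into \<open>h'\<close> for the operator itself and \<open>h - h'\<close> for a factor of norm \<open>c / (h - h')\<close>.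
  With the midpoint of \<open>\<mu> \<sigma>\<close> and \<open>h\<close> as \<open>h'\<close>, both \<open>h' - \<mu> \<sigma>\<close> and \<open>h - h'\<close> equal \<open>(h - \<mu> \<sigma>) / 2\<close>, so a
  bound \<open>A / (h - \<mu> \<sigma>)\<close> leads to the integrand \<open>4 c A / (h - \<mu> \<sigma>)\<^sup>2\<close>.  Since \<open>4 c = (2 / exp 1) \<mu>\<close>, its
  integral is at most \<open>(2 / exp 1) A / (h - \<mu> \<tau>)\<close>, a bound of the same shape.\<close>

lemma shrinking_bounds:
  fixes bd :: "real \<Rightarrow> real \<Rightarrow> real \<Rightarrow> bool" and c :: real
  defines "\<mu> \<equiv> 2 * exp 1 * c"
  assumes "0 \<le> c" "0 \<le> A"
    and mono: "\<And>h \<sigma> C C'. bd h \<sigma> C \<Longrightarrow> C \<le> C' \<Longrightarrow> bd h \<sigma> C'"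
    and init: "\<And>h \<sigma>. 0 < h \<Longrightarrow> h \<le> H \<Longrightarrow> 0 \<le> \<sigma> \<Longrightarrow> \<mu> * \<sigma> < h \<Longrightarrow> bd h \<sigma> (A / (h - \<mu> * \<sigma>))"
    and step: "\<And>h \<tau> g J. 0 < h \<Longrightarrow> h \<le> H \<Longrightarrow> 0 \<le> \<tau> \<Longrightarrow> \<mu> * \<tau> < h \<Longrightarrow> (g has_integral J) {0..\<tau>} \<Longrightarrow>
      (\<And>\<sigma>. 0 \<le> \<sigma> \<Longrightarrow> \<sigma> \<le> \<tau> \<Longrightarrow> \<exists>h' C. \<mu> * \<sigma> < h' \<and> h' \<le> (h + \<mu> * \<tau>) / 2 \<and> 0 \<le> C \<and> bd h' \<sigma> C \<and> c / (h - h') * C \<le> g \<sigma>) \<Longrightarrow>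
      bd h \<tau> J"
    and "0 < h" "h \<le> H" "0 \<le> \<tau>" "\<mu> * \<tau> < h"
  shows "bd h \<tau> ((2 / exp 1) ^ n * A / (h - \<mu> * \<tau>))"
  using assms(7-10)
proof (induction n arbitrary: h \<tau>)
  case 0
  then show ?case using init by simp
next
  case (Suc n)
  have "0 \<le> \<mu>" using assms by (simp add: \<mu>_def)
  define B where "B = (2 / exp 1) ^ n * A"
  have "0 \<le> B" using assms by (simp add: B_def)
  define k where "k = 2 / exp 1 * B"
  define G where "G \<sigma> = k / (h - \<mu> * \<sigma>)" for \<sigma>
  define g where "g \<sigma> = k * \<mu> / (h - \<mu> * \<sigma>)\<^sup>2" for \<sigma>
  have pos: "\<mu> * \<sigma> < h" if "\<sigma> \<le> \<tau>" for \<sigma>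
    using mult_left_mono[OF that \<open>0 \<le> \<mu>\<close>] Suc.prems by simp
  have "(g has_integral G \<tau> - G 0) {0..\<tau>}"
  proof (rule fundamental_theorem_of_calculus)
    fix \<sigma> assume \<sigma>: "\<sigma> \<in> {0..\<tau>}"
    then have "h - \<mu> * \<sigma> \<noteq> 0" using pos[of \<sigma>] by simp
    then have "(G has_real_derivative g \<sigma>) (at \<sigma> within {0..\<tau>})"
      unfolding G_def g_def
      by (auto intro!: derivative_eq_intros simp: power2_eq_square field_simps)
    then show "(G has_vector_derivative g \<sigma>) (at \<sigma> within {0..\<tau>})"
      by (simp add: has_real_derivative_iff_has_vector_derivative)
  qed (use Suc.prems in simp)
  then have "bd h \<tau> (G \<tau> - G 0)"
  proof (rule step[OF Suc.prems])
    fix \<sigma> assume \<sigma>: "0 \<le> \<sigma>" "\<sigma> \<le> \<tau>"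
    define d where "d = h - \<mu> * \<sigma>"
    have d: "0 < d" using pos[OF \<sigma>(2)] by (simp add: d_def)
    have \<sigma>\<tau>: "\<mu> * \<sigma> \<le> \<mu> * \<tau>" using \<sigma> \<open>0 \<le> \<mu>\<close> by (intro mult_left_mono)
    show "\<exists>h' C. \<mu> * \<sigma> < h' \<and> h' \<le> (h + \<mu> * \<tau>) / 2 \<and> 0 \<le> C \<and> bd h' \<sigma> C \<and> c / (h - h') * C \<le> g \<sigma>"
    proof (intro exI conjI)
      let ?h = "(h + \<mu> * \<sigma>) / 2"
      have hd: "?h - \<mu> * \<sigma> = d / 2" "h - ?h = d / 2" by (auto simp: d_def field_simps)
      have 0: "0 \<le> \<mu> * \<sigma>" using \<sigma> \<open>0 \<le> \<mu>\<close> by simp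
      show 1: "\<mu> * \<sigma> < ?h" using pos[OF \<sigma>(2)] by simp
      show "?h \<le> (h + \<mu> * \<tau>) / 2" using \<sigma>\<tau> by simp
      show "bd ?h \<sigma> (B / (?h - \<mu> * \<sigma>))"
        unfolding B_def using 0 1 pos[OF \<sigma>(2)] Suc.prems(1,2) \<sigma>(1) by (intro Suc.IH) auto
      show "0 \<le> B / (?h - \<mu> * \<sigma>)" unfolding hd using d \<open>0 \<le> B\<close> by simp
      have "k * \<mu> = 4 * c * B" by (simp add: k_def \<mu>_def)
      then show "c / (h - ?h) * (B / (?h - \<mu> * \<sigma>)) \<le> g \<sigma>"
        unfolding hd g_def d_def[symmetric] by (simp add: power2_eq_square)
    qed
  qed
  moreover have "0 \<le> G 0" using \<open>0 \<le> B\<close> Suc.prems by (simp add: G_def k_def)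
  ultimately have "bd h \<tau> (G \<tau>)" by (auto intro: mono)
  then show ?case by (simp add: G_def k_def B_def mult_ac)
qed

context perturbed_evolution
begin

text \<open>The consequences of (a) and (b) that uniqueness rests on.  In the first consistency
  condition one inequality implies the other, because the smaller target index has the longer horizon.\<close>

definition admissible :: "(real \<Rightarrow> real \<Rightarrow> 'b opfam) \<Rightarrow> bool"
  where "admissible U \<longleftrightarrow>
    (\<forall>\<beta> \<alpha> s t. \<alpha>s < \<beta> \<and> \<beta> < \<alpha> \<and> 0 \<le> s \<and> s \<le> t \<and> rate \<beta> \<alpha> * (t - s) < 1 \<longrightarrow>
      (\<forall>k\<in>E \<alpha>. U s t \<alpha> \<beta> k \<in> E \<beta> \<and> N \<beta> (U s t \<alpha> \<beta> k) \<le> K / (1 - rate \<beta> \<alpha> * (t - s)) * N \<alpha> k)) \<and>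
    (\<forall>\<beta> \<gamma> \<alpha> s t. \<alpha>s < \<beta> \<and> \<beta> < \<gamma> \<and> \<gamma> < \<alpha> \<and> 0 \<le> s \<and> s \<le> t \<and> rate \<gamma> \<alpha> * (t - s) < 1 \<longrightarrow>
      (\<forall>k\<in>E \<alpha>. U s t \<alpha> \<beta> k = U s t \<alpha> \<gamma> k)) \<and>
    (\<forall>\<beta> \<gamma> \<alpha> s t. \<alpha>s < \<beta> \<and> \<beta> < \<gamma> \<and> \<gamma> < \<alpha> \<and> 0 \<le> s \<and> s \<le> t \<and> rate \<beta> \<alpha> * (t - s) < 1 \<and> rate \<beta> \<gamma> * (t - s) < 1 \<longrightarrow>
      (\<forall>k\<in>E \<alpha>. U s t \<alpha> \<beta> k = U s t \<gamma> \<beta> k))"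

lemma admissibleD:
  assumes "admissible U" "\<alpha>s < \<beta>" "\<beta> < \<alpha>" "0 \<le> s" "s \<le> t" "rate \<beta> \<alpha> * (t - s) < 1" "k \<in> E \<alpha>"
  shows "U s t \<alpha> \<beta> k \<in> E \<beta>" "N \<beta> (U s t \<alpha> \<beta> k) \<le> K / (1 - rate \<beta> \<alpha> * (t - s)) * N \<alpha> k"
    "\<gamma> \<le> \<beta> \<Longrightarrow> \<alpha>s < \<gamma> \<Longrightarrow> U s t \<alpha> \<gamma> k = U s t \<alpha> \<beta> k"
    "\<beta> < \<gamma> \<Longrightarrow> \<gamma> \<le> \<alpha> \<Longrightarrow> rate \<beta> \<gamma> * (t - s) < 1 \<Longrightarrow> U s t \<alpha> \<beta> k = U s t \<gamma> \<beta> k"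
proof -
  note A = assms(1)[unfolded admissible_def]
  show "U s t \<alpha> \<beta> k \<in> E \<beta>" "N \<beta> (U s t \<alpha> \<beta> k) \<le> K / (1 - rate \<beta> \<alpha> * (t - s)) * N \<alpha> k"
    using A[THEN conjunct1] assms by blast+
  show "\<gamma> \<le> \<beta> \<Longrightarrow> \<alpha>s < \<gamma> \<Longrightarrow> U s t \<alpha> \<gamma> k = U s t \<alpha> \<beta> k"
    using A[THEN conjunct2, THEN conjunct1, rule_format, of \<gamma> \<beta> \<alpha> s t k] assms by (cases "\<gamma> = \<beta>") auto
  show "\<beta> < \<gamma> \<Longrightarrow> \<gamma> \<le> \<alpha> \<Longrightarrow> rate \<beta> \<gamma> * (t - s) < 1 \<Longrightarrow> U s t \<alpha> \<beta> k = U s t \<gamma> \<beta> k"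
    using A[THEN conjunct2, THEN conjunct2, rule_format, of \<beta> \<gamma> \<alpha> s t k] assms by (cases "\<gamma> = \<alpha>") auto
qed

lemma admissible_diff:
  assumes "admissible U" "admissible U'" "\<alpha>s < \<beta>" "\<beta> < \<alpha>" "0 \<le> s" "s \<le> t" "k \<in> E \<alpha>"
    and \<rho>: "rate \<beta> \<alpha> * (t - s) \<le> \<rho>" "\<rho> < 1"
  shows "U s t \<alpha> \<beta> k - U' s t \<alpha> \<beta> k \<in> E \<beta>"
    "N \<beta> (U s t \<alpha> \<beta> k - U' s t \<alpha> \<beta> k) \<le> 2 * K / (1 - \<rho>) * N \<alpha> k"
proof -
  interpret banach_carrier smul "E \<beta>" "N \<beta>" using assms by (intro carrier)
  have r: "rate \<beta> \<alpha> * (t - s) < 1" using \<rho> by simp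
  note D = admissibleD(1,2)[OF assms(1) assms(3-6) r assms(7)] admissibleD(1,2)[OF assms(2) assms(3-6) r assms(7)]
  show "U s t \<alpha> \<beta> k - U' s t \<alpha> \<beta> k \<in> E \<beta>" using D by (intro mem_diff)
  have "K / (1 - rate \<beta> \<alpha> * (t - s)) \<le> K / (1 - \<rho>)"
    using \<rho> K_ge_1 by (intro divide_left_mono mult_pos_pos) auto
  then have le: "K / (1 - rate \<beta> \<alpha> * (t - s)) * N \<alpha> k \<le> K / (1 - \<rho>) * N \<alpha> k"
    using assms by (intro mult_right_mono norm_nonneg) auto
  have "N \<beta> (U s t \<alpha> \<beta> k - U' s t \<alpha> \<beta> k) \<le> K / (1 - \<rho>) * N \<alpha> k + K / (1 - \<rho>) * N \<alpha> k"
    using q_diff_le[OF D(1,3)] D(2,4) le by linarith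
  then show "N \<beta> (U s t \<alpha> \<beta> k - U' s t \<alpha> \<beta> k) \<le> 2 * K / (1 - \<rho>) * N \<alpha> k" by simp
qed

text \<open>The ratio \<open>2 / exp 1\<close> is less than \<open>1\<close>.\<close>

lemma vanishing_from_shrinking:
  fixes X :: real
  assumes "\<And>n. X \<le> (2 / exp 1) ^ n * A / d * C"
  shows "X \<le> 0"
proof -
  have "2 < exp (1::real)" using exp_lower_Taylor_quadratic[of "1::real"] by simp
  then have "2 / exp 1 < (1::real)" by simp
  then have "(\<lambda>n. (2 / exp (1::real)) ^ n * (A / d * C)) \<longlonglongrightarrow> 0 * (A / d * C)"
    by (intro tendsto_intros LIMSEQ_power_zero) auto
  then have "(\<lambda>n. (2 / exp (1::real)) ^ n * A / d * C) \<longlonglongrightarrow> 0" by (simp add: mult.assoc)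
  then show ?thesis using LIMSEQ_le_const[of _ 0 X] assms by auto
qed

definition solves_WBV :: "(real \<Rightarrow> real \<Rightarrow> 'b opfam) \<Rightarrow> bool"
  where "solves_WBV U \<longleftrightarrow> (\<forall>\<beta> \<gamma> \<alpha> s t. \<alpha>s < \<beta> \<and> \<beta> < \<gamma> \<and> \<gamma> < \<alpha> \<and> 0 \<le> s \<and> s \<le> t \<and>
      rate \<beta> \<alpha> * (t - s) < 1 \<and> rate \<beta> \<gamma> * (t - s) < 1 \<longrightarrow>
    (\<forall>k\<in>E \<alpha>. has_int_in \<beta> (\<lambda>r. U s r \<gamma> \<beta> (b r (v (r, t) k))) (U s t \<alpha> \<beta> k - v (s, t) k) s t))"

definition solves_VBW :: "(real \<Rightarrow> real \<Rightarrow> 'b opfam) \<Rightarrow> bool"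
  where "solves_VBW U \<longleftrightarrow> (\<forall>\<beta> \<gamma> \<alpha> s t. \<alpha>s < \<beta> \<and> \<beta> < \<gamma> \<and> \<gamma> < \<alpha> \<and> 0 \<le> s \<and> s \<le> t \<and> rate \<gamma> \<alpha> * (t - s) < 1 \<longrightarrow>
    (\<forall>k\<in>E \<alpha>. has_int_in \<beta> (\<lambda>r. v (s, r) (b r (U r t \<alpha> \<gamma> k))) (U s t \<alpha> \<beta> k - v (s, t) k) s t))"

text \<open>The target index \<open>\<beta>\<close> and the initial time \<open>s\<close> stay fixed while the source index \<open>\<beta> + h\<close> and the
  final time \<open>s + \<sigma>\<close> vary.  Since \<open>M\<close> is monotone, replacing \<open>M (\<beta> + h)\<close> by \<open>M \<alpha>\<close> only shrinks the
  domain \<open>\<mu> \<sigma> < h\<close>, which still contains the point \<open>(H, t - s)\<close> of interest.\<close>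

lemma unique_WBV:
  assumes U: "admissible U" "solves_WBV U" and U': "admissible U'" "solves_WBV U'"
    and \<alpha>: "\<alpha>s < \<beta>" "\<beta> < \<alpha>" "0 \<le> s" "s \<le> t" "rate \<beta> \<alpha> * (t - s) < 1" "k \<in> E \<alpha>"
  shows "U s t \<alpha> \<beta> k = U' s t \<alpha> \<beta> k"
proof -
  interpret banach_carrier smul "E \<beta>" "N \<beta>" using \<alpha> by (intro carrier)
  have "\<alpha>s < \<alpha>" using \<alpha> by simp
  define c where "c = K * M \<alpha>"
  define \<mu> where "\<mu> = 2 * exp 1 * c"
  define H where "H = \<alpha> - \<beta>"
  have "0 \<le> c" using K_ge_1 M_nonneg[OF \<open>\<alpha>s < \<alpha>\<close>] by (simp add: c_def)
  have "0 < H" using \<alpha> by (simp add: H_def)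
  have rate: "rate \<beta> (\<beta> + h) * \<sigma> \<le> \<mu> * \<sigma> / h" if "0 < h" "h \<le> H" "0 \<le> \<sigma>" for h \<sigma>
  proof -
    have "M (\<beta> + h) \<le> M \<alpha>" using \<alpha> that by (intro M_mono) (auto simp: H_def)
    then have "rate \<beta> (\<beta> + h) \<le> \<mu> / h"
      unfolding rate_def \<mu>_def c_def using that K_ge_1 by (auto intro!: divide_right_mono mult_left_mono)
    then show ?thesis using mult_right_mono[OF _ that(3)] by fastforce
  qed
  define D where "D \<gamma> \<sigma> x = U s (s + \<sigma>) \<gamma> \<beta> x - U' s (s + \<sigma>) \<gamma> \<beta> x" for \<gamma> \<sigma> x
  define bd where "bd h \<sigma> C \<longleftrightarrow> (\<forall>x\<in>E (\<beta> + h). 0 < h \<longrightarrow> N \<beta> (D (\<beta> + h) \<sigma> x) \<le> C * N (\<beta> + h) x)" for h \<sigma> C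
  have main: "bd h \<tau> ((2 / exp 1) ^ n * (2 * K * H) / (h - \<mu> * \<tau>))"
    if h: "0 < h" "h \<le> H" "0 \<le> \<tau>" "\<mu> * \<tau> < h" for h \<tau> n
  proof (rule shrinking_bounds[where H = H and c = c and bd = bd, folded \<mu>_def])
    show "0 \<le> c" by fact
    show "0 \<le> 2 * K * H" using K_ge_1 \<open>0 < H\<close> by simp
    show "bd h \<sigma> C'" if "bd h \<sigma> C" "C \<le> C'" for h \<sigma> C C'
      unfolding bd_def
    proof (intro ballI impI)
      fix x assume x: "x \<in> E (\<beta> + h)" and "0 < h"
      then have "0 \<le> N (\<beta> + h) x" using \<alpha> by (intro norm_nonneg) auto
      then show "N \<beta> (D (\<beta> + h) \<sigma> x) \<le> C' * N (\<beta> + h) x"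
        using that x \<open>0 < h\<close> mult_right_mono[of C C' "N (\<beta> + h) x"] unfolding bd_def by fastforce
    qed
    show "bd h \<sigma> (2 * K * H / (h - \<mu> * \<sigma>))" if h: "0 < h" "h \<le> H" "0 \<le> \<sigma>" "\<mu> * \<sigma> < h" for h \<sigma>
      unfolding bd_def
    proof (intro ballI impI)
      fix x assume x: "x \<in> E (\<beta> + h)"
      have "N \<beta> (D (\<beta> + h) \<sigma> x) \<le> 2 * K / (1 - \<mu> * \<sigma> / h) * N (\<beta> + h) x"
        unfolding D_def using \<alpha> h x rate[OF h(1-3)] by (intro admissible_diff[OF U(1) U'(1)]) auto
      also have "\<dots> \<le> 2 * K * H / (h - \<mu> * \<sigma>) * N (\<beta> + h) x"
      proof (rule mult_right_mono)
        have "2 * K / (1 - \<mu> * \<sigma> / h) = 2 * K * h / (h - \<mu> * \<sigma>)" using h by (simp add: field_simps)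
        also have "\<dots> \<le> 2 * K * H / (h - \<mu> * \<sigma>)"
          using h K_ge_1 by (intro divide_right_mono mult_left_mono) auto
        finally show "2 * K / (1 - \<mu> * \<sigma> / h) \<le> 2 * K * H / (h - \<mu> * \<sigma>)" .
        show "0 \<le> N (\<beta> + h) x" using \<alpha> h x by (intro norm_nonneg) auto
      qed
      finally show "N \<beta> (D (\<beta> + h) \<sigma> x) \<le> 2 * K * H / (h - \<mu> * \<sigma>) * N (\<beta> + h) x" .
    qed
    show "bd h \<tau> J" if h: "0 < h" "h \<le> H" "0 \<le> \<tau>" "\<mu> * \<tau> < h" and g: "(g has_integral J) {0..\<tau>}"
      and bd: "\<And>\<sigma>. 0 \<le> \<sigma> \<Longrightarrow> \<sigma> \<le> \<tau> \<Longrightarrow> \<exists>h' C. \<mu> * \<sigma> < h' \<and> h' \<le> (h + \<mu> * \<tau>) / 2 \<and> 0 \<le> C \<and> bd h' \<sigma> C \<and> c / (h - h') * C \<le> g \<sigma>"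
      for h \<tau> g J
      unfolding bd_def
    proof (intro ballI impI)
      fix x assume x: "x \<in> E (\<beta> + h)"
      \<comment> \<open>A fixed intermediate index for the integral equation; consistency replaces it by \<open>\<beta> + h'\<close> pointwise.\<close>
      define \<gamma> where "\<gamma> = \<beta> + (h + \<mu> * \<tau>) / 2"
      have "0 \<le> \<mu>" using \<open>0 \<le> c\<close> by (simp add: \<mu>_def)
      have \<mu>\<tau>: "0 \<le> \<mu> * \<tau>" using \<open>0 \<le> \<mu>\<close> h by simp
      have \<gamma>: "\<beta> < \<gamma>" "\<gamma> < \<beta> + h" using \<mu>\<tau> h by (auto simp: \<gamma>_def)
      have r1: "rate \<beta> (\<beta> + h') * \<sigma> < 1" if "0 \<le> \<sigma>" "h' \<le> H" "\<mu> * \<sigma> < h'" for h' \<sigma>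
      proof -
        have "0 < h'" using that \<open>0 \<le> \<mu>\<close> mult_nonneg_nonneg[of \<mu> \<sigma>] by linarith
        then have "\<mu> * \<sigma> / h' < 1" using that by simp
        then show ?thesis using rate[OF \<open>0 < h'\<close> that(2,1)] by linarith
      qed
      have rh: "rate \<beta> (\<beta> + h) * (s + \<tau> - s) < 1" using r1[of \<tau> h] h by simp
      have r\<gamma>: "rate \<beta> \<gamma> * \<sigma> < 1" if "0 \<le> \<sigma>" "\<sigma> \<le> \<tau>" for \<sigma>
      proof -
        have "\<mu> * \<sigma> \<le> \<mu> * \<tau>" using that \<open>0 \<le> \<mu>\<close> by (intro mult_left_mono)
        then show ?thesis unfolding \<gamma>_def using that h by (intro r1) auto
      qed
      let ?y = "\<lambda>r. b r (v (r, s + \<tau>) x)"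
      have I: "has_int_in \<beta> (\<lambda>r. U s r \<gamma> \<beta> (?y r)) (U s (s + \<tau>) (\<beta> + h) \<beta> x - v (s, s + \<tau>) x) s (s + \<tau>)"
        "has_int_in \<beta> (\<lambda>r. U' s r \<gamma> \<beta> (?y r)) (U' s (s + \<tau>) (\<beta> + h) \<beta> x - v (s, s + \<tau>) x) s (s + \<tau>)"
        using U(2) U'(2) \<alpha> \<gamma> h x rh r\<gamma>[of \<tau>] unfolding solves_WBV_def by auto
      have int: "has_int_in \<beta> (\<lambda>r. U s r \<gamma> \<beta> (?y r) - U' s r \<gamma> \<beta> (?y r)) (D (\<beta> + h) \<tau> x) s (s + \<tau>)"
        using has_int_diff[OF I] by (simp add: D_def)
      have shift: "((\<lambda>r. g (r - s)) has_integral J) {s..s + \<tau>}"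
        using has_integral_affinity[of g J 0 \<tau> 1 "- s"] g by (simp add: add.commute)
      show "N \<beta> (D (\<beta> + h) \<tau> x) \<le> J * N (\<beta> + h) x"
      proof (rule has_int_norm_le[OF int has_integral_mult_left[OF shift]])
        fix r assume r: "r \<in> {s..s + \<tau>}"
        define \<sigma> where "\<sigma> = r - s"
        have \<sigma>: "0 \<le> \<sigma>" "\<sigma> \<le> \<tau>" "r = s + \<sigma>" using r by (auto simp: \<sigma>_def)
        obtain h' C where h': "\<mu> * \<sigma> < h'" "h' \<le> (h + \<mu> * \<tau>) / 2" "0 \<le> C" "bd h' \<sigma> C" "c / (h - h') * C \<le> g \<sigma>"
          using bd[OF \<sigma>(1,2)] by blast
        have "0 < h'" using h'(1) \<sigma> \<open>0 \<le> \<mu>\<close> mult_nonneg_nonneg[of \<mu> \<sigma>] by linarith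
        have "h' < h" "\<beta> + h' \<le> \<gamma>" using h' h by (auto simp: \<gamma>_def)
        have y: "?y r \<in> E (\<beta> + h')" "N (\<beta> + h') (?y r) \<le> K * (M (\<beta> + h) / (\<beta> + h - (\<beta> + h'))) * N (\<beta> + h) x"
          using bv_bound[of "\<beta> + h'" "\<beta> + h" r "s + \<tau>" x] \<alpha> \<open>0 < h'\<close> \<open>h' < h\<close> r x by auto
        have y\<gamma>: "?y r \<in> E \<gamma>" using \<alpha> \<gamma> r x by (intro bv_bound) auto
        have "U s r \<gamma> \<beta> (?y r) - U' s r \<gamma> \<beta> (?y r) = D (\<beta> + h') \<sigma> (?y r)"
          unfolding D_def \<sigma>(3)[symmetric]
          using admissibleD(4)[OF U(1) \<alpha>(1) \<gamma>(1) \<alpha>(3), of r "?y r" "\<beta> + h'"]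
            admissibleD(4)[OF U'(1) \<alpha>(1) \<gamma>(1) \<alpha>(3), of r "?y r" "\<beta> + h'"]
            r\<gamma>[OF \<sigma>(1,2)] r1[OF \<sigma>(1) _ h'(1)] y\<gamma> \<open>0 < h'\<close> \<open>h' < h\<close> h \<open>\<beta> + h' \<le> \<gamma>\<close> r
          by (simp add: \<sigma>_def)
        also have "N \<beta> \<dots> \<le> C * N (\<beta> + h') (?y r)"
          using h'(4) y(1) \<open>0 < h'\<close> by (auto simp: bd_def)
        also have "\<dots> \<le> C * (c / (h - h') * N (\<beta> + h) x)"
        proof (intro mult_left_mono h'(3))
          have "K * (M (\<beta> + h) / (\<beta> + h - (\<beta> + h'))) \<le> c / (h - h')"
            using K_ge_1 M_mono[of "\<beta> + h" \<alpha>] \<alpha> h \<open>h' < h\<close>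
            by (auto simp: c_def H_def intro!: divide_right_mono mult_left_mono)
          then show "N (\<beta> + h') (?y r) \<le> c / (h - h') * N (\<beta> + h) x"
            using \<alpha> h x by (intro order_trans[OF y(2)] mult_right_mono norm_nonneg) auto
        qed
        also have "\<dots> \<le> g \<sigma> * N (\<beta> + h) x"
          using mult_right_mono[OF h'(5) norm_nonneg[of "\<beta> + h" x]] \<alpha> h x by (simp add: mult_ac)
        finally show "N \<beta> (U s r \<gamma> \<beta> (?y r) - U' s r \<gamma> \<beta> (?y r)) \<le> g (r - s) * N (\<beta> + h) x"
          by (simp add: \<sigma>_def)
      qed
    qed
  qed (use h in auto)
  have "\<mu> * (t - s) < H"
  proof -
    have "rate \<beta> \<alpha> * (t - s) = \<mu> * (t - s) / H" by (simp add: rate_def \<mu>_def c_def H_def)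
    then show ?thesis using \<alpha>(5) \<open>0 < H\<close> by simp
  qed
  then have "N \<beta> (D \<alpha> (t - s) k) \<le> (2 / exp 1) ^ n * (2 * K * H) / (H - \<mu> * (t - s)) * N \<alpha> k" for n
    using main[of H "t - s" n] \<open>0 < H\<close> \<alpha> by (auto simp: bd_def H_def)
  then have "N \<beta> (D \<alpha> (t - s) k) \<le> 0" by (rule vanishing_from_shrinking)
  moreover have mem: "D \<alpha> (t - s) k \<in> E \<beta>"
    unfolding D_def using \<alpha> by (intro admissible_diff[OF U(1) U'(1), of _ _ _ _ _ "rate \<beta> \<alpha> * (t - s)"]) auto
  ultimately have "D \<alpha> (t - s) k = 0" using q_nonneg[OF mem] q_eq_0_iff[OF mem] by simp
  then show ?thesis by (simp add: D_def)
qed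

text \<open>Here the source index \<open>\<alpha>\<close>, the vector \<open>k\<close> and the final time \<open>t\<close> stay fixed, while the target index
  \<open>\<alpha> - h\<close> and the initial time \<open>t - \<sigma>\<close> vary; otherwise the argument is the one for \<open>unique_WBV\<close>.\<close>

lemma unique_VBW:
  assumes U: "admissible U" "solves_VBW U" and U': "admissible U'" "solves_VBW U'"
    and \<alpha>: "\<alpha>s < \<beta>" "\<beta> < \<alpha>" "0 \<le> s" "s \<le> t" "rate \<beta> \<alpha> * (t - s) < 1" "k \<in> E \<alpha>"
  shows "U s t \<alpha> \<beta> k = U' s t \<alpha> \<beta> k"
proof -
  have "\<alpha>s < \<alpha>" using \<alpha> by simp
  define c where "c = K * M \<alpha>"
  define \<mu> where "\<mu> = 2 * exp 1 * c"
  define H where "H = \<alpha> - \<beta>"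
  have "0 \<le> c" using K_ge_1 M_nonneg[OF \<open>\<alpha>s < \<alpha>\<close>] by (simp add: c_def)
  then have "0 \<le> \<mu>" by (simp add: \<mu>_def)
  have "0 < H" using \<alpha> by (simp add: H_def)
  have rate: "rate (\<alpha> - h) \<alpha> * \<sigma> = \<mu> * \<sigma> / h" for h \<sigma>
    by (simp add: rate_def \<mu>_def c_def)
  have nn: "0 \<le> N \<alpha> k" using \<alpha> by (intro norm_nonneg) auto
  define D where "D h \<sigma> = U (t - \<sigma>) t \<alpha> (\<alpha> - h) k - U' (t - \<sigma>) t \<alpha> (\<alpha> - h) k" for h \<sigma>
  have ratio: "\<mu> * \<sigma> / h < 1" if "0 < h" "\<mu> * \<sigma> < h" for h \<sigma> using that by simp
  have D: "D h \<sigma> \<in> E (\<alpha> - h)" "N (\<alpha> - h) (D h \<sigma>) \<le> 2 * K / (1 - \<mu> * \<sigma> / h) * N \<alpha> k"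
    if "0 < h" "h \<le> H" "0 \<le> \<sigma>" "\<sigma> \<le> t" "\<mu> * \<sigma> < h" for h \<sigma>
  proof -
    have "rate (\<alpha> - h) \<alpha> * (t - (t - \<sigma>)) \<le> \<mu> * \<sigma> / h" using rate[of h \<sigma>] by simp
    then show "D h \<sigma> \<in> E (\<alpha> - h)" "N (\<alpha> - h) (D h \<sigma>) \<le> 2 * K / (1 - \<mu> * \<sigma> / h) * N \<alpha> k"
      unfolding D_def using that \<alpha> ratio[OF that(1,5)]
        admissible_diff[OF U(1) U'(1), of "\<alpha> - h" \<alpha> "t - \<sigma>" t k "\<mu> * \<sigma> / h"]
      by (auto simp: H_def)
  qed
  have D_eq: "D h \<sigma> = D h' \<sigma>" if "0 < h'" "h' \<le> h" "h \<le> H" "0 \<le> \<sigma>" "\<sigma> \<le> t" "\<mu> * \<sigma> < h'" for h h' \<sigma>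
    unfolding D_def using that \<alpha> rate[of h' \<sigma>] ratio[OF that(1,6)]
      admissibleD(3)[OF U(1), of "\<alpha> - h'" \<alpha> "t - \<sigma>" t k "\<alpha> - h"] admissibleD(3)[OF U'(1), of "\<alpha> - h'" \<alpha> "t - \<sigma>" t k "\<alpha> - h"]
    by (simp add: H_def)
  define bd where "bd h \<sigma> C \<longleftrightarrow> (\<sigma> \<le> t \<longrightarrow> 0 < h \<longrightarrow> N (\<alpha> - h) (D h \<sigma>) \<le> C)" for h \<sigma> C
  have main: "bd h \<tau> ((2 / exp 1) ^ n * (2 * K * H * N \<alpha> k) / (h - \<mu> * \<tau>))"
    if h: "0 < h" "h \<le> H" "0 \<le> \<tau>" "\<mu> * \<tau> < h" for h \<tau> n
  proof (rule shrinking_bounds[where H = H and c = c and bd = bd, folded \<mu>_def])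
    show "0 \<le> c" by fact
    show "0 \<le> 2 * K * H * N \<alpha> k" using K_ge_1 \<open>0 < H\<close> nn by simp
    show "bd h \<sigma> C'" if "bd h \<sigma> C" "C \<le> C'" for h \<sigma> C C'
      using that by (auto simp: bd_def)
    show "bd h \<sigma> (2 * K * H * N \<alpha> k / (h - \<mu> * \<sigma>))" if h: "0 < h" "h \<le> H" "0 \<le> \<sigma>" "\<mu> * \<sigma> < h" for h \<sigma>
      unfolding bd_def
    proof (intro impI)
      assume "\<sigma> \<le> t"
      then have "N (\<alpha> - h) (D h \<sigma>) \<le> 2 * K / (1 - \<mu> * \<sigma> / h) * N \<alpha> k" using h by (intro D) auto
      also have "2 * K / (1 - \<mu> * \<sigma> / h) * N \<alpha> k = 2 * K * h * N \<alpha> k / (h - \<mu> * \<sigma>)"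
        using h by (simp add: field_simps)
      also have "\<dots> \<le> 2 * K * H * N \<alpha> k / (h - \<mu> * \<sigma>)"
        using h K_ge_1 nn by (intro divide_right_mono mult_right_mono mult_left_mono) auto
      finally show "N (\<alpha> - h) (D h \<sigma>) \<le> 2 * K * H * N \<alpha> k / (h - \<mu> * \<sigma>)" .
    qed
    show "bd h \<tau> J" if h: "0 < h" "h \<le> H" "0 \<le> \<tau>" "\<mu> * \<tau> < h" and g: "(g has_integral J) {0..\<tau>}"
      and bd: "\<And>\<sigma>. 0 \<le> \<sigma> \<Longrightarrow> \<sigma> \<le> \<tau> \<Longrightarrow> \<exists>h' C. \<mu> * \<sigma> < h' \<and> h' \<le> (h + \<mu> * \<tau>) / 2 \<and> 0 \<le> C \<and> bd h' \<sigma> C \<and> c / (h - h') * C \<le> g \<sigma>"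
      for h \<tau> g J
      unfolding bd_def
    proof (intro impI)
      assume "\<tau> \<le> t"
      \<comment> \<open>The index \<open>\<alpha> - h2\<close> serves in the integral equation; consistency replaces it by \<open>\<alpha> - h'\<close> pointwise.\<close>
      define h2 where "h2 = (h + \<mu> * \<tau>) / 2"
      have \<mu>\<tau>: "0 \<le> \<mu> * \<tau>" using \<open>0 \<le> \<mu>\<close> h by simp
      have h2: "0 < h2" "\<mu> * \<tau> < h2" "h2 < h" "h2 \<le> H" using \<mu>\<tau> h by (auto simp: h2_def)
      have \<gamma>: "\<alpha>s < \<alpha> - h" "\<alpha> - h < \<alpha> - h2" "\<alpha> - h2 < \<alpha>" using \<alpha> h h2 by (auto simp: H_def)
      have \<mu>\<sigma>: "\<mu> * \<sigma> \<le> \<mu> * \<tau>" if "\<sigma> \<le> \<tau>" for \<sigma> using that \<open>0 \<le> \<mu>\<close> by (intro mult_left_mono)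
      interpret banach_carrier smul "E (\<alpha> - h)" "N (\<alpha> - h)" using \<gamma> by (intro carrier)
      have r2: "rate (\<alpha> - h2) \<alpha> * (t - (t - \<tau>)) < 1" using rate[of h2 \<tau>] ratio[OF h2(1,2)] by simp
      have mem: "U r t \<alpha> (\<alpha> - h2) k \<in> E (\<alpha> - h2)" "U' r t \<alpha> (\<alpha> - h2) k \<in> E (\<alpha> - h2)" if "r \<in> {t - \<tau>..t}" for r
      proof -
        have "\<mu> * (t - r) < h2" using \<mu>\<sigma>[of "t - r"] that h2(2) by auto
        then have "rate (\<alpha> - h2) \<alpha> * (t - r) < 1" using rate[of h2 "t - r"] ratio[OF h2(1)] by simp
        then show "U r t \<alpha> (\<alpha> - h2) k \<in> E (\<alpha> - h2)" "U' r t \<alpha> (\<alpha> - h2) k \<in> E (\<alpha> - h2)"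
          using that \<alpha> \<gamma> \<open>\<tau> \<le> t\<close> by (auto intro!: admissibleD(1)[OF U(1)] admissibleD(1)[OF U'(1)])
      qed
      have I: "has_int_in (\<alpha> - h) (\<lambda>r. v (t - \<tau>, r) (b r (U r t \<alpha> (\<alpha> - h2) k)))
          (U (t - \<tau>) t \<alpha> (\<alpha> - h) k - v (t - \<tau>, t) k) (t - \<tau>) t"
        "has_int_in (\<alpha> - h) (\<lambda>r. v (t - \<tau>, r) (b r (U' r t \<alpha> (\<alpha> - h2) k)))
          (U' (t - \<tau>) t \<alpha> (\<alpha> - h) k - v (t - \<tau>, t) k) (t - \<tau>) t"
        using U(2) U'(2) \<gamma> \<alpha> h \<open>\<tau> \<le> t\<close> r2 unfolding solves_VBW_def by auto
      have "has_int_in (\<alpha> - h) (\<lambda>r. v (t - \<tau>, r) (b r (U r t \<alpha> (\<alpha> - h2) k)) - v (t - \<tau>, r) (b r (U' r t \<alpha> (\<alpha> - h2) k)))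
          (D h \<tau>) (t - \<tau>) t"
        using has_int_diff[OF I] by (simp add: D_def)
      then have int: "has_int_in (\<alpha> - h) (\<lambda>r. v (t - \<tau>, r) (b r (D h2 (t - r)))) (D h \<tau>) (t - \<tau>) t"
        by (rule has_int_cong) (use \<open>\<tau> \<le> t\<close> h \<gamma> mem in \<open>auto simp: D_def intro!: vb_diff[of "\<alpha> - h" "\<alpha> - h2", symmetric]\<close>)
      have reflect: "((\<lambda>r. g (t - r)) has_integral J) {t - \<tau>..t}"
        using has_integral_affinity[of g J 0 \<tau> "- 1" t] g by (simp add: add.commute)
      show "N (\<alpha> - h) (D h \<tau>) \<le> J"
      proof (rule has_int_norm_le[OF int reflect])
        fix r assume r: "r \<in> {t - \<tau>..t}"
        define \<sigma> where "\<sigma> = t - r"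
        have \<sigma>: "0 \<le> \<sigma>" "\<sigma> \<le> \<tau>" "\<sigma> \<le> t" using r \<open>\<tau> \<le> t\<close> by (auto simp: \<sigma>_def)
        obtain h' C where h': "\<mu> * \<sigma> < h'" "h' \<le> h2" "0 \<le> C" "bd h' \<sigma> C" "c / (h - h') * C \<le> g \<sigma>"
          using bd[OF \<sigma>(1,2)] unfolding h2_def by blast
        have "0 \<le> \<mu> * \<sigma>" using \<open>0 \<le> \<mu>\<close> \<sigma> by simp
        then have "0 < h'" "h' < h" "h' \<le> H" using h' h2 by auto
        have "D h2 \<sigma> = D h' \<sigma>" using \<open>0 < h'\<close> h' h2 \<sigma> by (intro D_eq) auto
        then have "N (\<alpha> - h) (v (t - \<tau>, r) (b r (D h2 \<sigma>))) \<le> K * (M (\<alpha> - h') / (h - h')) * N (\<alpha> - h') (D h' \<sigma>)"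
          using vb_bound(2)[of "\<alpha> - h" "\<alpha> - h'" "t - \<tau>" r "D h' \<sigma>"] D(1)[of h' \<sigma>] \<gamma> \<open>0 < h'\<close> \<open>h' < h\<close> \<open>h' \<le> H\<close> \<open>\<tau> \<le> t\<close> \<sigma> h'(1) r
          by auto
        also have "\<dots> \<le> c / (h - h') * C"
        proof (rule mult_mono)
          have "M (\<alpha> - h') \<le> M \<alpha>" using \<gamma> \<open>0 < h'\<close> \<open>h' < h\<close> by (intro M_mono) auto
          then have "K * M (\<alpha> - h') \<le> c" using K_ge_1 by (simp add: c_def)
          then show "K * (M (\<alpha> - h') / (h - h')) \<le> c / (h - h')"
            using divide_right_mono[of "K * M (\<alpha> - h')" c "h - h'"] \<open>h' < h\<close> by simp
          show "N (\<alpha> - h') (D h' \<sigma>) \<le> C" using h'(4) \<sigma> \<open>0 < h'\<close> by (simp add: bd_def)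
          show "0 \<le> c / (h - h')" using \<open>0 \<le> c\<close> \<open>h' < h\<close> by simp
          show "0 \<le> N (\<alpha> - h') (D h' \<sigma>)"
            using D(1)[of h' \<sigma>] \<gamma> \<open>0 < h'\<close> \<open>h' < h\<close> \<open>h' \<le> H\<close> \<sigma> h'(1) by (intro norm_nonneg) auto
        qed
        finally show "N (\<alpha> - h) (v (t - \<tau>, r) (b r (D h2 (t - r)))) \<le> g (t - r)"
          using h'(5) by (simp add: \<sigma>_def)
      qed
    qed
  qed (use h in auto)
  have "\<mu> * (t - s) < H"
    using rate[of H "t - s"] \<alpha>(5) \<open>0 < H\<close> by (simp add: H_def)
  then have "N (\<alpha> - H) (D H (t - s)) \<le> (2 / exp 1) ^ n * (2 * K * H * N \<alpha> k) / (H - \<mu> * (t - s)) * 1" for n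
    using main[of H "t - s" n] \<open>0 < H\<close> \<alpha> by (simp add: bd_def)
  then have "N (\<alpha> - H) (D H (t - s)) \<le> 0" by (rule vanishing_from_shrinking)
  then have le: "N \<beta> (D H (t - s)) \<le> 0" by (simp add: H_def)
  interpret banach_carrier smul "E \<beta>" "N \<beta>" using \<alpha> by (intro carrier)
  have mem: "D H (t - s) \<in> E \<beta>"
    using D(1)[of H "t - s"] \<open>\<mu> * (t - s) < H\<close> \<open>0 < H\<close> \<alpha> by (simp add: H_def)
  have "D H (t - s) = 0" using le q_nonneg[OF mem] q_eq_0_iff[OF mem] by simp
  then show ?thesis by (simp add: D_def H_def)
qed

end

section \<open>From indexed collections to single maps\<close>

text \<open>Boundedness makes the set of quotients bounded above, so the supremum is an upper bound; vectors of
  norm \<open>0\<close> contribute the quotient \<open>0\<close>.\<close>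

lemma onorm_on_bound:
  assumes "banach_carrier smul X p" "banach_carrier smul Y q" "bounded_linear_on smul X p Y q f" "x \<in> X"
  shows "q (f x) \<le> onorm_on X p q f * p x"
proof -
  interpret X: banach_carrier smul X p by fact
  interpret Y: banach_carrier smul Y q by fact
  obtain C where C: "\<And>x. x \<in> X \<Longrightarrow> q (f x) \<le> C * p x"
    using assms(3) unfolding bounded_linear_on_def by blast
  have "f (smul 0 0) = smul 0 (f 0)"
    using assms(3) X.mem_0 unfolding bounded_linear_on_def by blast
  then have f0: "f 0 = 0" by simp
  show ?thesis
  proof (cases "x = 0")
    case False
    then have "0 < p x" using X.q_nonneg[OF assms(4)] X.q_eq_0_iff[OF assms(4)] by simp
    have "bdd_above ((\<lambda>x. q (f x) / p x) ` X)"
    proof (rule bdd_aboveI2)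
      fix x assume x: "x \<in> X"
      show "q (f x) / p x \<le> max C 0"
      proof (cases "p x = 0")
        case False
        then show ?thesis using C[OF x] X.q_nonneg[OF x] by (simp add: divide_le_eq le_max_iff_disj)
      qed simp
    qed
    then have "q (f x) / p x \<le> onorm_on X p q f"
      unfolding onorm_on_def using assms(4) by (rule cSUP_upper[rotated])
    then show ?thesis using \<open>0 < p x\<close> by (simp add: divide_le_eq)
  qed (simp add: f0)
qed

lemma onorm_on_least:
  assumes "banach_carrier smul X p" "0 \<le> C" "\<And>x. x \<in> X \<Longrightarrow> q (f x) \<le> C * p x"
  shows "onorm_on X p q f \<le> C"
  unfolding onorm_on_def
proof (rule cSUP_least)
  interpret X: banach_carrier smul X p by fact
  show "X \<noteq> {}" using X.mem_0 by blast
  fix x assume x: "x \<in> X"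
  show "q (f x) / p x \<le> C"
  proof (cases "p x = 0")
    case False
    then show ?thesis using X.q_nonneg[OF x] assms(3)[OF x] by (simp add: divide_le_eq)
  qed (use assms(2) in simp)
qed

lemma ex_eq_add_iff: "(\<exists>I. P I \<and> u = x + I) \<longleftrightarrow> P (u - x)" for u x :: "'a::ab_group_add"
  by (auto simp: eq_diff_eq add.commute intro!: exI[of _ "u - x"])

context scale
begin

text \<open>The choice of indices is immaterial by \<open>index_free_eq\<close>.\<close>

definition index_free :: "'a opfam \<Rightarrow> 'a \<Rightarrow> 'a"
  where "index_free A k = (SOME y. \<exists>\<alpha> \<beta>. \<alpha>s < \<beta> \<and> \<beta> < \<alpha> \<and> k \<in> E \<alpha> \<and> y = A \<alpha> \<beta> k)"

lemma index_free_eq: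
  assumes A: "A \<in> scale_ops smul \<alpha>s E N" and \<alpha>: "\<alpha>s < \<beta>" "\<beta> < \<alpha>" "k \<in> E \<alpha>"
  shows "A \<alpha> \<beta> k = index_free A k"
proof -
  have compat: "A \<alpha>3 \<alpha>1 x = A \<alpha>3 \<alpha>2 x \<and> A \<alpha>3 \<alpha>1 x = A \<alpha>2 \<alpha>1 x"
    if "\<alpha>s < \<alpha>1" "\<alpha>1 < \<alpha>2" "\<alpha>2 < \<alpha>3" "x \<in> E \<alpha>3" for \<alpha>1 \<alpha>2 \<alpha>3 x
    using A that unfolding scale_ops_def by blast
  have "\<exists>\<alpha> \<beta>. \<alpha>s < \<beta> \<and> \<beta> < \<alpha> \<and> k \<in> E \<alpha> \<and> index_free A k = A \<alpha> \<beta> k"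
    unfolding index_free_def by (rule someI_ex) (use \<alpha> in blast)
  then obtain \<alpha>' \<beta>' where \<alpha>': "\<alpha>s < \<beta>'" "\<beta>' < \<alpha>'" "k \<in> E \<alpha>'" "index_free A k = A \<alpha>' \<beta>' k" by blast
  define \<delta> where "\<delta> = min \<beta> \<beta>'"
  have "\<alpha>s < \<delta>" "\<delta> < \<alpha>" "\<delta> < \<alpha>'" using \<alpha> \<alpha>' by (auto simp: \<delta>_def)
  have "A \<alpha> \<beta> k = A \<alpha> \<delta> k" using compat[of \<delta> \<beta> \<alpha> k] \<alpha> \<open>\<alpha>s < \<delta>\<close> by (cases "\<delta> = \<beta>") (auto simp: \<delta>_def)
  moreover have "A \<alpha>' \<beta>' k = A \<alpha>' \<delta> k"
    using compat[of \<delta> \<beta>' \<alpha>' k] \<alpha>' \<open>\<alpha>s < \<delta>\<close> by (cases "\<delta> = \<beta>'") (auto simp: \<delta>_def)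
  moreover have "A \<alpha> \<delta> k = A \<alpha>' \<delta> k"
  proof (cases \<alpha> \<alpha>' rule: linorder_cases)
    case less
    then show ?thesis
      by (rule conjunct2[OF compat[OF \<open>\<alpha>s < \<delta>\<close> \<open>\<delta> < \<alpha>\<close> _ \<alpha>'(3)], symmetric])
  next
    case greater
    then show ?thesis
      by (rule conjunct2[OF compat[OF \<open>\<alpha>s < \<delta>\<close> \<open>\<delta> < \<alpha>'\<close> _ \<alpha>(3)]])
  qed simp
  ultimately show ?thesis using \<alpha>'(4) by simp
qed

lemma scale_ops_bounded_linear:
  "A \<in> scale_ops smul \<alpha>s E N \<Longrightarrow> \<alpha>s < \<beta> \<Longrightarrow> \<beta> < \<alpha> \<Longrightarrow> bounded_linear_on smul (E \<alpha>) (N \<alpha>) (E \<beta>) (N \<beta>) (A \<alpha> \<beta>)"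
  by (simp add: scale_ops_def)

lemma scale_linear_index_free:
  assumes A: "A \<in> scale_ops smul \<alpha>s E N"
  shows "scale_linear (index_free A)"
  unfolding scale_linear_def
proof (intro allI impI ballI)
  fix \<alpha> x assume "\<alpha>s < \<alpha>" and x: "x \<in> E \<alpha>"
  obtain \<beta> where \<beta>: "\<alpha>s < \<beta>" "\<beta> < \<alpha>" using \<open>\<alpha>s < \<alpha>\<close> dense by blast
  interpret banach_carrier smul "E \<alpha>" "N \<alpha>" using \<open>\<alpha>s < \<alpha>\<close> by (rule carrier)
  have bl: "A \<alpha> \<beta> (x + y) = A \<alpha> \<beta> x + A \<alpha> \<beta> y" "A \<alpha> \<beta> (smul c x) = smul c (A \<alpha> \<beta> x)" if "y \<in> E \<alpha>" for y c
    using scale_ops_bounded_linear[OF A \<beta>] x that unfolding bounded_linear_on_def by blast+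
  have eq: "index_free A y = A \<alpha> \<beta> y" if "y \<in> E \<alpha>" for y using index_free_eq[OF A \<beta> that] by simp
  show "(\<forall>y\<in>E \<alpha>. index_free A (x + y) = index_free A x + index_free A y) \<and>
      (\<forall>c. index_free A (smul c x) = smul c (index_free A x))"
    using bl x by (auto simp: eq mem_add[OF x] mem_scale[OF x])
qed

lemma bounded_by_index_free:
  assumes A: "A \<in> scale_ops smul \<alpha>s E N" and \<alpha>: "\<alpha>s < \<beta>" "\<beta> < \<alpha>"
    and C: "onorm_on (E \<alpha>) (N \<alpha>) (N \<beta>) (A \<alpha> \<beta>) \<le> C"
  shows "bounded_by (index_free A) \<alpha> \<beta> C"
  unfolding bounded_by_def
proof (intro ballI)
  fix x assume x: "x \<in> E \<alpha>"
  interpret X: banach_carrier smul "E \<alpha>" "N \<alpha>" using \<alpha> by (intro carrier) auto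
  interpret Y: banach_carrier smul "E \<beta>" "N \<beta>" using \<alpha> by (intro carrier)
  note bl = scale_ops_bounded_linear[OF A \<alpha>]
  have "A \<alpha> \<beta> x \<in> E \<beta>" using bl x unfolding bounded_linear_on_def by blast
  moreover have "N \<beta> (A \<alpha> \<beta> x) \<le> C * N \<alpha> x"
    using onorm_on_bound[OF X.banach_carrier_axioms Y.banach_carrier_axioms bl x]
      mult_right_mono[OF C X.q_nonneg[OF x]] by linarith
  ultimately show "index_free A x \<in> E \<beta> \<and> N \<beta> (index_free A x) \<le> C * N \<alpha> x"
    using index_free_eq[OF A \<alpha> x] by simp
qed

lemma cont_cong:
  assumes "\<alpha>s < \<beta>" "norm_continuous_on (N \<beta>) S f" "\<And>z. z \<in> S \<Longrightarrow> f z = g z"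
  shows "norm_continuous_on (N \<beta>) S (g :: 'z::{first_countable_topology, t2_space} \<Rightarrow> 'a)"
proof -
  interpret banach_carrier smul "E \<beta>" "N \<beta>" using assms(1) by (rule carrier)
  show ?thesis using assms(2,3) unfolding cont_iff by auto
qed

end

locale scale_evolution = scale +
  fixes V :: "real \<Rightarrow> real \<Rightarrow> 'b opfam" and B :: "real \<Rightarrow> 'b opfam" and K :: real and M :: "real \<Rightarrow> real"
  assumes A2: "A2_star smul \<alpha>s E N V" and A4: "A4_star \<alpha>s E N K V"
    and B: "\<And>t. 0 \<le> t \<Longrightarrow> B t \<in> scale_ops smul \<alpha>s E N"
    and B1: "B1 \<alpha>s E N B" and B2: "B2 \<alpha>s E N M B"
begin

definition v :: "real \<times> real \<Rightarrow> 'b \<Rightarrow> 'b" where "v = (\<lambda>(s, t). index_free (V s t))"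

definition b :: "real \<Rightarrow> 'b \<Rightarrow> 'b" where "b t = index_free (B t)"

lemma V_ops: "0 \<le> s \<Longrightarrow> s \<le> t \<Longrightarrow> V s t \<in> scale_ops smul \<alpha>s E N"
  using A2 by (simp add: A2_star_def)

lemma V_eq: "0 \<le> s \<Longrightarrow> s \<le> t \<Longrightarrow> \<alpha>s < \<beta> \<Longrightarrow> \<beta> < \<alpha> \<Longrightarrow> k \<in> E \<alpha> \<Longrightarrow> V s t \<alpha> \<beta> k = v (s, t) k"
  using index_free_eq[OF V_ops] by (simp add: v_def)

lemma B_eq: "0 \<le> t \<Longrightarrow> \<alpha>s < \<beta> \<Longrightarrow> \<beta> < \<alpha> \<Longrightarrow> k \<in> E \<alpha> \<Longrightarrow> B t \<alpha> \<beta> k = b t k"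
  using index_free_eq[OF B] by (simp add: b_def)

lemma v_bounded_by: "0 \<le> s \<Longrightarrow> s \<le> t \<Longrightarrow> \<alpha>s < \<beta> \<Longrightarrow> \<beta> < \<alpha> \<Longrightarrow> bounded_by (v (s, t)) \<alpha> \<beta> K"
  using bounded_by_index_free[OF V_ops] A4 by (simp add: v_def A4_star_def)

lemma b_bounded_by: "0 \<le> t \<Longrightarrow> \<alpha>s < \<beta> \<Longrightarrow> \<beta> < \<alpha> \<Longrightarrow> bounded_by (b t) \<alpha> \<beta> (M \<alpha> / (\<alpha> - \<beta>))"
  using bounded_by_index_free[OF B] B2 by (simp add: b_def B2_def)

lemma K1: "1 \<le> K"
  using A4 by (simp add: A4_star_def)

lemma M_nonneg': "\<alpha>s < \<alpha> \<Longrightarrow> 0 \<le> M \<alpha>"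
  using B2 by (simp add: B2_def)

lemma strong_b: "strong_family {0..} b"
  unfolding strong_family_def
proof (intro conjI ballI allI impI)
  show "scale_linear (b z)" if "z \<in> {0..}" for z
    using that by (auto simp: b_def intro!: scale_linear_index_free B)
  fix \<beta> \<alpha> Q assume *: "\<alpha>s < \<beta> \<and> \<beta> < \<alpha> \<and> compact Q \<and> Q \<subseteq> {0::real..}"
  show "\<exists>C\<ge>0. \<forall>z\<in>Q. bounded_by (b z) \<alpha> \<beta> C"
    using * M_nonneg'[of \<alpha>] by (intro exI[of _ "M \<alpha> / (\<alpha> - \<beta>)"]) (auto intro!: b_bounded_by)
next
  fix \<beta> \<alpha> k assume *: "\<alpha>s < \<beta> \<and> \<beta> < \<alpha> \<and> k \<in> E \<alpha>"
  then have "norm_continuous_on (N \<beta>) {0..} (\<lambda>t. B t \<alpha> \<beta> k)" using B1 by (simp add: B1_def)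
  then show "norm_continuous_on (N \<beta>) {0..} (\<lambda>t. b t k)"
    using * by (elim cont_cong[rotated]) (auto intro!: B_eq)
qed

lemma strong_v: "strong_family time_pairs v"
  unfolding strong_family_def
proof (intro conjI ballI allI impI)
  show "scale_linear (v z)" if "z \<in> time_pairs" for z
    using that by (auto simp: v_def intro!: scale_linear_index_free V_ops)
  fix \<beta> \<alpha> Q assume *: "\<alpha>s < \<beta> \<and> \<beta> < \<alpha> \<and> compact Q \<and> Q \<subseteq> time_pairs"
  show "\<exists>C\<ge>0. \<forall>z\<in>Q. bounded_by (v z) \<alpha> \<beta> C"
    using * K1 by (intro exI[of _ K]) (auto intro!: v_bounded_by)
next
  fix \<beta> \<alpha> k assume *: "\<alpha>s < \<beta> \<and> \<beta> < \<alpha> \<and> k \<in> E \<alpha>"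
  then have "norm_continuous_on (N \<beta>) time_pairs (\<lambda>(s, t). V s t \<alpha> \<beta> k)"
    using A2 by (simp add: A2_star_def)
  then show "norm_continuous_on (N \<beta>) time_pairs (\<lambda>z. v z k)"
    using * by (elim cont_cong[rotated]) (auto intro!: V_eq)
qed

sublocale perturbed_evolution smul \<alpha>s E N b v K M
proof
  show "strong_family {0..} b" by (rule strong_b)
  show "strong_family time_pairs v" by (rule strong_v)
  show "v (t, t) k = k" if "\<alpha>s < \<alpha>" "k \<in> E \<alpha>" "0 \<le> t" for \<alpha> k t
  proof -
    obtain \<beta> where \<beta>: "\<alpha>s < \<beta>" "\<beta> < \<alpha>" using \<open>\<alpha>s < \<alpha>\<close> dense by blast
    have "V t t \<alpha> \<beta> k = k" using A2 that \<beta> by (simp add: A2_star_def)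
    then show ?thesis using V_eq[of t t \<beta> \<alpha> k] that \<beta> by simp
  qed
  show "N \<beta> (v (s, t) k) \<le> K * N \<alpha> k" if "\<alpha>s < \<beta>" "\<beta> < \<alpha>" "0 \<le> s" "s \<le> t" "k \<in> E \<alpha>" for \<beta> \<alpha> s t k
    using bounded_byD(2)[OF v_bounded_by] that by blast
  show "N \<beta> (b t k) \<le> M \<alpha> / (\<alpha> - \<beta>) * N \<alpha> k" if "\<alpha>s < \<beta>" "\<beta> < \<alpha>" "0 \<le> t" "k \<in> E \<alpha>" for \<beta> \<alpha> t k
    using bounded_byD(2)[OF b_bounded_by] that by blast
  show "M \<beta> \<le> M \<alpha>" if "\<alpha>s < \<beta>" "\<beta> \<le> \<alpha>" for \<beta> \<alpha>
    using B2 that by (auto simp: B2_def mono_on_def)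
qed (use K1 M_nonneg' in auto)

abbreviation T :: "real \<Rightarrow> real \<Rightarrow> ereal" where "T \<equiv> horizon K M"

lemma less_horizon_iff:
  assumes "\<alpha>s < \<beta>" "\<beta> < \<alpha>"
  shows "ereal \<tau> < T \<beta> \<alpha> \<longleftrightarrow> rate \<beta> \<alpha> * \<tau> < 1"
proof (cases "M \<alpha> = 0")
  case False
  then have "0 < M \<alpha>" using M_nonneg[of \<alpha>] assms by simp
  then have "0 < 2 * K * exp 1 * M \<alpha>" using K_ge_1 by simp
  then show ?thesis using False assms by (simp add: horizon_def rate_def field_simps)
qed (simp add: horizon_def rate_def)

lemma horizon_bound:
  assumes "\<alpha>s < \<beta>" "\<beta> < \<alpha>" "rate \<beta> \<alpha> * \<tau> < 1"
  shows "(if T \<beta> \<alpha> = \<infinity> then 1 else real_of_ereal (T \<beta> \<alpha>) / (real_of_ereal (T \<beta> \<alpha>) - \<tau>)) * K =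
    K / (1 - rate \<beta> \<alpha> * \<tau>)"
proof (cases "M \<alpha> = 0")
  case False
  then have "0 < M \<alpha>" using M_nonneg[of \<alpha>] assms by simp
  then have D: "0 < 2 * K * exp 1 * M \<alpha>" using K_ge_1 by simp
  define D where "D = 2 * K * exp 1 * M \<alpha>"
  define h where "h = \<alpha> - \<beta>"
  have "0 < D" "0 < h" using D assms by (auto simp: D_def h_def)
  have r: "rate \<beta> \<alpha> = D / h" by (simp add: rate_def D_def h_def)
  have T: "T \<beta> \<alpha> = ereal (h / D)" using False by (simp add: horizon_def D_def h_def)
  have "D * \<tau> < h" using assms(3) \<open>0 < h\<close> by (simp add: r field_simps)
  moreover have "h / D - \<tau> = (h - D * \<tau>) / D" "1 - D / h * \<tau> = (h - D * \<tau>) / h"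
    using \<open>0 < D\<close> \<open>0 < h\<close> by (auto simp: field_simps)
  ultimately show ?thesis
    unfolding r T using \<open>0 < D\<close> \<open>0 < h\<close> by simp
qed (simp add: horizon_def rate_def)

lemma comp_BV:
  assumes "\<alpha>s < \<gamma>" "\<gamma> < \<alpha>" "0 \<le> r" "r \<le> t" "k \<in> E \<alpha>"
  shows "scale_comp (B r) (V r t) \<alpha> \<gamma> k = b r (v (r, t) k)"
proof -
  let ?m = "(\<gamma> + \<alpha>) / 2"
  have m: "\<gamma> < ?m" "?m < \<alpha>" "\<alpha>s < ?m" using assms by auto
  have "v (r, t) k \<in> E ?m" using assms m by (intro strong_mem[OF strong_v]) auto
  then show ?thesis using V_eq[of r t ?m \<alpha> k] B_eq[of r \<gamma> ?m "v (r, t) k"] assms m by (simp add: scale_comp_def)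
qed

lemma comp_VB:
  assumes "\<alpha>s < \<beta>" "\<beta> < \<gamma>" "0 \<le> s" "s \<le> r" "x \<in> E \<gamma>"
  shows "scale_comp (V s r) (B r) \<gamma> \<beta> x = v (s, r) (b r x)"
proof -
  let ?m = "(\<beta> + \<gamma>) / 2"
  have m: "\<beta> < ?m" "?m < \<gamma>" "\<alpha>s < ?m" using assms by auto
  have "b r x \<in> E ?m" using assms m by (intro strong_mem[OF strong_b]) auto
  then show ?thesis using V_eq[of s r \<beta> ?m "b r x"] B_eq[of r ?m \<gamma> x] assms m by (simp add: scale_comp_def)
qed

lemma admissibleI:
  assumes "local_family smul \<alpha>s E N T U" "continuous_bounded_family \<alpha>s E N K T U" "consistent_family \<alpha>s E T U"
  shows "admissible U"
  unfolding admissible_def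
proof (intro conjI allI impI ballI)
  fix \<beta> \<alpha> s t k
  assume *: "\<alpha>s < \<beta> \<and> \<beta> < \<alpha> \<and> 0 \<le> s \<and> s \<le> t \<and> rate \<beta> \<alpha> * (t - s) < 1" and k: "k \<in> E \<alpha>"
  then have T: "ereal (t - s) < T \<beta> \<alpha>" using less_horizon_iff by blast
  then have bl: "bounded_linear_on smul (E \<alpha>) (N \<alpha>) (E \<beta>) (N \<beta>) (U s t \<alpha> \<beta>)"
    using assms(1) * unfolding local_family_def by blast
  then show "U s t \<alpha> \<beta> k \<in> E \<beta>" using k unfolding bounded_linear_on_def by blast
  have "onorm_on (E \<alpha>) (N \<alpha>) (N \<beta>) (U s t \<alpha> \<beta>) \<le>
      (if T \<beta> \<alpha> = \<infinity> then 1 else real_of_ereal (T \<beta> \<alpha>) / (real_of_ereal (T \<beta> \<alpha>) - (t - s))) * K"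
    using assms(2) * T unfolding continuous_bounded_family_def by blast
  then have C: "onorm_on (E \<alpha>) (N \<alpha>) (N \<beta>) (U s t \<alpha> \<beta>) \<le> K / (1 - rate \<beta> \<alpha> * (t - s))"
    using horizon_bound[of \<beta> \<alpha> "t - s"] * by simp
  have "N \<beta> (U s t \<alpha> \<beta> k) \<le> onorm_on (E \<alpha>) (N \<alpha>) (N \<beta>) (U s t \<alpha> \<beta>) * N \<alpha> k"
    using * by (intro onorm_on_bound[OF carrier carrier bl k]) auto
  also have "\<dots> \<le> K / (1 - rate \<beta> \<alpha> * (t - s)) * N \<alpha> k"
    using * k by (intro mult_right_mono[OF C] norm_nonneg) auto
  finally show "N \<beta> (U s t \<alpha> \<beta> k) \<le> K / (1 - rate \<beta> \<alpha> * (t - s)) * N \<alpha> k" .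
next
  fix \<beta> \<gamma> \<alpha> s t k
  assume *: "\<alpha>s < \<beta> \<and> \<beta> < \<gamma> \<and> \<gamma> < \<alpha> \<and> 0 \<le> s \<and> s \<le> t \<and> rate \<gamma> \<alpha> * (t - s) < 1" and k: "k \<in> E \<alpha>"
  have "rate \<beta> \<alpha> * (t - s) < 1"
    using * mult_right_mono[OF rate_le[of \<alpha> \<beta> \<gamma>], of "t - s"] by auto
  then have "ereal (t - s) < min (T \<beta> \<alpha>) (T \<gamma> \<alpha>)" using * less_horizon_iff[of \<beta> \<alpha>] less_horizon_iff[of \<gamma> \<alpha>] by simp
  then show "U s t \<alpha> \<beta> k = U s t \<alpha> \<gamma> k"
    using assms(3) * k unfolding consistent_family_def by blast
next
  fix \<beta> \<gamma> \<alpha> s t k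
  assume *: "\<alpha>s < \<beta> \<and> \<beta> < \<gamma> \<and> \<gamma> < \<alpha> \<and> 0 \<le> s \<and> s \<le> t \<and> rate \<beta> \<alpha> * (t - s) < 1 \<and> rate \<beta> \<gamma> * (t - s) < 1"
    and k: "k \<in> E \<alpha>"
  then have "ereal (t - s) < min (T \<beta> \<alpha>) (T \<beta> \<gamma>)" using less_horizon_iff[of \<beta> \<alpha>] less_horizon_iff[of \<beta> \<gamma>] by simp
  then show "U s t \<alpha> \<beta> k = U s t \<gamma> \<beta> k"
    using assms(3) * k unfolding consistent_family_def by blast
qed

text \<open>Membership in the index sets and the composite operators are translated into \<open>rate\<close> and the
  index-free maps; the integral is then determined by the equation.\<close>

lemma duhamel_WBV_iff: "duhamel_WBV smul \<alpha>s E N T V B U \<longleftrightarrow> solves_WBV U"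
proof -
  have eq: "(\<exists>I. has_int_in \<beta> (\<lambda>r. U s r \<gamma> \<beta> (scale_comp (B r) (V r t) \<alpha> \<gamma> k)) I s t \<and> U s t \<alpha> \<beta> k = V s t \<alpha> \<beta> k + I) \<longleftrightarrow>
      has_int_in \<beta> (\<lambda>r. U s r \<gamma> \<beta> (b r (v (r, t) k))) (U s t \<alpha> \<beta> k - v (s, t) k) s t"
    if "\<alpha>s < \<beta>" "\<beta> < \<gamma>" "\<gamma> < \<alpha>" "0 \<le> s" "s \<le> t" "k \<in> E \<alpha>" for \<beta> \<gamma> \<alpha> s t k
  proof -
    interpret banach_carrier smul "E \<beta>" "N \<beta>" using that by (intro carrier)
    have "has_int_in \<beta> (\<lambda>r. U s r \<gamma> \<beta> (scale_comp (B r) (V r t) \<alpha> \<gamma> k)) I s t \<longleftrightarrow>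
        has_int_in \<beta> (\<lambda>r. U s r \<gamma> \<beta> (b r (v (r, t) k))) I s t" for I
      using that by (intro iffI; elim has_int_cong) (auto simp: comp_BV)
    moreover have "V s t \<alpha> \<beta> k = v (s, t) k" using that by (intro V_eq) auto
    ultimately show ?thesis by (simp only: ex_eq_add_iff)
  qed
  have T: "ereal (t - s) < min (T \<beta> \<alpha>) (T \<beta> \<gamma>) \<longleftrightarrow> rate \<beta> \<alpha> * (t - s) < 1 \<and> rate \<beta> \<gamma> * (t - s) < 1"
    if "\<alpha>s < \<beta>" "\<beta> < \<gamma>" "\<gamma> < \<alpha>" for \<beta> \<gamma> \<alpha> s t
    using that less_horizon_iff[of \<beta> \<alpha>] less_horizon_iff[of \<beta> \<gamma>] by simp
  show ?thesis
    unfolding duhamel_WBV_def solves_WBV_def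
    by (intro iff_allI imp_cong ball_cong conj_cong refl; (rule T | (elim conjE, rule eq)); assumption)
qed

lemma duhamel_VBW_iff:
  assumes "admissible U"
  shows "duhamel_VBW smul \<alpha>s E N T V B U \<longleftrightarrow> solves_VBW U"
proof -
  have eq: "(\<exists>I. has_int_in \<beta> (\<lambda>r. scale_comp (V s r) (B r) \<gamma> \<beta> (U r t \<alpha> \<gamma> k)) I s t \<and> U s t \<alpha> \<beta> k = V s t \<alpha> \<beta> k + I) \<longleftrightarrow>
      has_int_in \<beta> (\<lambda>r. v (s, r) (b r (U r t \<alpha> \<gamma> k))) (U s t \<alpha> \<beta> k - v (s, t) k) s t"
    if "\<alpha>s < \<beta>" "\<beta> < \<gamma>" "\<gamma> < \<alpha>" "0 \<le> s" "s \<le> t" "rate \<gamma> \<alpha> * (t - s) < 1" "k \<in> E \<alpha>" for \<beta> \<gamma> \<alpha> s t k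
  proof -
    interpret banach_carrier smul "E \<beta>" "N \<beta>" using that by (intro carrier)
    have "U r t \<alpha> \<gamma> k \<in> E \<gamma>" if "r \<in> {s..t}" for r
    proof (rule admissibleD(1)[OF assms])
      have "rate \<gamma> \<alpha> * (t - r) \<le> rate \<gamma> \<alpha> * (t - s)"
        using that \<open>\<alpha>s < \<beta>\<close> \<open>\<beta> < \<gamma>\<close> \<open>\<gamma> < \<alpha>\<close> by (intro mult_left_mono rate_nonneg) auto
      then show "rate \<gamma> \<alpha> * (t - r) < 1" using \<open>rate \<gamma> \<alpha> * (t - s) < 1\<close> by simp
    qed (use that \<open>\<alpha>s < \<beta>\<close> \<open>\<beta> < \<gamma>\<close> \<open>\<gamma> < \<alpha>\<close> \<open>0 \<le> s\<close> \<open>k \<in> E \<alpha>\<close> in auto)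
    then have "has_int_in \<beta> (\<lambda>r. scale_comp (V s r) (B r) \<gamma> \<beta> (U r t \<alpha> \<gamma> k)) I s t \<longleftrightarrow>
        has_int_in \<beta> (\<lambda>r. v (s, r) (b r (U r t \<alpha> \<gamma> k))) I s t" for I
      using that by (intro iffI; elim has_int_cong) (auto simp: comp_VB)
    moreover have "V s t \<alpha> \<beta> k = v (s, t) k" using that by (intro V_eq) auto
    ultimately show ?thesis by (simp only: ex_eq_add_iff)
  qed
  have T: "ereal (t - s) < min (T \<beta> \<alpha>) (T \<gamma> \<alpha>) \<longleftrightarrow> rate \<gamma> \<alpha> * (t - s) < 1"
    if "\<alpha>s < \<beta>" "\<beta> < \<gamma>" "\<gamma> < \<alpha>" "s \<le> t" for \<beta> \<gamma> \<alpha> s t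
    using that less_horizon_iff[of \<beta> \<alpha>] less_horizon_iff[of \<gamma> \<alpha>]
      mult_right_mono[OF rate_le[of \<alpha> \<beta> \<gamma>], of "t - s"] by auto
  show ?thesis
    unfolding duhamel_VBW_def solves_VBW_def
    by (intro iff_allI imp_cong ball_cong conj_cong refl; (rule T | (elim conjE, rule eq)); assumption)
qed

definition W_family :: "real \<Rightarrow> real \<Rightarrow> 'b opfam"
  where "W_family s t \<alpha> \<beta> k = W (s, t) k"

lemma W_local_family: "local_family smul \<alpha>s E N T W_family"
  unfolding local_family_def
proof (intro allI impI)
  fix \<beta> \<alpha> s t assume *: "\<alpha>s < \<beta> \<and> \<beta> < \<alpha> \<and> 0 \<le> s \<and> s \<le> t \<and> ereal (t - s) < T \<beta> \<alpha>"
  then have r: "\<alpha>s < \<beta>" "\<beta> < \<alpha>" "0 \<le> s" "s \<le> t" "rate \<beta> \<alpha> * (t - s) < 1" using less_horizon_iff by auto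
  show "bounded_linear_on smul (E \<alpha>) (N \<alpha>) (E \<beta>) (N \<beta>) (W_family s t \<alpha> \<beta>)"
    unfolding bounded_linear_on_def W_family_def
    using W_limit(1)[OF r(1,2) _ r(3-5)] W_linear[OF r(1,2) _ r(3-5)] W_bound[OF r(1,2) _ r(3-5)]
    by (intro conjI exI[of _ "K / (1 - rate \<beta> \<alpha> * (t - s))"]) (auto simp del: times_divide_eq_left)
qed

lemma W_continuous_bounded_family: "continuous_bounded_family \<alpha>s E N K T W_family"
  unfolding continuous_bounded_family_def
proof (intro allI impI conjI ballI)
  fix \<beta> \<alpha> assume *: "\<alpha>s < \<beta> \<and> \<beta> < \<alpha>"
  then have \<alpha>: "\<alpha>s < \<beta>" "\<beta> < \<alpha>" by auto
  show "norm_continuous_on (N \<beta>) {(s, t). 0 \<le> s \<and> s \<le> t \<and> ereal (t - s) < T \<beta> \<alpha>} (\<lambda>(s, t). W_family s t \<alpha> \<beta> k)"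
    if "k \<in> E \<alpha>" for k
    using W_continuous[OF \<alpha> that] less_horizon_iff[OF \<alpha>] by (simp add: W_family_def case_prod_beta')
  show "W_family t t \<alpha> \<beta> k = k" if "0 \<le> t" "k \<in> E \<alpha>" for t k
    unfolding W_family_def using that \<alpha> by (intro W_refl[of \<alpha>]) auto
  fix s t assume st: "0 \<le> s \<and> s \<le> t \<and> ereal (t - s) < T \<beta> \<alpha>"
  then have r: "rate \<beta> \<alpha> * (t - s) < 1" using less_horizon_iff[OF \<alpha>] by simp
  have "onorm_on (E \<alpha>) (N \<alpha>) (N \<beta>) (W_family s t \<alpha> \<beta>) \<le> K / (1 - rate \<beta> \<alpha> * (t - s))"
    unfolding W_family_def using \<alpha> st r K_ge_1
    by (intro onorm_on_least[OF carrier[of \<alpha>]] W_bound) auto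
  then show "onorm_on (E \<alpha>) (N \<alpha>) (N \<beta>) (W_family s t \<alpha> \<beta>) \<le>
      (if T \<beta> \<alpha> = \<infinity> then 1 else real_of_ereal (T \<beta> \<alpha>) / (real_of_ereal (T \<beta> \<alpha>) - (t - s))) * K"
    unfolding horizon_bound[OF \<alpha> r] .
qed

lemma W_consistent_family: "consistent_family \<alpha>s E T W_family"
  by (simp add: consistent_family_def W_family_def)

lemma W_solves_WBV: "solves_WBV W_family"
  unfolding solves_WBV_def W_family_def by (auto intro!: W_duhamel_WBV)

lemma W_solves_VBW: "solves_VBW W_family"
  unfolding solves_VBW_def W_family_def by (auto intro!: W_duhamel_VBW)

lemma W_admissible: "admissible W_family"
  by (intro admissibleI W_local_family W_continuous_bounded_family W_consistent_family)

end

theorem theorem3p10: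
  fixes smul :: "'k::real_normed_field \<Rightarrow> 'a::ab_group_add \<Rightarrow> 'a"
    and \<alpha>s :: real
    and E :: "real \<Rightarrow> 'a set"
    and N :: "real \<Rightarrow> 'a \<Rightarrow> real"
    and K :: real
    and M :: "real \<Rightarrow> real"
    and V :: "real \<Rightarrow> real \<Rightarrow> real \<Rightarrow> real \<Rightarrow> 'a \<Rightarrow> 'a"
    and B :: "real \<Rightarrow> real \<Rightarrow> real \<Rightarrow> 'a \<Rightarrow> 'a"
    and T :: "real \<Rightarrow> real \<Rightarrow> ereal"
  assumes "banach_scale smul \<alpha>s E N"
    and "A2_star smul \<alpha>s E N V"
    and "A4_star \<alpha>s E N K V"
    and "\<And>t. 0 \<le> t \<Longrightarrow> B t \<in> scale_ops smul \<alpha>s E N"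
    and "B1 \<alpha>s E N B"
    and "B2 \<alpha>s E N M B"
  defines "T \<equiv> horizon K M"
  shows "\<exists>W :: real \<Rightarrow> real \<Rightarrow> real \<Rightarrow> real \<Rightarrow> 'a \<Rightarrow> 'a.
    local_family smul \<alpha>s E N T W \<and>
    continuous_bounded_family \<alpha>s E N K T W \<and>
    consistent_family \<alpha>s E T W \<and>
    duhamel_WBV smul \<alpha>s E N T V B W \<and>
    (\<forall>W'. local_family smul \<alpha>s E N T W' \<and> continuous_bounded_family \<alpha>s E N K T W' \<and>
        consistent_family \<alpha>s E T W' \<and> duhamel_WBV smul \<alpha>s E N T V B W' \<longrightarrow>
      families_agree \<alpha>s E T W' W) \<and>
    duhamel_VBW smul \<alpha>s E N T V B W \<and>
    (\<forall>W'. local_family smul \<alpha>s E N T W' \<and> continuous_bounded_family \<alpha>s E N K T W' \<and>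
        consistent_family \<alpha>s E T W' \<and> duhamel_VBW smul \<alpha>s E N T V B W' \<longrightarrow>
      families_agree \<alpha>s E T W' W)"
proof -
  interpret vector_space smul using assms(1) by (simp add: banach_scale_def)
  interpret scale_evolution smul \<alpha>s E N V B K M by unfold_locales (rule assms | assumption)+
  show ?thesis
    unfolding T_def
  proof (intro exI[of _ W_family] conjI allI impI)
    show "duhamel_WBV smul \<alpha>s E N (horizon K M) V B W_family"
      using W_solves_WBV by (simp only: duhamel_WBV_iff)
    show "duhamel_VBW smul \<alpha>s E N (horizon K M) V B W_family"
      using W_solves_VBW by (simp only: duhamel_VBW_iff[OF W_admissible])
  next
    fix W' assume "local_family smul \<alpha>s E N (horizon K M) W' \<and> continuous_bounded_family \<alpha>s E N K (horizon K M) W' \<and>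
        consistent_family \<alpha>s E (horizon K M) W' \<and> duhamel_WBV smul \<alpha>s E N (horizon K M) V B W'"
    then have W': "admissible W'" "solves_WBV W'"
      using admissibleI[of W'] duhamel_WBV_iff[of W'] by blast+
    show "families_agree \<alpha>s E (horizon K M) W' W_family"
      unfolding families_agree_def
    proof (intro allI impI ballI, elim conjE)
      fix \<beta> \<alpha> s t k
      assume "\<alpha>s < \<beta>" "\<beta> < \<alpha>" "0 \<le> s" "s \<le> t" "ereal (t - s) < horizon K M \<beta> \<alpha>" "k \<in> E \<alpha>"
      then show "W' s t \<alpha> \<beta> k = W_family s t \<alpha> \<beta> k"
        using unique_WBV[OF W' W_admissible W_solves_WBV] less_horizon_iff by blast
    qed
  next
    fix W' assume *: "local_family smul \<alpha>s E N (horizon K M) W' \<and> continuous_bounded_family \<alpha>s E N K (horizon K M) W' \<and>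
        consistent_family \<alpha>s E (horizon K M) W' \<and> duhamel_VBW smul \<alpha>s E N (horizon K M) V B W'"
    then have W': "admissible W'" using admissibleI[of W'] by blast
    have "solves_VBW W'" using * duhamel_VBW_iff[OF W'] by blast
    note unique = unique_VBW[OF W' this W_admissible W_solves_VBW]
    show "families_agree \<alpha>s E (horizon K M) W' W_family"
      unfolding families_agree_def
    proof (intro allI impI ballI, elim conjE)
      fix \<beta> \<alpha> s t k
      assume "\<alpha>s < \<beta>" "\<beta> < \<alpha>" "0 \<le> s" "s \<le> t" "ereal (t - s) < horizon K M \<beta> \<alpha>" "k \<in> E \<alpha>"
      then show "W' s t \<alpha> \<beta> k = W_family s t \<alpha> \<beta> k"
        using unique less_horizon_iff by blast
    qed
  qed (rule W_local_family W_continuous_bounded_family W_consistent_family)+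
qed

end
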